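(* Let $S$ be a generalized left-symmetric algebra (with grading group $\Gamma$ and commutation factor $\epsilon$) and let $M$ be an $S$-bimodule, both finite-dimensional over a field $k$ of characteristic zero. Let $\mathfrak{g}_S$ be the associated $\epsilon$-Lie algebra of $S$. For $i\ge 0$ define $$\psi: C^{i}(\mathfrak{g}_{S},C^{1}(S,M))\to C^{i+1}(S,M),\qquad \psi(f)(x_1,\dots,x_i,x_{i+1})=f(x_1,\dots,x_i)(x_{i+1}),$$ (for $i=0$ this is the identity of $C^1(S,M)$). Then for every $i>0$ the map $\psi$ is an isomorphism of $\mathfrak{g}_S$-modules (with respect to the action $\xi$ on the source and $\rho$ on the target). Moreover, $\psi$ induces an isomorphism of cochain complexes between $\big(\bigoplus_{i\ge 0}C^{i}(\mathfrak{g}_S,C^1(S,M)),\mathfrak{d}\big)$ and $\big(\bigoplus_{i\ge 1}C^i(S,M),d\big)$ (with the shift $i\mapsto i+1$ of cochain degree), i.e. $\psi\circ\mathfrak{d}=d\circ\psi$ on $C^{i}(\mathfrak{g}_S,C^1(S,M))$ for all $i\ge0$. In particular, $$H^{i+1}(S,M)\cong H^{i}_{\mathrm{Lie}}(\mathfrak{g}_S,C^1(S,M))\quad\text{for all } i>0.$$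
   Context: All vector spaces are finite-dimensional over a field $k$ of characteristic zero. $\Gamma$ is an abelian group and $\epsilon:\Gamma\times\Gamma\to k^*$ is a commutation factor: $\epsilon(\alpha,\beta)\epsilon(\beta,\alpha)=1$, $\epsilon(\alpha,\beta+\gamma)=\epsilon(\alpha,\beta)\epsilon(\alpha,\gamma)$, $\epsilon(\alpha+\beta,\gamma)=\epsilon(\alpha,\gamma)\epsilon(\beta,\gamma)$. A generalized left-symmetric algebra is a $\Gamma$-graded nonassociative algebra $S=\bigoplus_{\gamma}S_\gamma$, $S_\alpha\cdot S_\beta\subseteq S_{\alpha+\beta}$, with $(x\cdot y)\cdot z-x\cdot(y\cdot z)=\epsilon(\alpha,\beta)((y\cdot x)\cdot z-y\cdot(x\cdot z))$ for $x\in S_\alpha,y\in S_\beta,z\in S$. An $S$-bimodule is a $\Gamma$-graded vector space $M$ with bilinear, grading-compatible left and right actions such that, for $x\in S_\alpha,y\in S_\beta,m\in M_\gamma$, $(x\cdot y)\cdot m-x\cdot(y\cdot m)=\epsilon(\alpha,\beta)((y\cdot x)\cdot m-y\cdot(x\cdot m))$ and $(x\cdot m)\cdot y-x\cdot(m\cdot y)=\epsilon(\alpha,\gamma)((m\cdot x)\cdot y-m\cdot(x\cdot y))$. An $\epsilon$-Lie algebra is a $\Gamma$-graded algebra with bracket satisfying, for $x,y,z$ homogeneous of degrees $\alpha,\beta,\gamma$, $[x,y]=-\epsilon(\alpha,\beta)[y,x]$ and $\epsilon(\alpha,\gamma)[x,[y,z]]+\text{cyclic}=0$. The associated $\epsilon$-Lie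 algebra $\mathfrak{g}_S$ is $S$ with $[x,y]=x\cdot y-\epsilon(\alpha,\beta)y\cdot x$ for $x\in S_\alpha$, $y\in S_\beta$. A left $\mathfrak g$-module is a $\Gamma$-graded space $\mathfrak M$ with a bilinear, grading-compatible action $(x,m)\mapsto[x,m]$ with $[[x,y],m]=[x,[y,m]]-\epsilon(\alpha,\beta)[y,[x,m]]$ for $x\in\mathfrak g_\alpha,y\in\mathfrak g_\beta$. For a $\Gamma$-graded space $V$, $\wedge_\epsilon V$ is the quotient of the tensor algebra $T(V)$ by the two-sided ideal generated by $m\otimes n+\epsilon(\alpha,\beta)n\otimes m$ ($m\in V_\alpha$, $n\in V_\beta$), and $\wedge^i_\epsilon V$ is the image of $V^{\otimes i}$ ($\wedge^0_\epsilon V=k$). $\mathrm{Hom}=\bigoplus_\gamma\mathrm{Hom}_\gamma$, where $\mathrm{Hom}_\gamma$ denotes homogeneous linear maps of degree $\gamma$. For $i\ge0$, $C^{i+1}(S,M)=\mathrm{Hom}(\wedge^i_\epsilon S\otimes S,M)$. Below $x\in S_\alpha$, $x_s\in S_{\alpha_s}$, $\hat x$ denotes omission. Action $\rho$ of $\mathfrak g_S$ on $C^{i+1}(S,M)$: for $f$ of degree $\beta$, $$\begin{aligned}(\rho(x)f)(x_1,\dots,x_{i+1})={}&x\cdot f(x_1,\dots,x_{i+1})-\epsilon(\alpha,\beta+\alpha_1+\cdots+\alpha_i)f(x_1,\dots,x_i,x\cdot x_{i+1})\\&+\epsilon(\alpha,\beta+\alpha_1+\cdots+\alpha_i)f(x_1,\dots,x_i,x)\cdot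 x_{i+1}\\&-\sum_{s=1}^i\epsilon(\alpha,\beta+\alpha_1+\cdots+\alpha_{s-1})f(x_1,\dots,x_{s-1},[x,x_s],\dots,x_i,x_{i+1}).\end{aligned}$$ In particular, on $C^1(S,M)=\mathrm{Hom}(S,M)$: $[x,f](x_1)=x\cdot f(x_1)-\epsilon(\alpha,\beta)f(x\cdot x_1)+\epsilon(\alpha,\beta)f(x)\cdot x_1$. Coboundary $d$: for $f\in C^i(S,M)$, $i\ge1$, of degree $\beta$, $$\begin{aligned}(df)(x_1,\dots,x_{i+1})={}&-\sum_{t=1}^i(-1)^t\epsilon(\beta+\alpha_1+\cdots+\alpha_{t-1},\alpha_t)\,x_t\cdot f(x_1,\dots,\hat x_t,\dots,x_{i+1})\\&+\sum_{t=1}^i(-1)^t\epsilon(\alpha_t,\alpha_{t+1}+\cdots+\alpha_i)f(x_1,\dots,\hat x_t,\dots,x_i,x_t\cdot x_{i+1})\\&-\sum_{t=1}^i(-1)^t\epsilon(\alpha_t,\alpha_{t+1}+\cdots+\alpha_i)f(x_1,\dots,\hat x_t,\dots,x_i,x_t)\cdot x_{i+1}\\&+\sum_{1\le t<j\le i}(-1)^t\epsilon(\alpha_t,\alpha_{t+1}+\cdots+\alpha_{j-1})f(x_1,\dots,\hat x_t,\dots,x_{j-1},[x_t,x_j],\dots,x_{i+1}).\end{aligned}$$ For $n\ge2$, $H^n(S,M)=\ker(d|_{C^n(S,M)})/d(C^{n-1}(S,M))$. For an $\epsilon$-Lie algebra $\mathfrak g$ and a left module $\mathfrak M$: $C^i(\mathfrak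 g,\mathfrak M)=\mathrm{Hom}(\wedge^i_\epsilon\mathfrak g,\mathfrak M)$, with $\mathfrak g$-action, for $f$ of degree $\beta$, $$(\xi(x)f)(x_1,\dots,x_i)=[x,f(x_1,\dots,x_i)]-\sum_{j=1}^i\epsilon(\alpha,\beta+\alpha_1+\cdots+\alpha_{j-1})f(x_1,\dots,x_{j-1},[x,x_j],\dots,x_i),$$ and Chevalley–Eilenberg coboundary $$\begin{aligned}(\mathfrak d f)(x_1,\dots,x_{i+1})={}&-\sum_{t=1}^{i+1}(-1)^t\epsilon(\beta+\alpha_1+\cdots+\alpha_{t-1},\alpha_t)[x_t,f(x_1,\dots,\hat x_t,\dots,x_{i+1})]\\&+\sum_{1\le t<j\le i+1}(-1)^t\epsilon(\alpha_t,\alpha_{t+1}+\cdots+\alpha_{j-1})f(x_1,\dots,\hat x_t,\dots,x_{j-1},[x_t,x_j],\dots,x_{i+1}).\end{aligned}$$ $H^i_{\mathrm{Lie}}(\mathfrak g,\mathfrak M)$ is the cohomology of $(\bigoplus_{i\ge 0} C^i(\mathfrak g,\mathfrak M),\mathfrak d)$. *)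

theory Defs
  imports Complex_Main "HOL-Library.Poly_Mapping" "HOL-Library.Function_Algebras"
begin

section \<open>Graded vector spaces\<close>

text \<open>
  The spaces \<open>S\<close>, \<open>M\<close> and all spaces of maps live on types of class \<^class>\<open>ab_group_add\<close>.
  Exterior powers, tensor products and cohomology spaces consist of cosets, i.e. they live on
  a type \<open>'a set\<close> that carries no suitable class instance; this is why addition is a field
  of the record.
\<close>

record ('k, 'g, 'v) gspace =
  carrier :: "'v set"
  vadd :: "'v \<Rightarrow> 'v \<Rightarrow> 'v"
  vscale :: "'k \<Rightarrow> 'v \<Rightarrow> 'v"
  grade :: "'g \<Rightarrow> 'v set"

definition graded_space :: "('k::field, 'g, 'v::ab_group_add, 'z) gspace_scheme \<Rightarrow> bool" where
  "graded_space V \<longleftrightarrow>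
     vadd V = (+) \<and> vector_space (vscale V) \<and>
     (\<forall>\<gamma>. module.subspace (vscale V) (grade V \<gamma>)) \<and>
     carrier V = module.span (vscale V) (\<Union>\<gamma>. grade V \<gamma>) \<and>
     (\<forall>c. finite {\<gamma>. c \<gamma> \<noteq> 0} \<longrightarrow> (\<forall>\<gamma>. c \<gamma> \<in> grade V \<gamma>) \<longrightarrow>
        (\<Sum>\<gamma> | c \<gamma> \<noteq> 0. c \<gamma>) = 0 \<longrightarrow> (\<forall>\<gamma>. c \<gamma> = 0))"

definition finite_dim :: "('k::field, 'g, 'v::ab_group_add, 'z) gspace_scheme \<Rightarrow> bool" where
  "finite_dim V \<longleftrightarrow> (\<exists>B. finite B \<and> carrier V = module.span (vscale V) B)"

definition homog_part :: "('k, 'g, 'v::ab_group_add, 'z) gspace_scheme \<Rightarrow> 'v \<Rightarrow> 'g \<Rightarrow> 'v" where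
  "homog_part V v = (THE c. finite {\<gamma>. c \<gamma> \<noteq> 0} \<and> (\<forall>\<gamma>. c \<gamma> \<in> grade V \<gamma>) \<and>
     v = (\<Sum>\<gamma> | c \<gamma> \<noteq> 0. c \<gamma>))"

text \<open>Additive extension of an assignment \<open>F \<gamma> : V\<^sub>\<gamma> \<rightarrow> B\<close> given on homogeneous elements;
  it is used for every operation that is prescribed on homogeneous arguments only.\<close>

definition hsum :: "('k, 'g, 'v::ab_group_add, 'z) gspace_scheme \<Rightarrow> 'v \<Rightarrow>
    ('g \<Rightarrow> 'v \<Rightarrow> 'b::comm_monoid_add) \<Rightarrow> 'b" where
  "hsum V v F = (\<Sum>\<gamma> | homog_part V v \<gamma> \<noteq> 0. F \<gamma> (homog_part V v \<gamma>))"

definition linear_iso :: "('k, 'g, 'v, 'y) gspace_scheme \<Rightarrow> ('k, 'h, 'w, 'z) gspace_scheme \<Rightarrow>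
    ('v \<Rightarrow> 'w) \<Rightarrow> bool" where
  "linear_iso V W \<phi> \<longleftrightarrow>
     bij_betw \<phi> (carrier V) (carrier W) \<and>
     (\<forall>x\<in>carrier V. \<forall>y\<in>carrier V. \<phi> (vadd V x y) = vadd W (\<phi> x) (\<phi> y)) \<and>
     (\<forall>c. \<forall>x\<in>carrier V. \<phi> (vscale V c x) = vscale W c (\<phi> x))"

definition isomorphic :: "('k, 'g, 'v, 'y) gspace_scheme \<Rightarrow> ('k, 'h, 'w, 'z) gspace_scheme \<Rightarrow> bool"
  where "isomorphic V W \<longleftrightarrow> (\<exists>\<phi>. linear_iso V W \<phi>)"

definition coset :: "'v::ab_group_add set \<Rightarrow> 'v \<Rightarrow> 'v set" where
  "coset U x = {y. y - x \<in> U}"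

definition quotient_space :: "('k, 'g, 'v::ab_group_add, 'z) gspace_scheme \<Rightarrow> 'v set \<Rightarrow>
    ('k, 'g, 'v set) gspace" where
  "quotient_space V U =
     \<lparr> carrier = coset U ` carrier V,
       vadd = (\<lambda>X Y. \<Union>x\<in>X. \<Union>y\<in>Y. coset U (x + y)),
       vscale = (\<lambda>c X. \<Union>x\<in>X. coset U (vscale V c x)),
       grade = (\<lambda>\<gamma>. coset U ` grade V \<gamma>) \<rparr>"

text \<open>Homogeneous linear maps of degree \<open>\<gamma>\<close>, and \<open>Hom = \<Oplus>\<^sub>\<gamma> Hom\<^sub>\<gamma>\<close>. Maps are set to \<open>0\<close>
  off the carrier of their domain, so that equality of functions is equality of maps.\<close>

definition hom_deg :: "('k, 'g::ab_group_add, 'v, 'y) gspace_scheme \<Rightarrow>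
    ('k, 'g, 'w::ab_group_add, 'z) gspace_scheme \<Rightarrow> 'g \<Rightarrow> ('v \<Rightarrow> 'w) set" where
  "hom_deg V W \<gamma> = {f.
     (\<forall>x\<in>carrier V. f x \<in> carrier W) \<and>
     (\<forall>x\<in>carrier V. \<forall>y\<in>carrier V. f (vadd V x y) = f x + f y) \<and>
     (\<forall>c. \<forall>x\<in>carrier V. f (vscale V c x) = vscale W c (f x)) \<and>
     (\<forall>\<alpha>. \<forall>x\<in>grade V \<alpha>. f x \<in> grade W (\<alpha> + \<gamma>)) \<and>
     (\<forall>x. x \<notin> carrier V \<longrightarrow> f x = 0)}"

definition graded_hom :: "('k::field, 'g::ab_group_add, 'v, 'y) gspace_scheme \<Rightarrow>
    ('k, 'g, 'w::ab_group_add, 'z) gspace_scheme \<Rightarrow> ('k, 'g, 'v \<Rightarrow> 'w) gspace" where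
  "graded_hom V W =
     \<lparr> carrier = module.span (\<lambda>c f x. vscale W c (f x)) (\<Union>\<gamma>. hom_deg V W \<gamma>),
       vadd = (+),
       vscale = (\<lambda>c f x. vscale W c (f x)),
       grade = hom_deg V W \<rparr>"


section \<open>Tensor products and \<open>\<epsilon>\<close>-exterior powers\<close>

definition free_scale :: "'k::field \<Rightarrow> ('x \<Rightarrow>\<^sub>0 'k) \<Rightarrow> ('x \<Rightarrow>\<^sub>0 'k)" where
  "free_scale c = Poly_Mapping.map ((*) c)"

definition free_gen :: "'x \<Rightarrow> ('x \<Rightarrow>\<^sub>0 'k::field)" where
  "free_gen x = Poly_Mapping.single x 1"

definition tensor_rel :: "('k::field, 'g, 'v, 'y) gspace_scheme \<Rightarrow> ('k, 'g, 'w, 'z) gspace_scheme \<Rightarrow>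
    ('v \<times> 'w \<Rightarrow>\<^sub>0 'k) set" where
  "tensor_rel V W = module.span free_scale
     ({free_gen (vadd V x x', y) - free_gen (x, y) - free_gen (x', y) | x x' y.
         x \<in> carrier V \<and> x' \<in> carrier V \<and> y \<in> carrier W} \<union>
      {free_gen (x, vadd W y y') - free_gen (x, y) - free_gen (x, y') | x y y'.
         x \<in> carrier V \<and> y \<in> carrier W \<and> y' \<in> carrier W} \<union>
      {free_gen (vscale V c x, y) - free_scale c (free_gen (x, y)) | c x y.
         x \<in> carrier V \<and> y \<in> carrier W} \<union>
      {free_gen (x, vscale W c y) - free_scale c (free_gen (x, y)) | c x y.
         x \<in> carrier V \<and> y \<in> carrier W})"

definition tensor_space :: "('k::field, 'g::ab_group_add, 'v, 'y) gspace_scheme \<Rightarrow>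
    ('k, 'g, 'w, 'z) gspace_scheme \<Rightarrow> ('k, 'g, ('v \<times> 'w \<Rightarrow>\<^sub>0 'k) set) gspace" where
  "tensor_space V W = quotient_space
     \<lparr> carrier = module.span free_scale {free_gen (x, y) | x y. x \<in> carrier V \<and> y \<in> carrier W},
       vadd = (+),
       vscale = free_scale,
       grade = (\<lambda>\<gamma>. module.span free_scale
         {free_gen (x, y) | x y \<alpha> \<beta>. x \<in> grade V \<alpha> \<and> y \<in> grade W \<beta> \<and> \<alpha> + \<beta> = \<gamma>}) \<rparr>
     (tensor_rel V W)"

definition tensor :: "('k::field, 'g, 'v, 'y) gspace_scheme \<Rightarrow> ('k, 'g, 'w, 'z) gspace_scheme \<Rightarrow>
    'v \<Rightarrow> 'w \<Rightarrow> ('v \<times> 'w \<Rightarrow>\<^sub>0 'k) set" where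
  "tensor V W x y = coset (tensor_rel V W) (free_gen (x, y))"

text \<open>With concatenation as addition of words, \<open>'v list \<Rightarrow>\<^sub>0 'k\<close> is (as a monoid algebra) the free
  associative algebra on the set \<open>'v\<close>; its product is \<open>free_gen xs * free_gen ys = free_gen (xs @ ys)\<close>.\<close>

instantiation list :: (type) monoid_add
begin
definition zero_list :: "'a list" where "zero_list = []"
definition plus_list :: "'a list \<Rightarrow> 'a list \<Rightarrow> 'a list" where "plus_list = (@)"
instance by standard (simp_all add: zero_list_def plus_list_def)
end

definition two_sided_ideal :: "'a::ring_1 set \<Rightarrow> bool" where
  "two_sided_ideal I \<longleftrightarrow>
     0 \<in> I \<and> (\<forall>a\<in>I. \<forall>b\<in>I. a + b \<in> I) \<and> (\<forall>a\<in>I. \<forall>p. p * a \<in> I \<and> a * p \<in> I)"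

text \<open>The first two families of relations present the tensor algebra \<open>T(V)\<close> as a quotient of the
  free algebra on the set \<open>V\<close>, the third one is \<open>m \<otimes> n + \<epsilon>(\<alpha>,\<beta>) n \<otimes> m\<close>. So the quotient by
  this ideal is \<open>T(V)\<close> modulo the two-sided ideal defining the \<open>\<epsilon>\<close>-exterior algebra.\<close>

definition ext_ideal :: "('g \<Rightarrow> 'g \<Rightarrow> 'k::field) \<Rightarrow> ('k, 'g, 'v, 'z) gspace_scheme \<Rightarrow>
    ('v list \<Rightarrow>\<^sub>0 'k) set" where
  "ext_ideal \<epsilon> V = two_sided_ideal hull
     ({free_gen [vadd V x y] - free_gen [x] - free_gen [y] | x y.
         x \<in> carrier V \<and> y \<in> carrier V} \<union>
      {free_gen [vscale V c x] - free_scale c (free_gen [x]) | c x. x \<in> carrier V} \<union>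
      {free_gen [m] * free_gen [n] + free_scale (\<epsilon> \<alpha> \<beta>) (free_gen [n] * free_gen [m]) | m n \<alpha> \<beta>.
         m \<in> grade V \<alpha> \<and> n \<in> grade V \<beta>})"

definition ext_power :: "('g::ab_group_add \<Rightarrow> 'g \<Rightarrow> 'k::field) \<Rightarrow> ('k, 'g, 'v, 'z) gspace_scheme \<Rightarrow>
    nat \<Rightarrow> ('k, 'g, ('v list \<Rightarrow>\<^sub>0 'k) set) gspace" where
  "ext_power \<epsilon> V n = quotient_space
     \<lparr> carrier = module.span free_scale {free_gen xs | xs. length xs = n \<and> set xs \<subseteq> carrier V},
       vadd = (+),
       vscale = free_scale,
       grade = (\<lambda>\<gamma>. module.span free_scale
         {free_gen xs | xs \<alpha>s. length xs = n \<and> list_all2 (\<lambda>x \<alpha>. x \<in> grade V \<alpha>) xs \<alpha>s \<and>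
            sum_list \<alpha>s = \<gamma>}) \<rparr>
     (ext_ideal \<epsilon> V)"

definition wedge :: "('g \<Rightarrow> 'g \<Rightarrow> 'k::field) \<Rightarrow> ('k, 'g, 'v, 'z) gspace_scheme \<Rightarrow>
    'v list \<Rightarrow> ('v list \<Rightarrow>\<^sub>0 'k) set" where
  "wedge \<epsilon> V xs = coset (ext_ideal \<epsilon> V) (free_gen xs)"


section \<open>Generalized left-symmetric algebras and bimodules\<close>

definition commutation_factor :: "('g::ab_group_add \<Rightarrow> 'g \<Rightarrow> 'k::field) \<Rightarrow> bool" where
  "commutation_factor \<epsilon> \<longleftrightarrow>
     (\<forall>\<alpha> \<beta>. \<epsilon> \<alpha> \<beta> \<noteq> 0) \<and>
     (\<forall>\<alpha> \<beta>. \<epsilon> \<alpha> \<beta> * \<epsilon> \<beta> \<alpha> = 1) \<and>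
     (\<forall>\<alpha> \<beta> \<gamma>. \<epsilon> \<alpha> (\<beta> + \<gamma>) = \<epsilon> \<alpha> \<beta> * \<epsilon> \<alpha> \<gamma>) \<and>
     (\<forall>\<alpha> \<beta> \<gamma>. \<epsilon> (\<alpha> + \<beta>) \<gamma> = \<epsilon> \<alpha> \<gamma> * \<epsilon> \<beta> \<gamma>)"

record ('k, 'g, 's) galgebra = "('k, 'g, 's) gspace" +
  mult :: "'s \<Rightarrow> 's \<Rightarrow> 's"

record ('k, 'g, 'm, 's) gbimodule = "('k, 'g, 'm) gspace" +
  lact :: "'s \<Rightarrow> 'm \<Rightarrow> 'm"
  ract :: "'m \<Rightarrow> 's \<Rightarrow> 'm"

record ('k, 'g, 'm, 's) gmodule = "('k, 'g, 'm) gspace" +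
  act :: "'s \<Rightarrow> 'm \<Rightarrow> 'm"

definition gen_lsa :: "('g::ab_group_add \<Rightarrow> 'g \<Rightarrow> 'k::field) \<Rightarrow>
    ('k, 'g, 's::ab_group_add) galgebra \<Rightarrow> bool" where
  "gen_lsa \<epsilon> S \<longleftrightarrow>
     graded_space S \<and> carrier S = UNIV \<and>
     (\<forall>x. Vector_Spaces.linear (vscale S) (vscale S) (\<lambda>y. mult S x y)) \<and>
     (\<forall>y. Vector_Spaces.linear (vscale S) (vscale S) (\<lambda>x. mult S x y)) \<and>
     (\<forall>\<alpha> \<beta>. \<forall>x\<in>grade S \<alpha>. \<forall>y\<in>grade S \<beta>. mult S x y \<in> grade S (\<alpha> + \<beta>)) \<and>
     (\<forall>\<alpha> \<beta>. \<forall>x\<in>grade S \<alpha>. \<forall>y\<in>grade S \<beta>. \<forall>z.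
        mult S (mult S x y) z - mult S x (mult S y z) =
        vscale S (\<epsilon> \<alpha> \<beta>) (mult S (mult S y x) z - mult S y (mult S x z)))"

definition lsa_bimodule :: "('g::ab_group_add \<Rightarrow> 'g \<Rightarrow> 'k::field) \<Rightarrow>
    ('k, 'g, 's::ab_group_add) galgebra \<Rightarrow> ('k, 'g, 'm::ab_group_add, 's) gbimodule \<Rightarrow> bool" where
  "lsa_bimodule \<epsilon> S M \<longleftrightarrow>
     graded_space M \<and> carrier M = UNIV \<and>
     (\<forall>x. Vector_Spaces.linear (vscale M) (vscale M) (\<lambda>m. lact M x m)) \<and>
     (\<forall>m. Vector_Spaces.linear (vscale S) (vscale M) (\<lambda>x. lact M x m)) \<and>
     (\<forall>m. Vector_Spaces.linear (vscale S) (vscale M) (\<lambda>x. ract M m x)) \<and>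
     (\<forall>x. Vector_Spaces.linear (vscale M) (vscale M) (\<lambda>m. ract M m x)) \<and>
     (\<forall>\<alpha> \<gamma>. \<forall>x\<in>grade S \<alpha>. \<forall>m\<in>grade M \<gamma>.
        lact M x m \<in> grade M (\<alpha> + \<gamma>) \<and> ract M m x \<in> grade M (\<gamma> + \<alpha>)) \<and>
     (\<forall>\<alpha> \<beta> \<gamma>. \<forall>x\<in>grade S \<alpha>. \<forall>y\<in>grade S \<beta>. \<forall>m\<in>grade M \<gamma>.
        lact M (mult S x y) m - lact M x (lact M y m) =
        vscale M (\<epsilon> \<alpha> \<beta>) (lact M (mult S y x) m - lact M y (lact M x m))) \<and>
     (\<forall>\<alpha> \<beta> \<gamma>. \<forall>x\<in>grade S \<alpha>. \<forall>y\<in>grade S \<beta>. \<forall>m\<in>grade M \<gamma>.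
        ract M (lact M x m) y - lact M x (ract M m y) =
        vscale M (\<epsilon> \<alpha> \<gamma>) (ract M (ract M m x) y - ract M m (mult S x y)))"

text \<open>The associated \<open>\<epsilon>\<close>-Lie algebra: the same graded space, with the bracket as product.\<close>

definition lie_algebra_of :: "('g \<Rightarrow> 'g \<Rightarrow> 'k::field) \<Rightarrow> ('k, 'g, 's::ab_group_add) galgebra \<Rightarrow>
    ('k, 'g, 's) galgebra" where
  "lie_algebra_of \<epsilon> S = S\<lparr> mult := (\<lambda>x y. mult S x y -
     hsum S x (\<lambda>\<alpha> a. hsum S y (\<lambda>\<beta> b. vscale S (\<epsilon> \<alpha> \<beta>) (mult S b a)))) \<rparr>"

definition with_action :: "('k, 'g, 'm) gspace \<Rightarrow> ('s \<Rightarrow> 'm \<Rightarrow> 'm) \<Rightarrow> ('k, 'g, 'm, 's) gmodule" where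
  "with_action V a = \<lparr> carrier = carrier V, vadd = vadd V, vscale = vscale V, grade = grade V, act = a \<rparr>"

text \<open>An isomorphism of graded modules over the \<open>\<epsilon>\<close>-Lie algebra \<open>L\<close>: bijective, linear, of degree 0
  and equivariant. That the actions satisfy the module identity is not part of the predicate.\<close>

definition module_iso :: "('k, 'g, 's) galgebra \<Rightarrow> ('k, 'g, 'v, 's) gmodule \<Rightarrow>
    ('k, 'g, 'w, 's) gmodule \<Rightarrow> ('v \<Rightarrow> 'w) \<Rightarrow> bool" where
  "module_iso L V W \<phi> \<longleftrightarrow>
     linear_iso V W \<phi> \<and>
     (\<forall>\<gamma>. \<phi> ` grade V \<gamma> = grade W \<gamma>) \<and>
     (\<forall>x\<in>carrier L. \<forall>v\<in>carrier V. act V x v \<in> carrier V) \<and>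
     (\<forall>x\<in>carrier L. \<forall>w\<in>carrier W. act W x w \<in> carrier W) \<and>
     (\<forall>x\<in>carrier L. \<forall>v\<in>carrier V. \<phi> (act V x v) = act W x (\<phi> v))"


section \<open>Cohomology of \<open>\<epsilon>\<close>-Lie algebras\<close>

definition lie_cochains :: "('g::ab_group_add \<Rightarrow> 'g \<Rightarrow> 'k::field) \<Rightarrow> ('k, 'g, 's) galgebra \<Rightarrow>
    ('k, 'g, 'm::ab_group_add, 's) gmodule \<Rightarrow> nat \<Rightarrow>
    ('k, 'g, ('s list \<Rightarrow>\<^sub>0 'k) set \<Rightarrow> 'm) gspace" where
  "lie_cochains \<epsilon> L N i = graded_hom (ext_power \<epsilon> L i) N"

text \<open>In the following, the arguments \<open>x\<^sub>1, x\<^sub>2, \<dots>\<close> of a cochain and their degrees are given by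
  functions on indices starting at 1, and a list such as \<open>map x ([1..<t] @ [Suc t..<i + 2])\<close> is
  \<open>x\<^sub>1, \<dots>, x\<^sub>t\<^sub>-\<^sub>1, x\<^sub>t\<^sub>+\<^sub>1, \<dots>, x\<^sub>i\<^sub>+\<^sub>1\<close>. A cochain is determined by its values on
  homogeneous arguments, which is how the operators below are specified.\<close>

definition \<xi>_hom :: "('g::ab_group_add \<Rightarrow> 'g \<Rightarrow> 'k::field) \<Rightarrow> ('k, 'g, 's) galgebra \<Rightarrow>
    ('k, 'g, 'm::ab_group_add, 's) gmodule \<Rightarrow> nat \<Rightarrow> 'g \<Rightarrow> 's \<Rightarrow> 'g \<Rightarrow>
    (('s list \<Rightarrow>\<^sub>0 'k) set \<Rightarrow> 'm) \<Rightarrow> ('s list \<Rightarrow>\<^sub>0 'k) set \<Rightarrow> 'm" where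
  "\<xi>_hom \<epsilon> L N i a y \<beta> f = (THE h. h \<in> carrier (lie_cochains \<epsilon> L N i) \<and>
     (\<forall>x \<alpha>. (\<forall>s\<in>{1..i}. x s \<in> grade L (\<alpha> s)) \<longrightarrow>
        h (wedge \<epsilon> L (map x [1..<Suc i])) =
          act N y (f (wedge \<epsilon> L (map x [1..<Suc i])))
          - (\<Sum>j\<in>{1..i}. vscale N (\<epsilon> a (\<beta> + (\<Sum>s\<in>{1..<j}. \<alpha> s)))
               (f (wedge \<epsilon> L (map x [1..<j] @ [mult L y (x j)] @ map x [Suc j..<Suc i]))))))"

definition \<xi> :: "('g::ab_group_add \<Rightarrow> 'g \<Rightarrow> 'k::field) \<Rightarrow> ('k, 'g, 's::ab_group_add) galgebra \<Rightarrow>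
    ('k, 'g, 'm::ab_group_add, 's) gmodule \<Rightarrow> nat \<Rightarrow> 's \<Rightarrow>
    (('s list \<Rightarrow>\<^sub>0 'k) set \<Rightarrow> 'm) \<Rightarrow> ('s list \<Rightarrow>\<^sub>0 'k) set \<Rightarrow> 'm" where
  "\<xi> \<epsilon> L N i y f = hsum L y (\<lambda>a u. hsum (lie_cochains \<epsilon> L N i) f (\<lambda>\<beta> h. \<xi>_hom \<epsilon> L N i a u \<beta> h))"

definition lie_d_hom :: "('g::ab_group_add \<Rightarrow> 'g \<Rightarrow> 'k::field) \<Rightarrow> ('k, 'g, 's) galgebra \<Rightarrow>
    ('k, 'g, 'm::ab_group_add, 's) gmodule \<Rightarrow> nat \<Rightarrow> 'g \<Rightarrow>
    (('s list \<Rightarrow>\<^sub>0 'k) set \<Rightarrow> 'm) \<Rightarrow> ('s list \<Rightarrow>\<^sub>0 'k) set \<Rightarrow> 'm" where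
  "lie_d_hom \<epsilon> L N i \<beta> f = (THE h. h \<in> carrier (lie_cochains \<epsilon> L N (Suc i)) \<and>
     (\<forall>x \<alpha>. (\<forall>s\<in>{1..i+1}. x s \<in> grade L (\<alpha> s)) \<longrightarrow>
        h (wedge \<epsilon> L (map x [1..<i+2])) =
          - (\<Sum>t\<in>{1..i+1}. vscale N ((-1) ^ t * \<epsilon> (\<beta> + (\<Sum>s\<in>{1..<t}. \<alpha> s)) (\<alpha> t))
               (act N (x t) (f (wedge \<epsilon> L (map x ([1..<t] @ [Suc t..<i+2]))))))
          + (\<Sum>j\<in>{1..i+1}. \<Sum>t\<in>{1..<j}. vscale N ((-1) ^ t * \<epsilon> (\<alpha> t) (\<Sum>s\<in>{Suc t..<j}. \<alpha> s))
               (f (wedge \<epsilon> L (map x ([1..<t] @ [Suc t..<j]) @ [mult L (x t) (x j)] @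
                  map x [Suc j..<i+2]))))))"

definition lie_d :: "('g::ab_group_add \<Rightarrow> 'g \<Rightarrow> 'k::field) \<Rightarrow> ('k, 'g, 's) galgebra \<Rightarrow>
    ('k, 'g, 'm::ab_group_add, 's) gmodule \<Rightarrow> nat \<Rightarrow>
    (('s list \<Rightarrow>\<^sub>0 'k) set \<Rightarrow> 'm) \<Rightarrow> ('s list \<Rightarrow>\<^sub>0 'k) set \<Rightarrow> 'm" where
  "lie_d \<epsilon> L N i f = hsum (lie_cochains \<epsilon> L N i) f (lie_d_hom \<epsilon> L N i)"

text \<open>\<open>ker d / B\<close>, for a linear map \<open>d\<close> on \<open>C\<close> and a subspace \<open>B\<close> of coboundaries.\<close>

definition cohomology_space :: "('k, 'g, 'v::ab_group_add) gspace \<Rightarrow> ('v \<Rightarrow> 'w::zero) \<Rightarrow> 'v set \<Rightarrow>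
    ('k, 'g, 'v set) gspace" where
  "cohomology_space C d B = quotient_space
     (C\<lparr> carrier := {f \<in> carrier C. d f = 0}, grade := (\<lambda>\<gamma>. {f \<in> grade C \<gamma>. d f = 0}) \<rparr>) B"

definition lie_cohomology :: "('g::ab_group_add \<Rightarrow> 'g \<Rightarrow> 'k::field) \<Rightarrow> ('k, 'g, 's) galgebra \<Rightarrow>
    ('k, 'g, 'm::ab_group_add, 's) gmodule \<Rightarrow> nat \<Rightarrow>
    ('k, 'g, (('s list \<Rightarrow>\<^sub>0 'k) set \<Rightarrow> 'm) set) gspace" where
  "lie_cohomology \<epsilon> L N i = cohomology_space (lie_cochains \<epsilon> L N i) (lie_d \<epsilon> L N i)
     (case i of 0 \<Rightarrow> {0} | Suc j \<Rightarrow> lie_d \<epsilon> L N j ` carrier (lie_cochains \<epsilon> L N j))"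


section \<open>Cohomology of generalized left-symmetric algebras\<close>

text \<open>\<open>C\<^sup>n(S,M)\<close>, for \<open>n \<ge> 1\<close> only.\<close>

definition lsa_cochains :: "('g::ab_group_add \<Rightarrow> 'g \<Rightarrow> 'k::field) \<Rightarrow> ('k, 'g, 's) galgebra \<Rightarrow>
    ('k, 'g, 'm::ab_group_add, 's) gbimodule \<Rightarrow> nat \<Rightarrow>
    ('k, 'g, (('s list \<Rightarrow>\<^sub>0 'k) set \<times> 's \<Rightarrow>\<^sub>0 'k) set \<Rightarrow> 'm) gspace" where
  "lsa_cochains \<epsilon> S M n = graded_hom (tensor_space (ext_power \<epsilon> S (n - 1)) S) M"

text \<open>\<open>(x\<^sub>1 \<and> \<dots> \<and> x\<^sub>i) \<otimes> y\<close>, the argument at which \<open>f(x\<^sub>1, \<dots>, x\<^sub>i, y)\<close> evaluates \<open>f\<close>.\<close>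

definition wedge_tensor :: "('g::ab_group_add \<Rightarrow> 'g \<Rightarrow> 'k::field) \<Rightarrow> ('k, 'g, 's) galgebra \<Rightarrow>
    's list \<Rightarrow> 's \<Rightarrow> (('s list \<Rightarrow>\<^sub>0 'k) set \<times> 's \<Rightarrow>\<^sub>0 'k) set" where
  "wedge_tensor \<epsilon> S xs y = tensor (ext_power \<epsilon> S (length xs)) S (wedge \<epsilon> S xs) y"

text \<open>\<open>C\<^sup>1(S,M) = Hom(S,M)\<close> as a module over the associated \<open>\<epsilon>\<close>-Lie algebra.\<close>

definition C1_module :: "('g::ab_group_add \<Rightarrow> 'g \<Rightarrow> 'k::field) \<Rightarrow> ('k, 'g, 's::ab_group_add) galgebra \<Rightarrow>
    ('k, 'g, 'm::ab_group_add, 's) gbimodule \<Rightarrow> ('k, 'g, 's \<Rightarrow> 'm, 's) gmodule" where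
  "C1_module \<epsilon> S M = with_action (graded_hom S M)
     (\<lambda>y f. hsum S y (\<lambda>\<alpha> u. hsum (graded_hom S M) f (\<lambda>\<beta> h. (\<lambda>z.
        lact M u (h z) - vscale M (\<epsilon> \<alpha> \<beta>) (h (mult S u z)) + vscale M (\<epsilon> \<alpha> \<beta>) (ract M (h u) z)))))"

definition \<rho>_hom :: "('g::ab_group_add \<Rightarrow> 'g \<Rightarrow> 'k::field) \<Rightarrow> ('k, 'g, 's::ab_group_add) galgebra \<Rightarrow>
    ('k, 'g, 'm::ab_group_add, 's) gbimodule \<Rightarrow> nat \<Rightarrow> 'g \<Rightarrow> 's \<Rightarrow> 'g \<Rightarrow>
    ((('s list \<Rightarrow>\<^sub>0 'k) set \<times> 's \<Rightarrow>\<^sub>0 'k) set \<Rightarrow> 'm) \<Rightarrow>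
    (('s list \<Rightarrow>\<^sub>0 'k) set \<times> 's \<Rightarrow>\<^sub>0 'k) set \<Rightarrow> 'm" where
  "\<rho>_hom \<epsilon> S M i a y \<beta> f = (THE h. h \<in> carrier (lsa_cochains \<epsilon> S M (i + 1)) \<and>
     (\<forall>x \<alpha>. (\<forall>s\<in>{1..i+1}. x s \<in> grade S (\<alpha> s)) \<longrightarrow>
        h (wedge_tensor \<epsilon> S (map x [1..<i+1]) (x (i+1))) =
          lact M y (f (wedge_tensor \<epsilon> S (map x [1..<i+1]) (x (i+1))))
          - vscale M (\<epsilon> a (\<beta> + (\<Sum>s\<in>{1..i}. \<alpha> s)))
              (f (wedge_tensor \<epsilon> S (map x [1..<i+1]) (mult S y (x (i+1)))))
          + vscale M (\<epsilon> a (\<beta> + (\<Sum>s\<in>{1..i}. \<alpha> s)))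
              (ract M (f (wedge_tensor \<epsilon> S (map x [1..<i+1]) y)) (x (i+1)))
          - (\<Sum>s\<in>{1..i}. vscale M (\<epsilon> a (\<beta> + (\<Sum>r\<in>{1..<s}. \<alpha> r)))
              (f (wedge_tensor \<epsilon> S
                 (map x [1..<s] @ [mult (lie_algebra_of \<epsilon> S) y (x s)] @ map x [Suc s..<i+1])
                 (x (i+1)))))))"

text \<open>The action on \<open>C\<^sup>i\<^sup>+\<^sup>1(S,M)\<close>.\<close>

definition \<rho> :: "('g::ab_group_add \<Rightarrow> 'g \<Rightarrow> 'k::field) \<Rightarrow> ('k, 'g, 's::ab_group_add) galgebra \<Rightarrow>
    ('k, 'g, 'm::ab_group_add, 's) gbimodule \<Rightarrow> nat \<Rightarrow> 's \<Rightarrow>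
    ((('s list \<Rightarrow>\<^sub>0 'k) set \<times> 's \<Rightarrow>\<^sub>0 'k) set \<Rightarrow> 'm) \<Rightarrow>
    (('s list \<Rightarrow>\<^sub>0 'k) set \<times> 's \<Rightarrow>\<^sub>0 'k) set \<Rightarrow> 'm" where
  "\<rho> \<epsilon> S M i y f = hsum S y (\<lambda>a u. hsum (lsa_cochains \<epsilon> S M (i + 1)) f (\<lambda>\<beta> h. \<rho>_hom \<epsilon> S M i a u \<beta> h))"

definition lsa_d_hom :: "('g::ab_group_add \<Rightarrow> 'g \<Rightarrow> 'k::field) \<Rightarrow> ('k, 'g, 's::ab_group_add) galgebra \<Rightarrow>
    ('k, 'g, 'm::ab_group_add, 's) gbimodule \<Rightarrow> nat \<Rightarrow> 'g \<Rightarrow>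
    ((('s list \<Rightarrow>\<^sub>0 'k) set \<times> 's \<Rightarrow>\<^sub>0 'k) set \<Rightarrow> 'm) \<Rightarrow>
    (('s list \<Rightarrow>\<^sub>0 'k) set \<times> 's \<Rightarrow>\<^sub>0 'k) set \<Rightarrow> 'm" where
  "lsa_d_hom \<epsilon> S M i \<beta> f = (THE h. h \<in> carrier (lsa_cochains \<epsilon> S M (i + 1)) \<and>
     (\<forall>x \<alpha>. (\<forall>s\<in>{1..i+1}. x s \<in> grade S (\<alpha> s)) \<longrightarrow>
        h (wedge_tensor \<epsilon> S (map x [1..<i+1]) (x (i+1))) =
          - (\<Sum>t\<in>{1..i}. vscale M ((-1) ^ t * \<epsilon> (\<beta> + (\<Sum>s\<in>{1..<t}. \<alpha> s)) (\<alpha> t))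
               (lact M (x t)
                  (f (wedge_tensor \<epsilon> S (map x ([1..<t] @ [Suc t..<i+1])) (x (i+1))))))
          + (\<Sum>t\<in>{1..i}. vscale M ((-1) ^ t * \<epsilon> (\<alpha> t) (\<Sum>s\<in>{Suc t..i}. \<alpha> s))
               (f (wedge_tensor \<epsilon> S (map x ([1..<t] @ [Suc t..<i+1])) (mult S (x t) (x (i+1))))))
          - (\<Sum>t\<in>{1..i}. vscale M ((-1) ^ t * \<epsilon> (\<alpha> t) (\<Sum>s\<in>{Suc t..i}. \<alpha> s))
               (ract M (f (wedge_tensor \<epsilon> S (map x ([1..<t] @ [Suc t..<i+1])) (x t))) (x (i+1))))
          + (\<Sum>j\<in>{1..i}. \<Sum>t\<in>{1..<j}. vscale M ((-1) ^ t * \<epsilon> (\<alpha> t) (\<Sum>s\<in>{Suc t..<j}. \<alpha> s))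
               (f (wedge_tensor \<epsilon> S
                  (map x ([1..<t] @ [Suc t..<j]) @ [mult (lie_algebra_of \<epsilon> S) (x t) (x j)] @
                     map x [Suc j..<i+1])
                  (x (i+1)))))))"

text \<open>The coboundary \<open>C\<^sup>i(S,M) \<rightarrow> C\<^sup>i\<^sup>+\<^sup>1(S,M)\<close>, for \<open>i \<ge> 1\<close>.\<close>

definition lsa_d :: "('g::ab_group_add \<Rightarrow> 'g \<Rightarrow> 'k::field) \<Rightarrow> ('k, 'g, 's::ab_group_add) galgebra \<Rightarrow>
    ('k, 'g, 'm::ab_group_add, 's) gbimodule \<Rightarrow> nat \<Rightarrow>
    ((('s list \<Rightarrow>\<^sub>0 'k) set \<times> 's \<Rightarrow>\<^sub>0 'k) set \<Rightarrow> 'm) \<Rightarrow>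
    (('s list \<Rightarrow>\<^sub>0 'k) set \<times> 's \<Rightarrow>\<^sub>0 'k) set \<Rightarrow> 'm" where
  "lsa_d \<epsilon> S M i f = hsum (lsa_cochains \<epsilon> S M i) f (lsa_d_hom \<epsilon> S M i)"

text \<open>\<open>H\<^sup>n(S,M)\<close>, for \<open>n \<ge> 2\<close> only.\<close>

definition lsa_cohomology :: "('g::ab_group_add \<Rightarrow> 'g \<Rightarrow> 'k::field) \<Rightarrow>
    ('k, 'g, 's::ab_group_add) galgebra \<Rightarrow> ('k, 'g, 'm::ab_group_add, 's) gbimodule \<Rightarrow> nat \<Rightarrow>
    ('k, 'g, ((('s list \<Rightarrow>\<^sub>0 'k) set \<times> 's \<Rightarrow>\<^sub>0 'k) set \<Rightarrow> 'm) set) gspace" where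
  "lsa_cohomology \<epsilon> S M n = cohomology_space (lsa_cochains \<epsilon> S M n) (lsa_d \<epsilon> S M n)
     (lsa_d \<epsilon> S M (n - 1) ` carrier (lsa_cochains \<epsilon> S M (n - 1)))"

definition \<psi> :: "('g::ab_group_add \<Rightarrow> 'g \<Rightarrow> 'k::field) \<Rightarrow> ('k, 'g, 's) galgebra \<Rightarrow>
    ('k, 'g, 'm::ab_group_add, 's) gbimodule \<Rightarrow> nat \<Rightarrow>
    (('s list \<Rightarrow>\<^sub>0 'k) set \<Rightarrow> 's \<Rightarrow> 'm) \<Rightarrow> (('s list \<Rightarrow>\<^sub>0 'k) set \<times> 's \<Rightarrow>\<^sub>0 'k) set \<Rightarrow> 'm" where
  "\<psi> \<epsilon> S M i f = (THE h. h \<in> carrier (lsa_cochains \<epsilon> S M (i + 1)) \<and>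
     (\<forall>xs y. length xs = i \<longrightarrow> h (wedge_tensor \<epsilon> S xs y) = f (wedge \<epsilon> S xs) y))"

end

theory Submission
  imports Defs
begin

text \<open>
  A cochain with values in \<open>C\<^sup>1(S,M) = Hom(S,M)\<close> is the same as a cochain on \<open>\<And>\<^sup>iS \<otimes> S\<close> by currying,
  and \<open>\<psi>\<close> is this identification. Evaluating the Chevalley-Eilenberg formula at a last argument
  \<open>z\<close> and expanding the action on \<open>Hom(S,M)\<close> yields the formula for \<open>d\<close> term by term, because
  \<open>\<epsilon>(\<beta> + P, \<alpha>\<^sub>t) \<epsilon>(\<alpha>\<^sub>t, \<beta> + P + Q) = \<epsilon>(\<alpha>\<^sub>t, Q)\<close>, where \<open>P\<close> and \<open>Q\<close> are the sums of the degrees before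
  and after \<open>x\<^sub>t\<close>; the same holds for \<open>\<xi>\<close> and \<open>\<rho>\<close>. The operators are given by their values on
  homogeneous arguments only, so the substantial point is that these formulas define maps on the
  exterior power, i.e. are multilinear and \<open>\<epsilon>\<close>-alternating. This uses only the skewness of the
  bracket. Existence on the side of \<open>S\<close> then follows by transport along \<open>\<psi>\<close>.
\<close>


section \<open>Graded spaces\<close>

text \<open>In the index formulas a transposition of two neighbours acts differently on a term
  according to how the omitted index t and the slot j lie relative to them, and the exponents of
  \<open>\<epsilon>\<close> shift along. Recursion on words removes the positions: a transposition
  anywhere becomes one of the two leading letters once the letters before it are frozen, and only a
  handful of terms has to be matched, once for the Lie derivative and once for the coboundary. The
  index form is recovered afterwards by splitting off the lowest index. The second obstacle is that
  the exterior ideal is generated in the whole free algebra, with relations inside words of every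
  length. A linear map on a single exterior power is therefore built on the full free algebra, and
  the relations are shown to lie in the largest two-sided ideal that it kills.\<close>

lemma additive_sum:
  fixes h :: "'a::comm_monoid_add \<Rightarrow> 'b::ab_group_add"
  assumes "\<And>a b. h (a + b) = h a + h b"
  shows "h (sum f A) = (\<Sum>x\<in>A. h (f x))"
proof -
  have "h 0 = 0"
    using assms[of 0 0] by simp
  then show ?thesis
    by (induct A rule: infinite_finite_induct) (simp_all add: assms)
qed

lemma sum_support:
  assumes "finite A" "\<And>x. x \<notin> A \<Longrightarrow> c x = 0"
  shows "finite {x. c x \<noteq> 0}" "(\<Sum>x | c x \<noteq> 0. c x) = sum c A"
proof -
  have sub: "{x. c x \<noteq> 0} \<subseteq> A"
    using assms(2) by auto
  then show "finite {x. c x \<noteq> 0}"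
    using assms(1) by (rule finite_subset)
  show "(\<Sum>x | c x \<noteq> 0. c x) = sum c A"
    by (rule sum.mono_neutral_left[OF assms(1) sub]) simp
qed

locale gr_space =
  fixes V :: "('k::field, 'g, 'v::ab_group_add, 'z) gspace_scheme"
  assumes graded: "graded_space V"
begin

sublocale vector_space "vscale V"
  using graded by (simp add: graded_space_def)

lemma vadd_eq: "vadd V = (+)"
  using graded by (simp add: graded_space_def)

lemma subspace_grade: "subspace (grade V \<gamma>)"
  using graded by (simp add: graded_space_def)

lemma carrier_eq_span: "carrier V = span (\<Union>\<gamma>. grade V \<gamma>)"
  using graded by (simp add: graded_space_def)

lemma subspace_carrier: "subspace (carrier V)"
  by (simp add: carrier_eq_span)

lemma grade_carrier: "x \<in> grade V \<gamma> \<Longrightarrow> x \<in> carrier V"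
  by (auto simp: carrier_eq_span intro: span_base)

text \<open>\<open>graded_space\<close> sums over the support of the family. Any finite set
  containing the support is allowed here, so that two families can be compared over the union of
  their supports.\<close>

lemma independent_grades:
  assumes "finite A" "\<And>\<gamma>. c \<gamma> \<in> grade V \<gamma>" "\<And>\<gamma>. \<gamma> \<notin> A \<Longrightarrow> c \<gamma> = 0" "sum c A = 0"
  shows "c \<gamma> = 0"
proof -
  have "finite {\<gamma>. c \<gamma> \<noteq> 0} \<longrightarrow> (\<forall>\<gamma>. c \<gamma> \<in> grade V \<gamma>) \<longrightarrow>
      (\<Sum>\<gamma> | c \<gamma> \<noteq> 0. c \<gamma>) = 0 \<longrightarrow> (\<forall>\<gamma>. c \<gamma> = 0)"
    using graded unfolding graded_space_def by (elim conjE) (erule spec)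
  then show ?thesis
    using sum_support[of A c, OF assms(1,3)] assms(2,4) by simp
qed

lemma decomposition_exists:
  assumes "v \<in> carrier V"
  shows "\<exists>A c. finite A \<and> (\<forall>\<gamma>. c \<gamma> \<in> grade V \<gamma>) \<and> (\<forall>\<gamma>. \<gamma> \<notin> A \<longrightarrow> c \<gamma> = 0) \<and> v = sum c A"
  using assms unfolding carrier_eq_span
proof (induction rule: span_induct_alt)
  case base
  show ?case
    by (intro exI[of _ "{}"] exI[of _ "\<lambda>_. 0"]) (simp add: subspace_0 subspace_grade)
next
  case (step a x y)
  then obtain A c \<gamma> where *: "finite A" "\<And>\<gamma>. c \<gamma> \<in> grade V \<gamma>" "\<And>\<gamma>. \<gamma> \<notin> A \<Longrightarrow> c \<gamma> = 0"
    "y = sum c A" "x \<in> grade V \<gamma>"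
    by auto
  \<comment> \<open>Only the component of degree \<gamma> changes. A grade is a subspace, so it
    absorbs the new vector whether or not \<gamma> already occurs in A.\<close>
  define d where "d \<delta> = c \<delta> + (if \<delta> = \<gamma> then vscale V a x else 0)" for \<delta>
  have "sum c (insert \<gamma> A) = y"
    using *(1,3,4) by (auto simp: sum.insert_if)
  then have "vscale V a x + y = sum d (insert \<gamma> A)"
    using *(1) by (simp add: d_def sum.distrib sum.delta add.commute)
  moreover have "\<forall>\<delta>. d \<delta> \<in> grade V \<delta>" "\<forall>\<delta>. \<delta> \<notin> insert \<gamma> A \<longrightarrow> d \<delta> = 0"
    using * by (auto simp: d_def intro: subspace_add subspace_scale subspace_grade)
  ultimately show ?case
    using *(1) by blast
qed

text \<open>This makes the description in \<open>homog_part\<close> usable: a second decomposition d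
  differs from c by a family in the grades with sum zero, which vanishes by independence.\<close>

lemma homog_part_sum:
  assumes "finite A" "\<And>\<gamma>. c \<gamma> \<in> grade V \<gamma>" "\<And>\<gamma>. \<gamma> \<notin> A \<Longrightarrow> c \<gamma> = 0"
  shows "homog_part V (sum c A) = c"
  unfolding homog_part_def
proof (rule the_equality)
  show "finite {\<gamma>. c \<gamma> \<noteq> 0} \<and> (\<forall>\<gamma>. c \<gamma> \<in> grade V \<gamma>) \<and> sum c A = (\<Sum>\<gamma> | c \<gamma> \<noteq> 0. c \<gamma>)"
    using sum_support[OF assms(1), of c] assms(2,3) by simp
next
  fix d assume d: "finite {\<gamma>. d \<gamma> \<noteq> 0} \<and> (\<forall>\<gamma>. d \<gamma> \<in> grade V \<gamma>) \<and> sum c A = (\<Sum>\<gamma> | d \<gamma> \<noteq> 0. d \<gamma>)"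
  let ?B = "A \<union> {\<gamma>. d \<gamma> \<noteq> 0}"
  have fin: "finite ?B"
    using d assms(1) by simp
  have "sum c ?B = sum c A"
    using fin assms(3) by (intro sum.mono_neutral_right) auto
  moreover have "sum d ?B = (\<Sum>\<gamma> | d \<gamma> \<noteq> 0. d \<gamma>)"
    using fin by (intro sum.mono_neutral_right) auto
  ultimately have 0: "(\<Sum>\<gamma>\<in>?B. d \<gamma> - c \<gamma>) = 0"
    using d by (simp add: sum_subtractf)
  have "d \<gamma> - c \<gamma> = 0" for \<gamma>
  proof (rule independent_grades[of ?B "\<lambda>\<gamma>. d \<gamma> - c \<gamma>"])
    show "d \<gamma> - c \<gamma> \<in> grade V \<gamma>" for \<gamma>
      by (rule subspace_diff[OF subspace_grade]) (use assms(2) d in simp_all)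
    show "d \<gamma> - c \<gamma> = 0" if "\<gamma> \<notin> ?B" for \<gamma>
      using that assms(3) by simp
  qed (rule fin 0)+
  then show "d = c"
    by (simp add: fun_eq_iff)
qed

lemma homog_part:
  assumes "v \<in> carrier V"
  shows "finite {\<gamma>. homog_part V v \<gamma> \<noteq> 0}" "homog_part V v \<gamma> \<in> grade V \<gamma>"
    "v = (\<Sum>\<gamma> | homog_part V v \<gamma> \<noteq> 0. homog_part V v \<gamma>)"
proof -
  obtain A c where *: "finite A" "\<And>\<gamma>. c \<gamma> \<in> grade V \<gamma>" "\<And>\<gamma>. \<gamma> \<notin> A \<Longrightarrow> c \<gamma> = 0" "v = sum c A"
    using decomposition_exists[OF assms] by blast
  then have hp: "homog_part V v = c"
    using homog_part_sum by blast
  show "finite {\<gamma>. homog_part V v \<gamma> \<noteq> 0}"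
    unfolding hp by (rule sum_support(1)[of A c, OF *(1,3)])
  show "homog_part V v \<gamma> \<in> grade V \<gamma>"
    unfolding hp by (rule *(2))
  show "v = (\<Sum>\<gamma> | homog_part V v \<gamma> \<noteq> 0. homog_part V v \<gamma>)"
    unfolding hp using *(4) sum_support(2)[of A c, OF *(1,3)] by metis
qed

section \<open>Additive extension from homogeneous components\<close>

lemma hsum_sum:
  fixes F :: "'g \<Rightarrow> 'v \<Rightarrow> 'b::comm_monoid_add"
  assumes "finite A" "\<And>\<gamma>. c \<gamma> \<in> grade V \<gamma>" "\<And>\<gamma>. \<gamma> \<notin> A \<Longrightarrow> c \<gamma> = 0" "\<And>\<gamma>. F \<gamma> 0 = 0"
  shows "hsum V (sum c A) F = (\<Sum>\<gamma>\<in>A. F \<gamma> (c \<gamma>))"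
proof -
  have "homog_part V (sum c A) = c"
    using assms(1-3) by (rule homog_part_sum)
  moreover have "{\<gamma>. c \<gamma> \<noteq> 0} \<subseteq> A"
    using assms(3) by auto
  \<comment> \<open>\<open>hsum\<close> runs over the nonzero components only, while A may contain
    further indices; these contribute \<open>F \<gamma> 0 = 0\<close>.\<close>
  then have "(\<Sum>\<gamma> | c \<gamma> \<noteq> 0. F \<gamma> (c \<gamma>)) = (\<Sum>\<gamma>\<in>A. F \<gamma> (c \<gamma>))"
    using assms by (intro sum.mono_neutral_left) auto
  ultimately show ?thesis
    by (simp add: hsum_def)
qed

lemma hsum_homog:
  fixes F :: "'g \<Rightarrow> 'v \<Rightarrow> 'b::comm_monoid_add"
  assumes "v \<in> grade V \<gamma>" "\<And>\<gamma>. F \<gamma> 0 = 0"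
  shows "hsum V v F = F \<gamma> v"
  using hsum_sum[of "{\<gamma>}" "\<lambda>\<delta>. if \<delta> = \<gamma> then v else 0" F] assms
  by (auto simp: subspace_0 subspace_grade)

lemma hsum_cong:
  assumes "v \<in> carrier V" "\<And>\<gamma> u. u \<in> grade V \<gamma> \<Longrightarrow> F \<gamma> u = G \<gamma> u"
  shows "hsum V v F = hsum V v G"
  unfolding hsum_def using assms homog_part(2) by (auto intro: sum.cong)

lemma hsum_add_fun:
  fixes F :: "'g \<Rightarrow> 'v \<Rightarrow> 'b::comm_monoid_add"
  shows "hsum V v (\<lambda>\<gamma> u. F \<gamma> u + G \<gamma> u) = hsum V v F + hsum V v G"
  by (simp add: hsum_def sum.distrib)

lemma hsum_additive:
  fixes h :: "'a::comm_monoid_add \<Rightarrow> 'b::ab_group_add"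
  assumes "\<And>a b. h (a + b) = h a + h b"
  shows "h (hsum V v F) = hsum V v (\<lambda>\<gamma> u. h (F \<gamma> u))"
  by (simp add: hsum_def additive_sum[of h, OF assms])

text \<open>Additivity requires v, w and v + w over one common index set, since cancellation can
  make their supports differ.\<close>

lemma decompose_pair:
  assumes "v \<in> carrier V" "w \<in> carrier V"
  obtains A c d where "finite A" "\<And>\<gamma>. c \<gamma> \<in> grade V \<gamma>" "\<And>\<gamma>. \<gamma> \<notin> A \<Longrightarrow> c \<gamma> = 0" "v = sum c A"
    "\<And>\<gamma>. d \<gamma> \<in> grade V \<gamma>" "\<And>\<gamma>. \<gamma> \<notin> A \<Longrightarrow> d \<gamma> = 0" "w = sum d A"
proof -
  obtain A c where 1: "finite A" "\<And>\<gamma>. c \<gamma> \<in> grade V \<gamma>" "\<And>\<gamma>. \<gamma> \<notin> A \<Longrightarrow> c \<gamma> = 0" "v = sum c A"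
    using decomposition_exists[OF assms(1)] by blast
  obtain B d where 2: "finite B" "\<And>\<gamma>. d \<gamma> \<in> grade V \<gamma>" "\<And>\<gamma>. \<gamma> \<notin> B \<Longrightarrow> d \<gamma> = 0" "w = sum d B"
    using decomposition_exists[OF assms(2)] by blast
  have "sum c A = sum c (A \<union> B)" "sum d B = sum d (A \<union> B)"
    using 1 2 by (auto intro: sum.mono_neutral_left)
  then show thesis
    using that[of "A \<union> B" c d] 1 2 by auto
qed

lemma hsum_add:
  fixes F :: "'g \<Rightarrow> 'v \<Rightarrow> 'b::ab_group_add"
  assumes "v \<in> carrier V" "w \<in> carrier V"
    and F: "\<And>\<gamma> u u'. u \<in> grade V \<gamma> \<Longrightarrow> u' \<in> grade V \<gamma> \<Longrightarrow> F \<gamma> (u + u') = F \<gamma> u + F \<gamma> u'"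
  shows "hsum V (v + w) F = hsum V v F + hsum V w F"
proof -
  obtain A c d where *: "finite A" "\<And>\<gamma>. c \<gamma> \<in> grade V \<gamma>" "\<And>\<gamma>. \<gamma> \<notin> A \<Longrightarrow> c \<gamma> = 0" "v = sum c A"
    "\<And>\<gamma>. d \<gamma> \<in> grade V \<gamma>" "\<And>\<gamma>. \<gamma> \<notin> A \<Longrightarrow> d \<gamma> = 0" "w = sum d A"
    using decompose_pair[OF assms(1,2)] by blast
  have F0: "F \<gamma> 0 = 0" for \<gamma>
    using F[of 0 \<gamma> 0] by (simp add: subspace_0 subspace_grade)
  have "v + w = (\<Sum>\<gamma>\<in>A. c \<gamma> + d \<gamma>)"
    using * by (simp add: sum.distrib)
  then have "hsum V (v + w) F = (\<Sum>\<gamma>\<in>A. F \<gamma> (c \<gamma> + d \<gamma>))"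
    using * F0 by (simp add: hsum_sum subspace_add[OF subspace_grade])
  moreover have "hsum V v F = (\<Sum>\<gamma>\<in>A. F \<gamma> (c \<gamma>))" "hsum V w F = (\<Sum>\<gamma>\<in>A. F \<gamma> (d \<gamma>))"
    using * F0 by (auto simp: hsum_sum)
  ultimately show ?thesis
    using * F by (simp add: sum.distrib)
qed

text \<open>The target is only a group here, so multiplication by the fixed scalar k enters as an
  additive map h. This covers both scaling in a vector space and pointwise scaling of
  functions.\<close>

lemma hsum_scale:
  fixes F :: "'g \<Rightarrow> 'v \<Rightarrow> 'b::ab_group_add"
  assumes "v \<in> carrier V" and h: "\<And>a b. h (a + b) = h a + h b"
    and F: "\<And>\<gamma> u. u \<in> grade V \<gamma> \<Longrightarrow> F \<gamma> (vscale V k u) = h (F \<gamma> u)" "\<And>\<gamma>. F \<gamma> 0 = 0"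
  shows "hsum V (vscale V k v) F = h (hsum V v F)"
proof -
  obtain A c where *: "finite A" "\<And>\<gamma>. c \<gamma> \<in> grade V \<gamma>" "\<And>\<gamma>. \<gamma> \<notin> A \<Longrightarrow> c \<gamma> = 0" "v = sum c A"
    using decomposition_exists[OF assms(1)] by blast
  have "hsum V (vscale V k v) F = (\<Sum>\<gamma>\<in>A. F \<gamma> (vscale V k (c \<gamma>)))"
    using * F by (simp add: scale_sum_right hsum_sum subspace_scale[OF subspace_grade])
  also have "\<dots> = h (\<Sum>\<gamma>\<in>A. F \<gamma> (c \<gamma>))"
    using *(2) F(1) by (simp add: additive_sum[of h "\<lambda>\<gamma>. F \<gamma> (c \<gamma>)", OF h])
  finally show ?thesis
    using * F by (simp add: hsum_sum)
qed

text \<open>Scalars have no case of their own: each grade is closed under scaling, so the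
  homogeneous case absorbs them.\<close>

lemma carrier_induct [consumes 1, case_names zero homog add]:
  assumes "v \<in> carrier V" "P 0" "\<And>\<gamma> v. v \<in> grade V \<gamma> \<Longrightarrow> P v"
    "\<And>v w. v \<in> carrier V \<Longrightarrow> w \<in> carrier V \<Longrightarrow> P v \<Longrightarrow> P w \<Longrightarrow> P (v + w)"
  shows "P v"
proof -
  obtain A c where *: "finite A" "\<And>\<gamma>. c \<gamma> \<in> grade V \<gamma>" "v = sum c A"
    using decomposition_exists[OF assms(1)] by blast
  have "P (sum c B) \<and> sum c B \<in> carrier V" if "finite B" for B
    using that
  proof (induction B rule: finite_induct)
    case empty
    then show ?case
      using assms(2) by (simp add: subspace_0 subspace_carrier)
  next
    case (insert x F)
    moreover have "P (c x)" "c x \<in> carrier V"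
      using assms(3) *(2) grade_carrier by blast+
    ultimately show ?case
      using assms(4) by (simp add: subspace_add[OF subspace_carrier])
  qed
  then show ?thesis
    using * by blast
qed

end


section \<open>Homogeneous maps between graded spaces\<close>

text \<open>Exterior powers and tensor products are quotients and carry no group structure on their
  types. A presentation replaces such a space by the span of homogeneous generators \<open>H\<close>
  upstairs, so that arguments about linear maps can be made in an honest vector space.\<close>

locale presentation = vector_space s
  for s :: "'k::field \<Rightarrow> 'p::ab_group_add \<Rightarrow> 'p" +
  fixes V :: "('k, 'g::ab_group_add, 'v, 'y) gspace_scheme" and p :: "'p \<Rightarrow> 'v" and H :: "'g \<Rightarrow> 'p set"
  assumes carrier_image: "carrier V = p ` span (\<Union>\<gamma>. H \<gamma>)"
    and grade_image: "grade V \<gamma> = p ` span (H \<gamma>)"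
    and vadd_p: "vadd V (p a) (p b) = p (a + b)"
    and vscale_p: "vscale V c (p a) = p (s c a)"

text \<open>Sums of homogeneous maps of different degrees still lie in this set, so facts about
  arbitrary elements of \<open>graded_hom\<close> are drawn from it.\<close>

definition linear_maps :: "('k, 'g, 'v, 'y) gspace_scheme \<Rightarrow>
    ('k, 'g, 'w::ab_group_add, 'z) gspace_scheme \<Rightarrow> ('v \<Rightarrow> 'w) set" where
  "linear_maps V W = {f.
     (\<forall>x\<in>carrier V. f x \<in> carrier W) \<and>
     (\<forall>x\<in>carrier V. \<forall>y\<in>carrier V. f (vadd V x y) = f x + f y) \<and>
     (\<forall>c. \<forall>x\<in>carrier V. f (vscale V c x) = vscale W c (f x)) \<and>
     (\<forall>x. x \<notin> carrier V \<longrightarrow> f x = 0)}"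

lemma graded_hom_sel:
  "vadd (graded_hom V W) = (+)" "vscale (graded_hom V W) = (\<lambda>c f x. vscale W c (f x))"
  "grade (graded_hom V W) = hom_deg V W"
  by (simp_all add: graded_hom_def)

lemma hom_deg_eq:
  "hom_deg V W \<gamma> = linear_maps V W \<inter> {f. \<forall>\<alpha>. \<forall>x\<in>grade V \<alpha>. f x \<in> grade W (\<alpha> + \<gamma>)}"
  by (auto simp: hom_deg_def linear_maps_def)

lemma vector_space_fun:
  assumes "vector_space s"
  shows "vector_space (\<lambda>c f x. s c (f x))"
proof -
  interpret vector_space s by fact
  show ?thesis
    by standard (auto simp: fun_eq_iff algebra_simps)
qed

locale graded_homs = V: presentation s V p H + W: gr_space W
  for s :: "'k::field \<Rightarrow> 'p::ab_group_add \<Rightarrow> 'p"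
    and V :: "('k, 'g::ab_group_add, 'v, 'y) gspace_scheme" and p :: "'p \<Rightarrow> 'v" and H :: "'g \<Rightarrow> 'p set"
    and W :: "('k, 'g, 'w::ab_group_add, 'z) gspace_scheme"
begin

abbreviation smult :: "'k \<Rightarrow> ('v \<Rightarrow> 'w) \<Rightarrow> 'v \<Rightarrow> 'w" where
  "smult c f x \<equiv> vscale W c (f x)"

sublocale F: vector_space smult
  by (rule vector_space_fun) unfold_locales

lemma subspace_linear_maps: "F.subspace (linear_maps V W)"
  by (rule F.subspaceI)
    (auto simp: linear_maps_def W.subspace_0 W.subspace_add W.subspace_scale W.subspace_carrier
      W.scale_right_distrib W.scale_left_commute)

lemma subspace_hom_deg: "F.subspace (hom_deg V W \<gamma>)"
proof -
  have "F.subspace {f. \<forall>\<alpha>. \<forall>x\<in>grade V \<alpha>. f x \<in> grade W (\<alpha> + \<gamma>)}"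
    by (rule F.subspaceI)
      (auto simp: W.subspace_0 W.subspace_add W.subspace_scale W.subspace_grade)
  then show ?thesis
    unfolding hom_deg_eq by (rule F.subspace_inter[OF subspace_linear_maps])
qed

lemma carrier_graded_hom: "carrier (graded_hom V W) = F.span (\<Union>\<gamma>. hom_deg V W \<gamma>)"
  by (simp add: graded_hom_def)

lemma graded_hom_linear: "f \<in> carrier (graded_hom V W) \<Longrightarrow> f \<in> linear_maps V W"
proof -
  have "F.span (\<Union>\<gamma>. hom_deg V W \<gamma>) \<subseteq> linear_maps V W"
    by (rule F.span_minimal[OF _ subspace_linear_maps]) (auto simp: hom_deg_eq)
  then show "f \<in> carrier (graded_hom V W) \<Longrightarrow> f \<in> linear_maps V W"
    by (auto simp: carrier_graded_hom)
qed

lemma generator_carrier: "a \<in> H \<gamma> \<Longrightarrow> p a \<in> carrier V"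
  unfolding V.carrier_image by (blast intro: V.span_base)

lemma generator_grade: "a \<in> H \<gamma> \<Longrightarrow> p a \<in> grade V \<gamma>"
  unfolding V.grade_image by (blast intro: V.span_base)

lemma linear_maps_p:
  assumes "f \<in> linear_maps V W" "a \<in> V.span (\<Union>\<gamma>. H \<gamma>)"
  shows "f (p (s c a)) = vscale W c (f (p a))" "b \<in> V.span (\<Union>\<gamma>. H \<gamma>) \<Longrightarrow> f (p (a + b)) = f (p a) + f (p b)"
  using assms by (auto simp: linear_maps_def V.carrier_image V.vadd_p[symmetric] V.vscale_p[symmetric])

lemma linear_maps_p_zero: "f \<in> linear_maps V W \<Longrightarrow> f (p 0) = 0"
  using linear_maps_p(1)[of f 0 0] by (simp add: V.span_zero)

lemma linear_maps_eqI:
  assumes f: "f \<in> linear_maps V W" and g: "g \<in> linear_maps V W"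
    and eq: "\<And>\<gamma> a. a \<in> H \<gamma> \<Longrightarrow> f (p a) = g (p a)"
  shows "f = g"
proof
  fix x
  \<comment> \<open>Membership in the span travels with the equality, because additivity of f and g
    is available only for summands that lie in the span.\<close>
  have "a \<in> V.span (\<Union>\<gamma>. H \<gamma>) \<and> f (p a) = g (p a)" if "a \<in> V.span (\<Union>\<gamma>. H \<gamma>)" for a
    using that
  proof (induction rule: V.span_induct_alt)
    case base
    then show ?case
      using f g by (simp add: linear_maps_p_zero V.span_zero)
  next
    case (step c a b)
    then have "a \<in> V.span (\<Union>\<gamma>. H \<gamma>)" "V.subspace (V.span (\<Union>\<gamma>. H \<gamma>))"
      by (auto intro: V.span_base)
    with step eq show ?case
      by (auto simp: linear_maps_p[OF f] linear_maps_p[OF g] V.span_add V.span_scale)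
  qed
  then show "f x = g x"
    using f g by (cases "x \<in> carrier V") (auto simp: V.carrier_image linear_maps_def)
qed

lemma graded_hom_eqI:
  assumes "f \<in> carrier (graded_hom V W)" "g \<in> carrier (graded_hom V W)"
    and "\<And>\<gamma> a. a \<in> H \<gamma> \<Longrightarrow> f (p a) = g (p a)"
  shows "f = g"
  using assms graded_hom_linear linear_maps_eqI by blast

text \<open>Homogeneous maps of different degrees are independent because, at a generator of degree
  \<alpha>, a map of degree \<gamma> takes its value in degree \<alpha> + \<gamma>, and these
  degrees are distinct for distinct \<gamma>.\<close>

lemma graded_space_graded_hom: "graded_space (graded_hom V W)"
proof -
  have "c \<gamma> = 0" if fin: "finite {\<gamma>. c \<gamma> \<noteq> 0}" and c: "\<And>\<gamma>. c \<gamma> \<in> hom_deg V W \<gamma>"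
    and 0: "(\<Sum>\<gamma> | c \<gamma> \<noteq> 0. c \<gamma>) = 0" for c \<gamma>
  proof (rule linear_maps_eqI)
    show "c \<gamma> \<in> linear_maps V W" "0 \<in> linear_maps V W"
      using c F.subspace_0[OF subspace_linear_maps] by (auto simp: hom_deg_eq zero_fun_def)
    fix \<alpha> a assume a: "a \<in> H \<alpha>"
    \<comment> \<open>The values are reindexed by their own degree \<delta> = \<alpha> + \<gamma>,
      the form in which independence in W applies.\<close>
    have "c (\<delta> - \<alpha>) (p a) = 0" for \<delta>
    proof (rule W.independent_grades[of "(\<lambda>\<gamma>. \<alpha> + \<gamma>) ` {\<gamma>. c \<gamma> \<noteq> 0}" "\<lambda>\<delta>. c (\<delta> - \<alpha>) (p a)"])
      show "c (\<delta> - \<alpha>) (p a) \<in> grade W \<delta>" for \<delta>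
        using c[of "\<delta> - \<alpha>"] generator_grade[OF a] by (auto simp: hom_deg_eq dest!: bspec spec[of _ \<alpha>])
      show "c (\<delta> - \<alpha>) (p a) = 0" if "\<delta> \<notin> (\<lambda>\<gamma>. \<alpha> + \<gamma>) ` {\<gamma>. c \<gamma> \<noteq> 0}" for \<delta>
      proof -
        have "c (\<delta> - \<alpha>) = 0"
        proof (rule ccontr)
          assume "c (\<delta> - \<alpha>) \<noteq> 0"
          then have "\<alpha> + (\<delta> - \<alpha>) \<in> (\<lambda>\<gamma>. \<alpha> + \<gamma>) ` {\<gamma>. c \<gamma> \<noteq> 0}"
            by blast
          with that show False by simp
        qed
        then show ?thesis by simp
      qed
      have "(\<Sum>\<delta>\<in>(\<lambda>\<gamma>. \<alpha> + \<gamma>) ` {\<gamma>. c \<gamma> \<noteq> 0}. c (\<delta> - \<alpha>) (p a)) = (\<Sum>\<gamma> | c \<gamma> \<noteq> 0. c \<gamma> (p a))"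
        by (subst sum.reindex) (auto simp: inj_on_def)
      also have "\<dots> = (\<Sum>\<gamma> | c \<gamma> \<noteq> 0. c \<gamma>) (p a)"
        by (rule additive_sum[of "\<lambda>f. f (p a)", symmetric]) simp
      finally show "(\<Sum>\<delta>\<in>(\<lambda>\<gamma>. \<alpha> + \<gamma>) ` {\<gamma>. c \<gamma> \<noteq> 0}. c (\<delta> - \<alpha>) (p a)) = 0"
        by (simp add: 0)
    qed (use fin in simp)
    from this[of "\<gamma> + \<alpha>"] show "c \<gamma> (p a) = 0 (p a)"
      by simp
  qed
  note independent = this
  have sel: "vadd (graded_hom V W) = (+)" "vscale (graded_hom V W) = smult" "grade (graded_hom V W) = hom_deg V W"
    by (simp_all add: graded_hom_def)
  show ?thesis
    unfolding graded_space_def sel carrier_graded_hom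
  proof (intro conjI allI impI)
    fix c :: "'g \<Rightarrow> 'v \<Rightarrow> 'w" and \<gamma>
    assume "finite {\<gamma>. c \<gamma> \<noteq> 0}" "\<forall>\<gamma>. c \<gamma> \<in> hom_deg V W \<gamma>" "(\<Sum>\<gamma> | c \<gamma> \<noteq> 0. c \<gamma>) = 0"
    then show "c \<gamma> = 0"
      by (intro independent[of c \<gamma>]) (assumption | erule spec)+
  qed (rule refl F.vector_space_axioms subspace_hom_deg)+
qed

sublocale Hom: gr_space "graded_hom V W"
  by standard (rule graded_space_graded_hom)

text \<open>Universal property of a presentation: a linear T upstairs descends once it is constant
  on the fibres of p, and its degree can be read off on generators.\<close>

lemma hom_deg_exists:
  assumes add: "\<And>a b. T (a + b) = T a + T b" and scale: "\<And>c a. T (s c a) = vscale W c (T a)"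
    and wd: "\<And>a b. p a = p b \<Longrightarrow> T a = T b"
    and deg: "\<And>\<alpha> a. a \<in> H \<alpha> \<Longrightarrow> T a \<in> grade W (\<alpha> + \<gamma>)"
  shows "\<exists>h\<in>hom_deg V W \<gamma>. \<forall>a. p a \<in> carrier V \<longrightarrow> h (p a) = T a"
proof -
  \<comment> \<open>The chosen preimage may lie outside the span of the generators. Since T is
    constant on all fibres of p, the choice does not affect the value.\<close>
  define h where "h x = (if x \<in> carrier V then T (SOME a. x = p a) else 0)" for x
  have h_p: "h (p a) = T a" if "p a \<in> carrier V" for a
  proof -
    have "p a = p (SOME b. p a = p b)"
      by (rule someI) (rule refl)
    then have "T (SOME b. p a = p b) = T a"
      by (rule wd[symmetric])
    with that show ?thesis
      by (simp add: h_def)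
  qed
  then have h: "h (p a) = T a" if "a \<in> V.span (\<Union>\<gamma>. H \<gamma>)" for a
    using that by (simp add: V.carrier_image)
  have T0: "T 0 = 0"
    using add[of 0 0] by simp
  have span: "T a \<in> U" if "a \<in> V.span X" "W.subspace U" "\<And>a. a \<in> X \<Longrightarrow> T a \<in> U" for a X U
    using that(1) by (induction rule: V.span_induct_alt)
      (auto simp: T0 add scale that W.subspace_0 W.subspace_add W.subspace_scale)
  have "h \<in> hom_deg V W \<gamma>"
    unfolding hom_deg_eq linear_maps_def
  proof (safe)
    fix x assume "x \<in> carrier V"
    then obtain a where "x = p a" "a \<in> V.span (\<Union>\<gamma>. H \<gamma>)"
      by (auto simp: V.carrier_image)
    then show "h x \<in> carrier W"
      using span[of a "\<Union>\<gamma>. H \<gamma>" "carrier W"] deg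
      by (auto simp: h intro: W.subspace_carrier W.grade_carrier)
    fix c show "h (vscale V c x) = vscale W c (h x)"
      using \<open>x = p a\<close> \<open>a \<in> _\<close> by (simp add: V.vscale_p h V.span_scale scale)
    fix y assume "y \<in> carrier V"
    then obtain b where "y = p b" "b \<in> V.span (\<Union>\<gamma>. H \<gamma>)"
      by (auto simp: V.carrier_image)
    then show "h (vadd V x y) = h x + h y"
      using \<open>x = p a\<close> \<open>a \<in> _\<close> by (simp add: V.vadd_p h V.span_add add)
  next
    fix \<alpha> x assume "x \<in> grade V \<alpha>"
    then obtain a where a: "x = p a" "a \<in> V.span (H \<alpha>)"
      by (auto simp: V.grade_image)
    moreover have "a \<in> V.span (\<Union>\<gamma>. H \<gamma>)"
      using a(2) V.span_mono[of "H \<alpha>" "\<Union>\<gamma>. H \<gamma>"] by blast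
    ultimately show "h x \<in> grade W (\<alpha> + \<gamma>)"
      using span[of a "H \<alpha>" "grade W (\<alpha> + \<gamma>)"] deg by (auto simp: h intro: W.subspace_grade)
  qed (simp add: h_def)
  with h_p show ?thesis by blast
qed

end

text \<open>An honest graded space presents itself, with its grades as generators. This lets it
  serve as the source of the maps in \<open>graded_homs\<close>.\<close>

lemma presentation_graded_space:
  assumes "graded_space V"
  shows "presentation (vscale V) V (\<lambda>x. x) (grade V)"
proof -
  interpret gr_space V by standard fact
  show ?thesis
    by standard (simp_all add: carrier_eq_span vadd_eq span_eq_iff[THEN iffD2, OF subspace_grade])
qed


section \<open>Free spaces and quotients\<close>

lemma lookup_free_scale: "Poly_Mapping.lookup (free_scale c q) k = c * Poly_Mapping.lookup q k"
  by (simp add: free_scale_def Poly_Mapping.map.rep_eq when_def)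

interpretation free: vector_space "free_scale :: 'k::field \<Rightarrow> ('x \<Rightarrow>\<^sub>0 'k) \<Rightarrow> _"
  by standard
    (auto intro!: poly_mapping_eqI simp: lookup_free_scale lookup_add algebra_simps)

lemma free_scale_eq_times: "free_scale c q = Poly_Mapping.single 0 c * q"
  for q :: "'x::monoid_add \<Rightarrow>\<^sub>0 'k::field"
  by (simp add: free_scale_def mult_map_scale_conv_mult)

lemma single_eq_free_scale: "Poly_Mapping.single k c = free_scale c (free_gen k)"
  by (rule poly_mapping_eqI) (simp add: lookup_free_scale free_gen_def lookup_single when_def)

lemma span_free_gen: "q \<in> free.span (range free_gen)"
proof -
  have "q = (\<Sum>k\<in>Poly_Mapping.keys q. Poly_Mapping.single k (Poly_Mapping.lookup q k))"
    by (rule poly_mapping_eqI)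
      (auto simp: lookup_sum lookup_single when_def sum.delta' in_keys_iff)
  also have "\<dots> \<in> free.span (range free_gen)"
    unfolding single_eq_free_scale by (intro free.span_sum free.span_scale free.span_base rangeI)
  finally show ?thesis .
qed

lemma free_induct [case_names zero step]:
  assumes "P 0" "\<And>c k q. P q \<Longrightarrow> P (free_scale c (free_gen k) + q)"
  shows "P q"
  using span_free_gen[of q] by (induction rule: free.span_induct_alt) (auto intro: assms)

lemma free_gen_append: "free_gen (xs @ ys) = free_gen xs * (free_gen ys :: 'x list \<Rightarrow>\<^sub>0 'k::field)"
  by (simp add: free_gen_def mult_single plus_list_def)

lemma free_gen_Cons: "free_gen (x # xs) = free_gen [x] * (free_gen xs :: 'x list \<Rightarrow>\<^sub>0 'k::field)"
  using free_gen_append[of "[x]" xs] by simp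

lemma free_gen_Nil: "free_gen [] = (1 :: 'x list \<Rightarrow>\<^sub>0 'k::field)"
  by (simp add: free_gen_def zero_list_def[symmetric])

lemma free_scale_times_left: "free_scale c q * r = free_scale c (q * r)"
  for q :: "'x::monoid_add \<Rightarrow>\<^sub>0 'k::field"
  by (simp add: free_scale_eq_times mult.assoc)

text \<open>The product is noncommutative in general, but constants are central: they sit at the
  neutral element of the monoid.\<close>

lemma free_scale_times_right: "q * free_scale c r = free_scale c (q * r)"
  for q :: "'x::monoid_add \<Rightarrow>\<^sub>0 'k::field"
proof -
  have "q * Poly_Mapping.single 0 c = Poly_Mapping.single 0 c * q"
  proof (induction q rule: free_induct)
    case (step d k q)
    then show ?case
      by (simp add: distrib_left distrib_right single_eq_free_scale[symmetric] mult_single mult.commute)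
  qed simp
  then show ?thesis
    by (simp add: free_scale_eq_times mult.assoc[symmetric])
qed

definition free_extend :: "('k::field \<Rightarrow> 'w::ab_group_add \<Rightarrow> 'w) \<Rightarrow> ('x \<Rightarrow> 'w) \<Rightarrow> ('x \<Rightarrow>\<^sub>0 'k) \<Rightarrow> 'w" where
  "free_extend s f q = (\<Sum>k\<in>Poly_Mapping.keys q. s (Poly_Mapping.lookup q k) (f k))"

context vector_space
begin

lemma free_extend_superset:
  assumes "finite A" "Poly_Mapping.keys q \<subseteq> A"
  shows "free_extend scale f q = (\<Sum>k\<in>A. scale (Poly_Mapping.lookup q k) (f k))"
  unfolding free_extend_def using assms
  by (intro sum.mono_neutral_left) (auto simp: in_keys_iff)

lemma free_extend_add: "free_extend scale f (q + r) = free_extend scale f q + free_extend scale f r"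
proof -
  let ?A = "Poly_Mapping.keys q \<union> Poly_Mapping.keys r"
  have "Poly_Mapping.keys (q + r) \<subseteq> ?A"
    by (rule Poly_Mapping.keys_add)
  then show ?thesis
    by (simp add: free_extend_superset[of ?A] lookup_add scale_left_distrib sum.distrib)
qed

lemma free_extend_scale: "free_extend scale f (free_scale c q) = scale c (free_extend scale f q)"
proof -
  have "Poly_Mapping.keys (free_scale c q) \<subseteq> Poly_Mapping.keys q"
    by (auto simp: in_keys_iff lookup_free_scale)
  then show ?thesis
    by (simp add: free_extend_superset[of "Poly_Mapping.keys q"] lookup_free_scale scale_sum_right)
qed

lemma free_extend_gen [simp]: "free_extend scale f (free_gen k) = f k"
  by (simp add: free_extend_def free_gen_def)

lemma free_extend_zero [simp]: "free_extend scale f 0 = 0"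
  by (simp add: free_extend_def)

lemma free_extend_diff: "free_extend scale f (q - r) = free_extend scale f q - free_extend scale f r"
  using free_extend_add[of f "q - r" r] by simp

lemma coset_eq_iff:
  assumes "subspace U"
  shows "coset U x = coset U y \<longleftrightarrow> x - y \<in> U"
proof
  assume "coset U x = coset U y"
  moreover have "x \<in> coset U x"
    using assms by (simp add: coset_def subspace_0)
  ultimately show "x - y \<in> U"
    by (simp add: coset_def)
next
  assume *: "x - y \<in> U"
  have "z - x \<in> U \<longleftrightarrow> z - y \<in> U" for z
    using subspace_add[OF assms _ *, of "z - x"] subspace_diff[OF assms _ *, of "z - y"] by auto
  then show "coset U x = coset U y"
    by (simp add: coset_def)
qed

lemma coset_self: "subspace U \<Longrightarrow> x \<in> coset U x"
  by (simp add: coset_def subspace_0)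

text \<open>\<open>quotient_space\<close> defines the sum as a union over all representatives; the
  members of that union coincide, so it collapses to one coset.\<close>

lemma coset_Union_add:
  assumes "subspace U"
  shows "(\<Union>x\<in>coset U a. \<Union>y\<in>coset U b. coset U (x + y)) = coset U (a + b)"
proof -
  have "coset U (x + y) = coset U (a + b)" if "x \<in> coset U a" "y \<in> coset U b" for x y
    using that subspace_add[OF assms, of "x - a" "y - b"]
    by (simp add: coset_eq_iff[OF assms]) (simp add: coset_def algebra_simps)
  then show ?thesis
    using coset_self[OF assms] by blast
qed

lemma coset_Union_scale:
  assumes "subspace U"
  shows "(\<Union>x\<in>coset U a. coset U (scale c x)) = coset U (scale c a)"
proof -
  have "coset U (scale c x) = coset U (scale c a)" if "x \<in> coset U a" for x
    using that subspace_scale[OF assms, of "x - a" c]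
    by (simp add: coset_eq_iff[OF assms]) (simp add: coset_def algebra_simps)
  then show ?thesis
    using coset_self[OF assms] by blast
qed

text \<open>Exterior powers and tensor products are defined from arbitrary generators A. If each of
  these is, modulo U, a combination of the homogeneous ones in G, both families give the same
  quotient.\<close>

lemma coset_image_span:
  assumes "subspace U" "A \<subseteq> span (G \<union> U)" "G \<subseteq> span A"
  shows "coset U ` span A = coset U ` span G"
proof
  show "coset U ` span G \<subseteq> coset U ` span A"
    using span_minimal[OF assms(3) subspace_span] by blast
  show "coset U ` span A \<subseteq> coset U ` span G"
  proof safe
    fix x assume "x \<in> span A"
    then have "x \<in> span (G \<union> U)"
      using span_minimal[OF assms(2) subspace_span] by blast
    then obtain g u where "x = g + u" "g \<in> span G" "u \<in> U"
      using assms(1) span_eq_iff[of U] unfolding span_Un by blast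
    then have "coset U x = coset U g"
      by (simp add: coset_eq_iff[OF assms(1)])
    with \<open>g \<in> span G\<close> show "coset U x \<in> coset U ` span G"
      by blast
  qed
qed

lemma presentation_quotient:
  assumes "subspace U" "vscale V = scale" "coset U ` carrier V = coset U ` span (\<Union>\<gamma>. H \<gamma>)"
    "\<And>\<gamma>. grade V \<gamma> = span (H \<gamma>)"
  shows "presentation scale (quotient_space V U) (coset U) H"
  using assms by unfold_locales
    (simp_all add: quotient_space_def coset_Union_add coset_Union_scale)

end


section \<open>Exterior powers\<close>

lemma two_sided_ideal_hull: "two_sided_ideal (two_sided_ideal hull X)"
  by (rule hull_in) (auto simp: two_sided_ideal_def)

text \<open>Scaling is multiplication by a constant, so absorption of products includes it.\<close>

lemma ideal_subspace:
  fixes I :: "('x::monoid_add \<Rightarrow>\<^sub>0 'k::field) set"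
  assumes "two_sided_ideal I"
  shows "free.subspace I"
  using assms by (auto intro!: free.subspaceI simp: two_sided_ideal_def free_scale_eq_times)

text \<open>Each letter carries its degree because the vector alone does not determine it: zero lies
  in every grade.\<close>

definition homog_word :: "('k, 'g, 'v, 'z) gspace_scheme \<Rightarrow> ('v \<times> 'g) list \<Rightarrow> bool" where
  "homog_word V ws = list_all (\<lambda>(x, a). x \<in> grade V a) ws"

lemma homog_word_simps [simp]:
  "homog_word V []"
  "homog_word V ((x, a) # ws) \<longleftrightarrow> x \<in> grade V a \<and> homog_word V ws"
  "homog_word V (us @ ws) \<longleftrightarrow> homog_word V us \<and> homog_word V ws"
  by (simp_all add: homog_word_def)

definition word_gens :: "('k::field, 'g::ab_group_add, 'v, 'z) gspace_scheme \<Rightarrow> nat \<Rightarrow> 'g \<Rightarrow> ('v list \<Rightarrow>\<^sub>0 'k) set" where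
  "word_gens V n \<gamma> = {free_gen (map fst ws) | ws.
     length ws = n \<and> homog_word V ws \<and> sum_list (map snd ws) = \<gamma>}"

lemma word_gens_eq:
  "word_gens V n \<gamma> = {free_gen xs | xs \<alpha>s. length xs = n \<and>
     list_all2 (\<lambda>x \<alpha>. x \<in> grade V \<alpha>) xs \<alpha>s \<and> sum_list \<alpha>s = \<gamma>}"
proof -
  have 1: "\<exists>ws. xs = map fst ws \<and> homog_word V ws \<and> \<alpha>s = map snd ws"
    if "list_all2 (\<lambda>x \<alpha>. x \<in> grade V \<alpha>) xs \<alpha>s" for xs \<alpha>s
    using that
    by (intro exI[of _ "zip xs \<alpha>s"]) (auto simp: list_all2_iff homog_word_def list_all_iff)
  have 2: "list_all2 (\<lambda>x \<alpha>. x \<in> grade V \<alpha>) (map fst ws) (map snd ws)" if "homog_word V ws" for ws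
    using that by (induction ws) auto
  show ?thesis
    unfolding word_gens_def
  proof safe
    fix ws assume "homog_word V ws" "n = length ws" "\<gamma> = sum_list (map snd ws)"
    with 2 show "\<exists>xs \<alpha>s. free_gen (map fst ws) = free_gen xs \<and> length xs = length ws \<and>
        list_all2 (\<lambda>x \<alpha>. x \<in> grade V \<alpha>) xs \<alpha>s \<and> sum_list \<alpha>s = sum_list (map snd ws)"
      using length_map by blast
  next
    fix xs \<alpha>s assume "list_all2 (\<lambda>x \<alpha>. x \<in> grade V \<alpha>) xs \<alpha>s"
    with 1 show "\<exists>ws. free_gen xs = free_gen (map fst ws) \<and> length ws = length xs \<and> homog_word V ws \<and>
        sum_list (map snd ws) = sum_list \<alpha>s"
      using length_map by metis
  qed
qed

locale full_space = gr_space V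
  for V :: "('k::field, 'g::ab_group_add, 'v::ab_group_add, 'z) gspace_scheme" +
  fixes \<epsilon> :: "'g \<Rightarrow> 'g \<Rightarrow> 'k"
  assumes carrier_UNIV: "carrier V = UNIV"
begin

lemma ideal_ext_ideal: "two_sided_ideal (ext_ideal \<epsilon> V)"
  unfolding ext_ideal_def by (rule two_sided_ideal_hull)

lemma subspace_ext_ideal: "free.subspace (ext_ideal \<epsilon> V)"
  by (rule ideal_subspace) (rule ideal_ext_ideal)

lemma ext_ideal_times: "q \<in> ext_ideal \<epsilon> V \<Longrightarrow> r * q \<in> ext_ideal \<epsilon> V" "q \<in> ext_ideal \<epsilon> V \<Longrightarrow> q * r \<in> ext_ideal \<epsilon> V"
  using ideal_ext_ideal by (auto simp: two_sided_ideal_def)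

lemma ext_ideal_add: "free_gen [x + y] - free_gen [x] - free_gen [y] \<in> ext_ideal \<epsilon> V"
  unfolding ext_ideal_def by (rule hull_inc) (auto simp: vadd_eq carrier_UNIV)

lemma ext_ideal_scale: "free_gen [vscale V c x] - free_scale c (free_gen [x]) \<in> ext_ideal \<epsilon> V"
  unfolding ext_ideal_def by (rule hull_inc) (auto simp: carrier_UNIV)

lemma ext_ideal_swap:
  assumes "m \<in> grade V \<alpha>" "n \<in> grade V \<beta>"
  shows "free_gen [m] * free_gen [n] + free_scale (\<epsilon> \<alpha> \<beta>) (free_gen [n] * free_gen [m]) \<in> ext_ideal \<epsilon> V"
  unfolding ext_ideal_def using assms by (intro hull_inc) blast

text \<open>Modulo the ideal every letter splits into homogeneous ones. The leading letter is
  decomposed by \<open>carrier_induct\<close>, with the additive relation times the tail carrying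
  out the splitting; the tail itself is covered by the induction on the list.\<close>

lemma free_gen_in_span:
  "free_gen xs \<in> free.span ((\<Union>\<gamma>. word_gens V (length xs) \<gamma>) \<union> ext_ideal \<epsilon> V)"
proof (induction xs)
  case Nil
  then show ?case
    by (intro free.span_base) (auto simp: word_gens_def)
next
  case (Cons x xs)
  let ?G = "\<lambda>n. (\<Union>\<gamma>. word_gens V n \<gamma>) \<union> ext_ideal \<epsilon> V"
  have "x \<in> carrier V"
    by (simp add: carrier_UNIV)
  then show ?case
  proof (induction rule: carrier_induct)
    case zero
    \<comment> \<open>The relation for scalar multiples, taken with scalar 0, leaves just this
      one-letter word.\<close>
    have "free_gen [0] \<in> ext_ideal \<epsilon> V"
      using ext_ideal_scale[of 0 0] by simp
    then show ?case
      using ext_ideal_times(2)[of "free_gen [0]" "free_gen xs"]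
      by (intro free.span_base) (simp add: free_gen_Cons[of 0 xs])
  next
    case (homog a x)
    have "free_gen [x] * q \<in> free.span (?G (Suc (length xs)))" if "q \<in> free.span (?G (length xs))" for q
      using that
    proof (induction rule: free.span_induct_alt)
      case base
      then show ?case by (simp add: free.span_zero)
    next
      case (step c q r)
      have "free_gen [x] * q \<in> ?G (Suc (length xs))"
      proof (cases "q \<in> ext_ideal \<epsilon> V")
        case True
        then show ?thesis by (simp add: ext_ideal_times)
      next
        case False
        with step obtain ws where "q = free_gen (map fst ws)" "length ws = length xs" "homog_word V ws"
          by (auto simp: word_gens_def)
        with homog have "free_gen [x] * q = free_gen (map fst ((x, a) # ws)) \<and>
            length ((x, a) # ws) = Suc (length xs) \<and> homog_word V ((x, a) # ws)"
          by (simp add: free_gen_Cons[of x "map fst ws"])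
        then show ?thesis
          unfolding word_gens_def by blast
      qed
      with step(2) show ?case
        by (simp add: distrib_left free_scale_times_right free.span_add free.span_scale free.span_base)
    qed
    with Cons show ?case
      by (simp add: free_gen_Cons[of x xs])
  next
    case (add v w)
    have "(free_gen [v + w] - free_gen [v] - free_gen [w]) * free_gen xs \<in> ext_ideal \<epsilon> V"
      by (rule ext_ideal_times(2)[OF ext_ideal_add])
    then have "free_gen ((v + w) # xs) - free_gen (v # xs) - free_gen (w # xs) \<in> ext_ideal \<epsilon> V"
      by (simp add: left_diff_distrib free_gen_Cons[symmetric])
    then have "free_gen ((v + w) # xs) - free_gen (v # xs) - free_gen (w # xs) \<in> free.span (?G (Suc (length xs)))"
      by (intro free.span_base) simp
    with add have "(free_gen ((v + w) # xs) - free_gen (v # xs) - free_gen (w # xs)) + free_gen (v # xs) + free_gen (w # xs)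
        \<in> free.span (?G (Suc (length xs)))"
      by (intro free.span_add) simp_all
    then show ?case by simp
  qed
qed

lemma presentation_ext_power:
  "presentation free_scale (ext_power \<epsilon> V n) (coset (ext_ideal \<epsilon> V)) (word_gens V n)"
  unfolding ext_power_def
proof (rule free.presentation_quotient[OF subspace_ext_ideal])
  have "coset (ext_ideal \<epsilon> V) ` free.span {free_gen xs | xs. length xs = n \<and> set xs \<subseteq> carrier V}
      = coset (ext_ideal \<epsilon> V) ` free.span (\<Union>\<gamma>. word_gens V n \<gamma>)"
  proof (rule free.coset_image_span[OF subspace_ext_ideal])
    show "{free_gen xs | xs. length xs = n \<and> set xs \<subseteq> carrier V}
        \<subseteq> free.span ((\<Union>\<gamma>. word_gens V n \<gamma>) \<union> ext_ideal \<epsilon> V)"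
      using free_gen_in_span by auto
    show "(\<Union>\<gamma>. word_gens V n \<gamma>) \<subseteq> free.span {free_gen xs | xs. length xs = n \<and> set xs \<subseteq> carrier V}"
    proof -
      have "(\<Union>\<gamma>. word_gens V n \<gamma>) \<subseteq> {free_gen xs | xs. length xs = n \<and> set xs \<subseteq> carrier V}"
        by (auto simp: word_gens_def carrier_UNIV)
      then show ?thesis
        by (rule subset_trans[OF _ free.span_superset])
    qed
  qed
  then show "coset (ext_ideal \<epsilon> V) ` carrier
      \<lparr>carrier = free.span {free_gen xs |xs. length xs = n \<and> set xs \<subseteq> carrier V}, vadd = (+),
       vscale = free_scale, grade = \<lambda>\<gamma>. free.span {free_gen xs |xs \<alpha>s. length xs = n \<and>
         list_all2 (\<lambda>x \<alpha>. x \<in> grade V \<alpha>) xs \<alpha>s \<and> sum_list \<alpha>s = \<gamma>}\<rparr>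
      = coset (ext_ideal \<epsilon> V) ` free.span (\<Union>\<gamma>. word_gens V n \<gamma>)"
    by simp
qed (simp_all add: word_gens_eq)

end


section \<open>Tensor products\<close>

definition tensor_gens :: "('k::field, 'g::ab_group_add, 'v, 'y) gspace_scheme \<Rightarrow>
    ('k, 'g, 'w, 'z) gspace_scheme \<Rightarrow> 'g \<Rightarrow> ('v \<times> 'w \<Rightarrow>\<^sub>0 'k) set" where
  "tensor_gens V W \<gamma> = {free_gen (x, y) | x y \<alpha> \<beta>. x \<in> grade V \<alpha> \<and> y \<in> grade W \<beta> \<and> \<alpha> + \<beta> = \<gamma>}"

lemma tensor_relI:
  fixes V :: "('k::field, 'g, 'v, 'y) gspace_scheme" and W :: "('k, 'g, 'w, 'z) gspace_scheme"
  shows "x \<in> carrier V \<Longrightarrow> x' \<in> carrier V \<Longrightarrow> y \<in> carrier W \<Longrightarrow>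
      free_gen (vadd V x x', y) - free_gen (x, y) - free_gen (x', y) \<in> tensor_rel V W"
    and "x \<in> carrier V \<Longrightarrow> y \<in> carrier W \<Longrightarrow> y' \<in> carrier W \<Longrightarrow>
      free_gen (x, vadd W y y') - free_gen (x, y) - free_gen (x, y') \<in> tensor_rel V W"
    and "x \<in> carrier V \<Longrightarrow> y \<in> carrier W \<Longrightarrow>
      free_gen (vscale V c x, y) - free_scale c (free_gen (x, y)) \<in> tensor_rel V W"
    and "x \<in> carrier V \<Longrightarrow> y \<in> carrier W \<Longrightarrow>
      free_gen (x, vscale W c y) - free_scale c (free_gen (x, y)) \<in> tensor_rel V W"
  unfolding tensor_rel_def by (rule free.span_base, blast)+

lemma subspace_tensor_rel: "free.subspace (tensor_rel V W)"
  by (simp add: tensor_rel_def)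

text \<open>The two factors are decomposed by different means. W is an honest graded space, so
  \<open>carrier_induct\<close> splits y; V is known only through its presentation, so x is written
  as \<open>p a\<close> and the induction runs over a.\<close>

lemma (in graded_homs) free_gen_pair_in_span:
  assumes "x \<in> carrier V" "y \<in> carrier W"
  shows "free_gen (x, y) \<in> free.span ((\<Union>\<gamma>. tensor_gens V W \<gamma>) \<union> tensor_rel V W)" (is "_ \<in> free.span ?G")
  using assms(2)
proof (induction rule: W.carrier_induct)
  case zero
  show ?case
    using tensor_relI(4)[OF assms(1), of 0 W 0] by (intro free.span_base) (simp add: W.subspace_0 W.subspace_carrier)
next
  case (add v w)
  have "free_gen (x, v + w) - free_gen (x, v) - free_gen (x, w) \<in> free.span ?G"
    using tensor_relI(2)[OF assms(1) add(1,2)] by (intro free.span_base) (simp add: W.vadd_eq)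
  with add have "(free_gen (x, v + w) - free_gen (x, v) - free_gen (x, w)) + free_gen (x, v) + free_gen (x, w)
      \<in> free.span ?G"
    by (intro free.span_add)
  then show ?case by simp
next
  case (homog \<beta> y)
  note y = W.grade_carrier[OF homog]
  obtain a where a: "a \<in> V.span (\<Union>\<gamma>. H \<gamma>)" "x = p a"
    using assms(1) by (auto simp: V.carrier_image)
  have "a \<in> V.span (\<Union>\<gamma>. H \<gamma>) \<and> free_gen (p a, y) \<in> free.span ?G"
    using a(1)
  proof (induction rule: V.span_induct_alt)
    case base
    have "p 0 \<in> carrier V"
      by (auto simp: V.carrier_image V.span_zero)
    then show ?case
      using tensor_relI(3)[of "p 0" V y W 0] y
      by (auto intro!: free.span_base V.span_zero simp: V.vscale_p)
  next
    case (step c h b)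
    then obtain \<alpha> where h: "h \<in> H \<alpha>"
      by blast
    have b: "p b \<in> carrier V"
      using step by (auto simp: V.carrier_image)
    have sh: "s c h \<in> V.span (\<Union>\<gamma>. H \<gamma>)"
      using step(1) by (intro V.span_scale V.span_base)
    have "free_gen (p h, y) \<in> tensor_gens V W (\<alpha> + \<beta>)"
      unfolding tensor_gens_def using generator_grade[OF h] homog by blast
    then have gen: "free_gen (p h, y) \<in> free.span ?G"
      by (intro free.span_base) blast
    have "free_gen (vscale V c (p h), y) - free_scale c (free_gen (p h, y)) \<in> free.span ?G"
      using tensor_relI(3)[OF generator_carrier[OF h] y] by (intro free.span_base) simp
    from free.span_add[OF this free.span_scale[OF gen, of c]]
    have 1: "free_gen (p (s c h), y) \<in> free.span ?G"
      by (simp add: V.vscale_p)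
    have "free_gen (vadd V (p (s c h)) (p b), y) - free_gen (p (s c h), y) - free_gen (p b, y) \<in> free.span ?G"
      using tensor_relI(1)[OF _ b y, of "p (s c h)"] sh by (intro free.span_base) (auto simp: V.carrier_image)
    from free.span_add[OF free.span_add[OF this 1] conjunct2[OF step(2)]]
    have "free_gen (p (s c h + b), y) \<in> free.span ?G"
      by (simp add: V.vadd_p)
    then show ?case
      using sh step(2) V.span_add by blast
  qed
  then show ?case
    using a by simp
qed

lemma (in graded_homs) V_grade_carrier:
  assumes "x \<in> grade V \<gamma>"
  shows "x \<in> carrier V"
proof -
  have "V.span (H \<gamma>) \<subseteq> V.span (\<Union>\<gamma>. H \<gamma>)"
    by (rule V.span_mono) blast
  with assms show ?thesis
    by (auto simp: V.carrier_image V.grade_image)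
qed

lemma (in graded_homs) presentation_tensor:
  "presentation free_scale (tensor_space V W) (coset (tensor_rel V W)) (tensor_gens V W)"
  unfolding tensor_space_def
proof (rule free.presentation_quotient[OF subspace_tensor_rel])
  have "coset (tensor_rel V W) ` free.span {free_gen (x, y) | x y. x \<in> carrier V \<and> y \<in> carrier W}
      = coset (tensor_rel V W) ` free.span (\<Union>\<gamma>. tensor_gens V W \<gamma>)"
  proof (rule free.coset_image_span[OF subspace_tensor_rel])
    show "{free_gen (x, y) | x y. x \<in> carrier V \<and> y \<in> carrier W}
        \<subseteq> free.span ((\<Union>\<gamma>. tensor_gens V W \<gamma>) \<union> tensor_rel V W)"
      using free_gen_pair_in_span by blast
    have "(\<Union>\<gamma>. tensor_gens V W \<gamma>) \<subseteq> {free_gen (x, y) | x y. x \<in> carrier V \<and> y \<in> carrier W}"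
      unfolding tensor_gens_def using V_grade_carrier W.grade_carrier by blast
    then show "(\<Union>\<gamma>. tensor_gens V W \<gamma>) \<subseteq> free.span {free_gen (x, y) | x y. x \<in> carrier V \<and> y \<in> carrier W}"
      by (rule subset_trans[OF _ free.span_superset])
  qed
  then show "coset (tensor_rel V W) ` carrier
      \<lparr>carrier = free.span {free_gen (x, y) |x y. x \<in> carrier V \<and> y \<in> carrier W}, vadd = (+),
       vscale = free_scale, grade = \<lambda>\<gamma>. free.span {free_gen (x, y) |x y \<alpha> \<beta>.
         x \<in> grade V \<alpha> \<and> y \<in> grade W \<beta> \<and> \<alpha> + \<beta> = \<gamma>}\<rparr>
      = coset (tensor_rel V W) ` free.span (\<Union>\<gamma>. tensor_gens V W \<gamma>)"
    by simp
qed (simp_all add: tensor_gens_def)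


section \<open>Alternating cochains on homogeneous words\<close>

text \<open>A cochain is handled through its values on words, i.e. lists of arguments paired with their
  degrees. Multilinearity and \<open>\<epsilon>\<close>-alternation are stated recursively, by freezing the first
  argument: this makes them provable by induction for the recursively defined operators below.\<close>

locale cochain_space = L: full_space L \<epsilon> + W: gr_space W
  for L :: "('k::field, 'g::ab_group_add, 's::ab_group_add, 'y) gspace_scheme"
    and \<epsilon> :: "'g \<Rightarrow> 'g \<Rightarrow> 'k"
    and W :: "('k, 'g, 'w::ab_group_add, 'z) gspace_scheme"
begin

primrec alternating :: "nat \<Rightarrow> 'g \<Rightarrow> (('s \<times> 'g) list \<Rightarrow> 'w) \<Rightarrow> bool" where
  "alternating 0 \<beta> R \<longleftrightarrow> R [] \<in> grade W \<beta>"
| "alternating (Suc n) \<beta> R \<longleftrightarrow>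
    (\<forall>a. \<forall>x\<in>grade L a. alternating n (\<beta> + a) (\<lambda>ws. R ((x, a) # ws))) \<and>
    (\<forall>a. \<forall>x\<in>grade L a. \<forall>y\<in>grade L a. \<forall>ws. homog_word L ws \<longrightarrow> length ws = n \<longrightarrow>
      R ((x + y, a) # ws) = R ((x, a) # ws) + R ((y, a) # ws)) \<and>
    (\<forall>c a. \<forall>x\<in>grade L a. \<forall>ws. homog_word L ws \<longrightarrow> length ws = n \<longrightarrow>
      R ((vscale L c x, a) # ws) = vscale W c (R ((x, a) # ws))) \<and>
    (\<forall>a b. \<forall>x\<in>grade L a. \<forall>y\<in>grade L b. \<forall>ws. homog_word L ws \<longrightarrow> Suc (length ws) = n \<longrightarrow>
      R ((x, a) # (y, b) # ws) = vscale W (- \<epsilon> a b) (R ((y, b) # (x, a) # ws)))"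

lemma alternating_Cons:
  "alternating (Suc n) \<beta> R \<Longrightarrow> x \<in> grade L a \<Longrightarrow> alternating n (\<beta> + a) (\<lambda>ws. R ((x, a) # ws))"
  by simp

lemma alternating_add:
  "alternating (Suc n) \<beta> R \<Longrightarrow> x \<in> grade L a \<Longrightarrow> y \<in> grade L a \<Longrightarrow> homog_word L ws \<Longrightarrow> length ws = n \<Longrightarrow>
    R ((x + y, a) # ws) = R ((x, a) # ws) + R ((y, a) # ws)"
  by simp

lemma alternating_scale:
  "alternating (Suc n) \<beta> R \<Longrightarrow> x \<in> grade L a \<Longrightarrow> homog_word L ws \<Longrightarrow> length ws = n \<Longrightarrow>
    R ((vscale L c x, a) # ws) = vscale W c (R ((x, a) # ws))"
  by simp

lemma alternating_swap:
  "alternating (Suc n) \<beta> R \<Longrightarrow> x \<in> grade L a \<Longrightarrow> y \<in> grade L b \<Longrightarrow> homog_word L ws \<Longrightarrow> Suc (length ws) = n \<Longrightarrow>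
    R ((x, a) # (y, b) # ws) = vscale W (- \<epsilon> a b) (R ((y, b) # (x, a) # ws))"
  unfolding alternating.simps by blast

lemma alternating_SucI:
  assumes "\<And>a x. x \<in> grade L a \<Longrightarrow> alternating n (\<beta> + a) (\<lambda>ws. R ((x, a) # ws))"
    and "\<And>a x y ws. x \<in> grade L a \<Longrightarrow> y \<in> grade L a \<Longrightarrow> homog_word L ws \<Longrightarrow> length ws = n \<Longrightarrow>
      R ((x + y, a) # ws) = R ((x, a) # ws) + R ((y, a) # ws)"
    and "\<And>c a x ws. x \<in> grade L a \<Longrightarrow> homog_word L ws \<Longrightarrow> length ws = n \<Longrightarrow>
      R ((vscale L c x, a) # ws) = vscale W c (R ((x, a) # ws))"
    and "\<And>a b x y ws. x \<in> grade L a \<Longrightarrow> y \<in> grade L b \<Longrightarrow> homog_word L ws \<Longrightarrow> Suc (length ws) = n \<Longrightarrow>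
      R ((x, a) # (y, b) # ws) = vscale W (- \<epsilon> a b) (R ((y, b) # (x, a) # ws))"
  shows "alternating (Suc n) \<beta> R"
  unfolding alternating.simps using assms by blast

declare alternating.simps(2) [simp del]

lemma alternating_zero_arg:
  assumes "alternating (Suc n) \<beta> R" "homog_word L ws" "length ws = n"
  shows "R ((0, a) # ws) = 0"
  using alternating_scale[OF assms(1) _ assms(2,3), of 0 a 0] L.subspace_0[OF L.subspace_grade] by simp

lemma alternating_grade:
  assumes "alternating n \<beta> R" "homog_word L ws" "length ws = n"
  shows "R ws \<in> grade W (\<beta> + sum_list (map snd ws))"
  using assms
proof (induction ws arbitrary: n \<beta> R)
  case (Cons w ws)
  obtain x a where "w = (x, a)" by fastforce
  with Cons.prems Cons.IH[of "length ws" "\<beta> + a" "\<lambda>ws. R (w # ws)"] show ?case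
    by (auto simp: alternating_Cons add.assoc)
qed simp

lemma alternating_plus:
  "alternating n \<beta> R \<Longrightarrow> alternating n \<beta> R' \<Longrightarrow> alternating n \<beta> (\<lambda>ws. R ws + R' ws)"
proof (induction n arbitrary: \<beta> R R')
  case 0
  then show ?case by (simp add: W.subspace_add W.subspace_grade)
next
  case (Suc n)
  note R = Suc.prems
  show ?case
  proof (rule alternating_SucI)
    show "alternating n (\<beta> + a) (\<lambda>ws. R ((x, a) # ws) + R' ((x, a) # ws))" if "x \<in> grade L a" for x a
      using Suc that by (intro Suc.IH alternating_Cons)
    show "R ((x, a) # (y, b) # ws) + R' ((x, a) # (y, b) # ws) =
        vscale W (- \<epsilon> a b) (R ((y, b) # (x, a) # ws) + R' ((y, b) # (x, a) # ws))"
      if "x \<in> grade L a" "y \<in> grade L b" "homog_word L ws" "Suc (length ws) = n" for x y a b ws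
      unfolding alternating_swap[OF R(1) that] alternating_swap[OF R(2) that] W.scale_right_distrib ..
  qed (simp_all add: alternating_add[OF R(1)] alternating_add[OF R(2)]
      alternating_scale[OF R(1)] alternating_scale[OF R(2)] W.scale_right_distrib)
qed

lemma alternating_vscale:
  "alternating n \<beta> R \<Longrightarrow> alternating n \<beta> (\<lambda>ws. vscale W c (R ws))"
proof (induction n arbitrary: \<beta> R)
  case 0
  then show ?case by (simp add: W.subspace_scale W.subspace_grade)
next
  case (Suc n)
  note R = Suc.prems
  show ?case
  proof (rule alternating_SucI)
    show "alternating n (\<beta> + a) (\<lambda>ws. vscale W c (R ((x, a) # ws)))" if "x \<in> grade L a" for x a
      using Suc that by (intro Suc.IH alternating_Cons)
    show "vscale W c (R ((x, a) # (y, b) # ws)) = vscale W (- \<epsilon> a b) (vscale W c (R ((y, b) # (x, a) # ws)))"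
      if "x \<in> grade L a" "y \<in> grade L b" "homog_word L ws" "Suc (length ws) = n" for x y a b ws
      unfolding alternating_swap[OF R that] by (simp add: mult.commute)
  qed (simp_all add: alternating_add[OF R] alternating_scale[OF R] W.scale_right_distrib mult.commute)
qed

lemma alternating_diff:
  "alternating n \<beta> R \<Longrightarrow> alternating n \<beta> R' \<Longrightarrow> alternating n \<beta> (\<lambda>ws. R ws - R' ws)"
  using alternating_plus[of n \<beta> R "\<lambda>ws. vscale W (- 1) (R' ws)"] alternating_vscale[of n \<beta> R' "- 1"]
  by simp

section \<open>Multilinear expansion of arbitrary words into homogeneous ones\<close>

primrec extend :: "'s list \<Rightarrow> (('s \<times> 'g) list \<Rightarrow> 'w) \<Rightarrow> 'w" where
  "extend [] R = R []"
| "extend (x # xs) R = hsum L x (\<lambda>a u. extend xs (\<lambda>ws. R ((u, a) # ws)))"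

lemma extend_cong:
  assumes "\<And>ws. homog_word L ws \<Longrightarrow> length ws = length xs \<Longrightarrow> R ws = R' ws"
  shows "extend xs R = extend xs R'"
  using assms
proof (induction xs arbitrary: R R')
  case (Cons x xs)
  show ?case
    unfolding extend.simps
    by (rule L.hsum_cong) (auto simp: L.carrier_UNIV intro!: Cons)
qed simp

lemma extend_plus: "extend xs (\<lambda>ws. R ws + R' ws) = extend xs R + extend xs R'"
  by (induction xs arbitrary: R R') (simp_all add: L.hsum_add_fun)

lemma extend_vscale: "extend xs (\<lambda>ws. vscale W c (R ws)) = vscale W c (extend xs R)"
  by (induction xs arbitrary: R) (simp_all add: L.hsum_additive[of "vscale W c"] W.scale_right_distrib)

lemma extend_zero:
  assumes "\<And>ws. homog_word L ws \<Longrightarrow> length ws = length xs \<Longrightarrow> R ws = 0"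
  shows "extend xs R = 0"
  using extend_cong[of xs R "\<lambda>_. vscale W 0 0"] extend_vscale[of xs 0 "\<lambda>_. 0"] assms by simp

lemma extend_zero_arg:
  assumes "alternating (Suc (length vs)) \<beta> R"
  shows "extend vs (\<lambda>ws. R ((0, a) # ws)) = 0"
  by (rule extend_zero) (rule alternating_zero_arg[OF assms])

text \<open>On a homogeneous word each expansion has a single summand. \<open>hsum_homog\<close>
  applies because a zero letter makes the rest of the expansion vanish.\<close>

lemma extend_word:
  assumes "alternating (length ws) \<beta> R" "homog_word L ws"
  shows "extend (map fst ws) R = R ws"
  using assms
proof (induction ws arbitrary: \<beta> R)
  case (Cons w ws)
  obtain x a where w: "w = (x, a)" by fastforce
  have x: "x \<in> grade L a" "homog_word L ws" and alt: "alternating (Suc (length ws)) \<beta> R"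
    using Cons.prems w by auto
  have "extend (map fst (w # ws)) R = extend (map fst ws) (\<lambda>ws. R ((x, a) # ws))"
    using x alt by (simp add: w L.hsum_homog[where \<gamma> = a] extend_zero_arg)
  also have "\<dots> = R (w # ws)"
    using Cons.IH[OF alternating_Cons[OF alt x(1)] x(2)] by (simp add: w)
  finally show ?case .
qed simp

text \<open>Together with \<open>extend_scale_arg\<close> and \<open>extend_swap\<close> this covers
  the three families of relations in \<open>ext_ideal\<close>, placed between a prefix us and a
  suffix vs. The induction freezes the letters of us one by one until the relation stands at the
  front, where \<open>alternating\<close> speaks about it.\<close>

lemma extend_add_arg:
  assumes "alternating (length us + Suc (length vs)) \<beta> R"
  shows "extend (us @ (x + y) # vs) R = extend (us @ x # vs) R + extend (us @ y # vs) R"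
  using assms
proof (induction us arbitrary: \<beta> R)
  case Nil
  then have alt: "alternating (Suc (length vs)) \<beta> R" by simp
  have "extend vs (\<lambda>ws. R ((u + u', a) # ws)) = extend vs (\<lambda>ws. R ((u, a) # ws)) + extend vs (\<lambda>ws. R ((u', a) # ws))"
    if "u \<in> grade L a" "u' \<in> grade L a" for u u' a
    unfolding extend_plus[symmetric] by (rule extend_cong) (rule alternating_add[OF alt that])
  then show ?case
    by (simp add: L.hsum_add L.carrier_UNIV)
next
  case (Cons u us)
  have "hsum L u (\<lambda>a u. extend (us @ (x + y) # vs) (\<lambda>ws. R ((u, a) # ws))) =
      hsum L u (\<lambda>a u. extend (us @ x # vs) (\<lambda>ws. R ((u, a) # ws)) + extend (us @ y # vs) (\<lambda>ws. R ((u, a) # ws)))"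
    using Cons by (intro L.hsum_cong) (auto simp: L.carrier_UNIV intro: alternating_Cons)
  then show ?case
    by (simp add: L.hsum_add_fun)
qed

lemma extend_scale_arg:
  assumes "alternating (length us + Suc (length vs)) \<beta> R"
  shows "extend (us @ vscale L c x # vs) R = vscale W c (extend (us @ x # vs) R)"
  using assms
proof (induction us arbitrary: \<beta> R)
  case Nil
  then have alt: "alternating (Suc (length vs)) \<beta> R" by simp
  have "extend vs (\<lambda>ws. R ((vscale L c u, a) # ws)) = vscale W c (extend vs (\<lambda>ws. R ((u, a) # ws)))"
    if "u \<in> grade L a" for u a
    unfolding extend_vscale[symmetric] by (rule extend_cong) (rule alternating_scale[OF alt that])
  then show ?case
    using extend_zero_arg[OF alt]
    by (simp add: L.hsum_scale[where h = "vscale W c"] L.carrier_UNIV W.scale_right_distrib)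
next
  case (Cons u us)
  have "hsum L u (\<lambda>a u. extend (us @ vscale L c x # vs) (\<lambda>ws. R ((u, a) # ws))) =
      hsum L u (\<lambda>a u. vscale W c (extend (us @ x # vs) (\<lambda>ws. R ((u, a) # ws))))"
    using Cons by (intro L.hsum_cong) (auto simp: L.carrier_UNIV intro: alternating_Cons)
  then show ?case
    by (simp add: L.hsum_additive[of "vscale W c"] W.scale_right_distrib)
qed

lemma extend_swap:
  assumes "alternating (length us + Suc (Suc (length vs))) \<beta> R"
    and x: "x \<in> grade L a" and y: "y \<in> grade L b"
  shows "extend (us @ x # y # vs) R = vscale W (- \<epsilon> a b) (extend (us @ y # x # vs) R)"
  using assms(1)
proof (induction us arbitrary: \<beta> R)
  case Nil
  then have alt: "alternating (Suc (Suc (length vs))) \<beta> R" by simp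
  \<comment> \<open>Both letters are homogeneous, so the two outer sums of the expansion reduce to
    one term each; this is applied to both orders of the letters.\<close>
  have two: "extend (x # y # vs) R = extend vs (\<lambda>ws. R ((x, a) # (y, b) # ws))"
    if "x \<in> grade L a" "y \<in> grade L b" for x y a b
  proof -
    have "extend (y # vs) (\<lambda>ws. R ((0, c) # ws)) = 0" for c
      by (rule extend_zero_arg) (use alt in simp)
    then have "extend (x # y # vs) R = extend (y # vs) (\<lambda>ws. R ((x, a) # ws))"
      unfolding extend.simps(2)[of x] by (rule L.hsum_homog[OF that(1)])
    also have "\<dots> = extend vs (\<lambda>ws. R ((x, a) # (y, b) # ws))"
      unfolding extend.simps(2)
      by (rule L.hsum_homog[OF that(2)]) (rule extend_zero_arg[OF alternating_Cons[OF alt that(1)]])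
    finally show ?thesis .
  qed
  show ?case
    unfolding append_Nil two[OF x y] two[OF y x] extend_vscale[symmetric]
    by (rule extend_cong) (simp add: alternating_swap[OF alt x y] del: W.scale_minus_left)
next
  case (Cons u us)
  have "hsum L u (\<lambda>a u. extend (us @ x # y # vs) (\<lambda>ws. R ((u, a) # ws))) =
      hsum L u (\<lambda>c u. vscale W (- \<epsilon> a b) (extend (us @ y # x # vs) (\<lambda>ws. R ((u, c) # ws))))"
    using Cons by (intro L.hsum_cong) (auto simp: L.carrier_UNIV intro: alternating_Cons simp del: W.scale_minus_left)
  then show ?case
    by (simp add: L.hsum_additive[of "vscale W (- \<epsilon> a b)"] W.scale_right_distrib del: W.scale_minus_left)
qed

end

sublocale cochain_space \<subseteq> E: graded_homs free_scale "ext_power \<epsilon> L n" "coset (ext_ideal \<epsilon> L)" "word_gens L n" W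
  for n
  by (intro graded_homs.intro L.presentation_ext_power W.gr_space_axioms)

context cochain_space
begin

section \<open>Alternating functions on words versus linear maps on the exterior power\<close>

lemma word_gensI: "homog_word L ws \<Longrightarrow> free_gen (map fst ws) \<in> word_gens L (length ws) (sum_list (map snd ws))"
  unfolding word_gens_def by blast

lemma free_gen_span: "homog_word L ws \<Longrightarrow> free_gen (map fst ws) \<in> free.span (\<Union>\<gamma>. word_gens L (length ws) \<gamma>)"
  by (rule free.span_base) (blast intro: word_gensI)

lemma hom_exists:
  assumes alt: "alternating n \<beta> R"
  shows "\<exists>h\<in>hom_deg (ext_power \<epsilon> L n) W \<beta>.
    \<forall>ws. homog_word L ws \<longrightarrow> length ws = n \<longrightarrow> h (wedge \<epsilon> L (map fst ws)) = R ws"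
proof -
  \<comment> \<open>Words of other lengths are sent to 0, so that the relations in those lengths
    hold trivially.\<close>
  define T where "T = free_extend (vscale W) (\<lambda>xs. if length xs = n then extend xs R else 0)"
  have T_gen: "T (free_gen xs) = (if length xs = n then extend xs R else 0)" for xs
    by (simp add: T_def)
  have T_add: "T (p + q) = T p + T q" and T_diff: "T (p - q) = T p - T q"
    and T_scale: "T (free_scale c p) = vscale W c (T p)" for p q c
    by (simp_all add: T_def W.free_extend_add W.free_extend_diff W.free_extend_scale)
  have T_0: "T 0 = 0"
    by (simp add: T_def)
  \<comment> \<open>The largest two-sided ideal inside the kernel of T, tested on words only; the
    kernel itself need not be an ideal. Minimality of the hull reduces the inclusion of
    \<open>ext_ideal\<close> in J to its generators.\<close>
  define J where "J = {q. \<forall>us vs. T (free_gen us * q * free_gen vs) = 0}"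
  have "r * q \<in> J" if "q \<in> J" for q r
  proof (induction r rule: free_induct)
    case zero
    then show ?case by (simp add: J_def T_0)
  next
    case (step c k r)
    have "free_gen us * ((free_scale c (free_gen k) + r) * q) * free_gen vs =
        free_scale c (free_gen (us @ k) * q * free_gen vs) + free_gen us * (r * q) * free_gen vs" for us vs
      by (simp add: distrib_left distrib_right free_scale_times_left free_scale_times_right
          free_gen_append mult.assoc)
    with step that show ?case
      by (simp add: J_def T_add T_scale)
  qed
  moreover have "q * r \<in> J" if "q \<in> J" for q r
  proof (induction r rule: free_induct)
    case zero
    then show ?case by (simp add: J_def T_0)
  next
    case (step c k r)
    have "free_gen us * (q * (free_scale c (free_gen k) + r)) * free_gen vs =
        free_scale c (free_gen us * q * free_gen (k @ vs)) + free_gen us * (q * r) * free_gen vs" for us vs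
      by (simp add: distrib_left distrib_right free_scale_times_left free_scale_times_right
          free_gen_append mult.assoc)
    with step that show ?case
      by (simp add: J_def T_add T_scale)
  qed
  ultimately have "two_sided_ideal J"
    unfolding two_sided_ideal_def by (auto simp: J_def T_0 T_add distrib_left distrib_right)
  moreover have "free_gen [vadd L x y] - free_gen [x] - free_gen [y] \<in> J" for x y
  proof -
    have "T (free_gen us * (free_gen [x + y] - free_gen [x] - free_gen [y]) * free_gen vs) = 0" for us vs
      using extend_add_arg[of us vs \<beta> R x y] alt
      by (auto simp: left_diff_distrib right_diff_distrib T_diff free_gen_append[symmetric] T_gen)
    then show ?thesis by (simp add: J_def L.vadd_eq)
  qed
  moreover have "free_gen [vscale L c x] - free_scale c (free_gen [x]) \<in> J" for c x
  proof -
    have "T (free_gen us * (free_gen [vscale L c x] - free_scale c (free_gen [x])) * free_gen vs) = 0" for us vs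
      using extend_scale_arg[of us vs \<beta> R c x] alt
      by (auto simp: left_diff_distrib right_diff_distrib T_diff T_scale free_scale_times_left
          free_scale_times_right free_gen_append[symmetric] T_gen)
    then show ?thesis by (simp add: J_def)
  qed
  moreover have "free_gen [x] * free_gen [y] + free_scale (\<epsilon> a b) (free_gen [y] * free_gen [x]) \<in> J"
    if "x \<in> grade L a" "y \<in> grade L b" for x y a b
  proof -
    have "T (free_gen us * (free_gen [x] * free_gen [y] + free_scale (\<epsilon> a b) (free_gen [y] * free_gen [x]))
        * free_gen vs) = 0" for us vs
      using extend_swap[of us vs \<beta> R x a y b] alt that
      by (auto simp: distrib_left distrib_right T_add T_scale free_scale_times_left
          free_scale_times_right free_gen_append[symmetric] T_gen)
    then show ?thesis by (simp add: J_def)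
  qed
  ultimately have "ext_ideal \<epsilon> L \<subseteq> J"
    unfolding ext_ideal_def by (intro hull_minimal) auto
  then have T_ideal: "T q = 0" if "q \<in> ext_ideal \<epsilon> L" for q
  proof -
    \<comment> \<open>With empty words on both sides, membership in J says that T kills q
      itself.\<close>
    have "T (free_gen [] * q * free_gen []) = 0"
      using that \<open>ext_ideal \<epsilon> L \<subseteq> J\<close> unfolding J_def by blast
    then show ?thesis by (simp add: free_gen_Nil)
  qed
  have T_word: "T (free_gen (map fst ws)) = R ws" if "homog_word L ws" "length ws = n" for ws
    using that alt by (simp add: T_gen extend_word)
  have "\<exists>h\<in>hom_deg (ext_power \<epsilon> L n) W \<beta>. 
      \<forall>q. coset (ext_ideal \<epsilon> L) q \<in> carrier (ext_power \<epsilon> L n) \<longrightarrow> h (coset (ext_ideal \<epsilon> L) q) = T q"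
  proof (rule E.hom_deg_exists[OF T_add T_scale])
    show "T p = T q" if "coset (ext_ideal \<epsilon> L) p = coset (ext_ideal \<epsilon> L) q" for p q
      using that T_ideal[of "p - q"] by (simp add: free.coset_eq_iff[OF L.subspace_ext_ideal] T_diff)
    show "T q \<in> grade W (\<alpha> + \<beta>)" if "q \<in> word_gens L n \<alpha>" for q \<alpha>
      using that alternating_grade[OF alt] by (auto simp: word_gens_def T_word add.commute)
  qed
  then show ?thesis
    using E.generator_carrier[OF word_gensI] T_word unfolding wedge_def by metis
qed

text \<open>The converse of \<open>hom_exists\<close>. The recursion of \<open>alternating\<close>
  consumes letters one at a time while h always takes words with all n letters, so the letters
  already consumed are kept in the prefix us.\<close>

lemma hom_alternating_append:
  assumes h: "h \<in> hom_deg (ext_power \<epsilon> L n) W \<beta>"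
  shows "homog_word L us \<Longrightarrow> length us + m = n \<Longrightarrow>
    alternating m (\<beta> + sum_list (map snd us)) (\<lambda>ws. h (wedge \<epsilon> L (map fst (us @ ws))))"
proof (induction m arbitrary: us)
  case 0
  then show ?case
    using E.generator_grade[OF word_gensI[of us]] h
    by (simp add: hom_deg_eq wedge_def add.commute[of \<beta>])
next
  case (Suc m)
  let ?I = "ext_ideal \<epsilon> L"
  have lin: "h \<in> linear_maps (ext_power \<epsilon> L n) W"
    using h by (simp add: hom_deg_eq)
  have sp: "free_gen (map fst ws) \<in> free.span (\<Union>\<gamma>. word_gens L n \<gamma>)" if "homog_word L ws" "length ws = n" for ws
    using free_gen_span[of ws] that by simp
  \<comment> \<open>A relation among one or two letters stays in the ideal when multiplied by the
    words around it. This yields the rules for the letters that follow the prefix.\<close>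
  have mid: "free_gen us' * q * free_gen vs \<in> ?I" if "q \<in> ?I" for q us' vs
    using that by (simp add: L.ext_ideal_times)
  show ?case
  proof (rule alternating_SucI)
    fix a x assume "x \<in> grade L a"
    then show "alternating m (\<beta> + sum_list (map snd us) + a) (\<lambda>ws. h (wedge \<epsilon> L (map fst (us @ (x, a) # ws))))"
      using Suc.IH[of "us @ [(x, a)]"] Suc.prems by (simp add: add.assoc)
  next
    fix a x y ws assume *: "x \<in> grade L a" "y \<in> grade L a" "homog_word L ws" "length ws = m"
    have "wedge \<epsilon> L (map fst (us @ (x + y, a) # ws)) =
        coset ?I (free_gen (map fst (us @ (x, a) # ws)) + free_gen (map fst (us @ (y, a) # ws)))"
      unfolding wedge_def free.coset_eq_iff[OF L.subspace_ext_ideal]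
      using mid[OF L.ext_ideal_add[of x y], of "map fst us" "map fst ws"]
      by (simp add: left_diff_distrib right_diff_distrib distrib_left distrib_right
          free_gen_append[symmetric] diff_diff_eq)
    then show "h (wedge \<epsilon> L (map fst (us @ (x + y, a) # ws))) =
        h (wedge \<epsilon> L (map fst (us @ (x, a) # ws))) + h (wedge \<epsilon> L (map fst (us @ (y, a) # ws)))"
      using E.linear_maps_p(2)[OF lin sp sp, of "us @ (x, a) # ws" "us @ (y, a) # ws"] * Suc.prems
      unfolding wedge_def by simp
  next
    fix c a x ws assume *: "x \<in> grade L a" "homog_word L ws" "length ws = m"
    have "wedge \<epsilon> L (map fst (us @ (vscale L c x, a) # ws)) =
        coset ?I (free_scale c (free_gen (map fst (us @ (x, a) # ws))))"
      unfolding wedge_def free.coset_eq_iff[OF L.subspace_ext_ideal]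
      using mid[OF L.ext_ideal_scale[of c x], of "map fst us" "map fst ws"]
      by (simp add: left_diff_distrib right_diff_distrib free_gen_append[symmetric]
          free_scale_times_left free_scale_times_right)
    then show "h (wedge \<epsilon> L (map fst (us @ (vscale L c x, a) # ws))) =
        vscale W c (h (wedge \<epsilon> L (map fst (us @ (x, a) # ws))))"
      using E.linear_maps_p(1)[OF lin sp, of "us @ (x, a) # ws" c] * Suc.prems
      unfolding wedge_def by simp
  next
    fix a b x y ws assume *: "x \<in> grade L a" "y \<in> grade L b" "homog_word L ws" "Suc (length ws) = m"
    have "wedge \<epsilon> L (map fst (us @ (x, a) # (y, b) # ws)) =
        coset ?I (free_scale (- \<epsilon> a b) (free_gen (map fst (us @ (y, b) # (x, a) # ws))))"
      unfolding wedge_def free.coset_eq_iff[OF L.subspace_ext_ideal]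
      using mid[OF L.ext_ideal_swap[OF *(1,2)], of "map fst us" "map fst ws"]
      by (simp add: distrib_left distrib_right free_gen_append[symmetric]
          free_scale_times_left free_scale_times_right)
    then show "h (wedge \<epsilon> L (map fst (us @ (x, a) # (y, b) # ws))) =
        vscale W (- \<epsilon> a b) (h (wedge \<epsilon> L (map fst (us @ (y, b) # (x, a) # ws))))"
      using E.linear_maps_p(1)[OF lin sp, of "us @ (y, b) # (x, a) # ws" "- \<epsilon> a b"] * Suc.prems
      unfolding wedge_def by (simp del: W.scale_minus_left free.scale_minus_left)
  qed
qed

lemma hom_alternating:
  "h \<in> hom_deg (ext_power \<epsilon> L n) W \<beta> \<Longrightarrow> alternating n \<beta> (\<lambda>ws. h (wedge \<epsilon> L (map fst ws)))"
  using hom_alternating_append[of h n \<beta> "[]" n] by simp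

lemma hom_eqI:
  assumes "f \<in> carrier (graded_hom (ext_power \<epsilon> L n) W)" "g \<in> carrier (graded_hom (ext_power \<epsilon> L n) W)"
    and "\<And>ws. homog_word L ws \<Longrightarrow> length ws = n \<Longrightarrow> f (wedge \<epsilon> L (map fst ws)) = g (wedge \<epsilon> L (map fst ws))"
  shows "f = g"
  using assms(1,2) by (rule E.graded_hom_eqI) (use assms(3) in \<open>auto simp: word_gens_def wedge_def\<close>)

end


section \<open>The Lie derivative and the Chevalley-Eilenberg coboundary on words\<close>

lemma commutation_factorD:
  assumes "commutation_factor \<epsilon>"
  shows "\<epsilon> a b * \<epsilon> b a = 1" "\<epsilon> a (b + c) = \<epsilon> a b * \<epsilon> a c" "\<epsilon> (a + b) c = \<epsilon> a c * \<epsilon> b c"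
    "\<epsilon> a b \<noteq> 0"
  using assms by (auto simp: commutation_factor_def)

lemma commutation_factor_zero:
  assumes "commutation_factor \<epsilon>"
  shows "\<epsilon> a 0 = 1" "\<epsilon> 0 a = 1"
  using commutation_factorD(2)[OF assms, of a 0 0] commutation_factorD(3)[OF assms, of 0 0 a]
    commutation_factorD(4)[OF assms, of a 0] commutation_factorD(4)[OF assms, of 0 a]
  by simp_all

text \<open>Everything is asked on homogeneous arguments only: the bracket of
  \<open>lie_algebra_of\<close> and the action of \<open>C1_module\<close> are additive extensions,
  with an explicit formula just there.\<close>

locale lie_action = cochain_space L \<epsilon> W
  for L :: "('k::field, 'g::ab_group_add, 's::ab_group_add, 'y) gspace_scheme"
    and \<epsilon> :: "'g \<Rightarrow> 'g \<Rightarrow> 'k"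
    and W :: "('k, 'g, 'w::ab_group_add, 'z) gspace_scheme" +
  fixes br :: "'s \<Rightarrow> 's \<Rightarrow> 's" and ac :: "'s \<Rightarrow> 'w \<Rightarrow> 'w"
  assumes eps: "commutation_factor \<epsilon>"
    and br_grade: "\<And>a b x y. x \<in> grade L a \<Longrightarrow> y \<in> grade L b \<Longrightarrow> br x y \<in> grade L (a + b)"
    and br_add: "\<And>a b x x' y. x \<in> grade L a \<Longrightarrow> x' \<in> grade L a \<Longrightarrow> y \<in> grade L b \<Longrightarrow>
      br (x + x') y = br x y + br x' y"
    and br_scale: "\<And>a b c x y. x \<in> grade L a \<Longrightarrow> y \<in> grade L b \<Longrightarrow>
      br (vscale L c x) y = vscale L c (br x y)"
    and br_skew: "\<And>a b x y. x \<in> grade L a \<Longrightarrow> y \<in> grade L b \<Longrightarrow> br x y = vscale L (- \<epsilon> a b) (br y x)"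
    and ac_grade: "\<And>a b x n. x \<in> grade L a \<Longrightarrow> n \<in> grade W b \<Longrightarrow> ac x n \<in> grade W (b + a)"
    and ac_add_left: "\<And>a b x x' n. x \<in> grade L a \<Longrightarrow> x' \<in> grade L a \<Longrightarrow> n \<in> grade W b \<Longrightarrow>
      ac (x + x') n = ac x n + ac x' n"
    and ac_scale_left: "\<And>a b c x n. x \<in> grade L a \<Longrightarrow> n \<in> grade W b \<Longrightarrow>
      ac (vscale L c x) n = vscale W c (ac x n)"
    and ac_add_right: "\<And>a b x n n'. x \<in> grade L a \<Longrightarrow> n \<in> grade W b \<Longrightarrow> n' \<in> grade W b \<Longrightarrow>
      ac x (n + n') = ac x n + ac x n'"
    and ac_scale_right: "\<And>a b c x n. x \<in> grade L a \<Longrightarrow> n \<in> grade W b \<Longrightarrow>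
      ac x (vscale W c n) = vscale W c (ac x n)"
begin

lemmas eps_simps = commutation_factorD(2,3)[OF eps] commutation_factor_zero[OF eps]

text \<open>The three shapes in which a pair of mutually inverse factors appears after products have
  been normalised.\<close>

lemma eps_inv: "\<epsilon> a b * \<epsilon> b a = 1" "\<epsilon> a b * (\<epsilon> b a * c) = c" "\<epsilon> a b * (c * \<epsilon> b a) = c"
  using commutation_factorD(1)[OF eps, of a b] by (simp_all add: mult.assoc[symmetric])

text \<open>Skewness carries additivity over from the left argument.\<close>

lemma br_add_right:
  assumes "x \<in> grade L a" "y \<in> grade L b" "y' \<in> grade L b"
  shows "br x (y + y') = br x y + br x y'"
  using br_skew[OF assms(1), of "y + y'" b] br_skew[OF assms(1,2)] br_skew[OF assms(1,3)] assms
  by (simp add: br_add L.subspace_add L.subspace_grade L.scale_right_distrib del: L.scale_minus_left)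

lemma br_scale_right:
  assumes "x \<in> grade L a" "y \<in> grade L b"
  shows "br x (vscale L c y) = vscale L c (br x y)"
  using br_skew[OF assms(1), of "vscale L c y" b] br_skew[OF assms] assms
  by (simp add: br_scale L.subspace_scale L.subspace_grade mult.commute del: L.scale_minus_left)

text \<open>In closed form, the sum over \<open>j\<close> of \<open>\<epsilon>(a, c + \<alpha>\<^sub>1 + \<dots> + \<alpha>\<^sub>j\<^sub>-\<^sub>1) R(\<dots>, [y, x\<^sub>j], \<dots>)\<close>.\<close>

primrec bracket_sum :: "('s \<times> 'g) list \<Rightarrow> 's \<Rightarrow> 'g \<Rightarrow> 'g \<Rightarrow> (('s \<times> 'g) list \<Rightarrow> 'w) \<Rightarrow> 'w" where
  "bracket_sum [] y a c R = 0"
| "bracket_sum (w # ws) y a c R = vscale W (\<epsilon> a c) (R ((br y (fst w), a + snd w) # ws))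
     + bracket_sum ws y a (c + snd w) (\<lambda>vs. R (w # vs))"

text \<open>Recursion by Cartan's formula: \<open>\<iota>\<^sub>x (df) = \<epsilon>(\<beta>,\<alpha>) \<theta>\<^sub>x f - d (\<iota>\<^sub>x f)\<close> for \<open>\<theta>\<^sub>x\<close> the Lie
  derivative and \<open>\<iota>\<^sub>x\<close> the insertion of \<open>x\<close> as first argument.\<close>

primrec ce_diff :: "('s \<times> 'g) list \<Rightarrow> 'g \<Rightarrow> (('s \<times> 'g) list \<Rightarrow> 'w) \<Rightarrow> 'w" where
  "ce_diff [] \<beta> R = 0"
| "ce_diff (w # ws) \<beta> R = vscale W (\<epsilon> \<beta> (snd w)) (ac (fst w) (R ws)) - bracket_sum ws (fst w) (snd w) 0 R
     - ce_diff ws (\<beta> + snd w) (\<lambda>vs. R (w # vs))"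

lemma bracket_sum_cong:
  assumes "\<And>vs. homog_word L vs \<Longrightarrow> length vs = length ws \<Longrightarrow> R vs = R' vs"
    and "homog_word L ws" "y \<in> grade L a"
  shows "bracket_sum ws y a c R = bracket_sum ws y a c R'"
  using assms
proof (induction ws arbitrary: c R R')
  case (Cons w ws)
  obtain x b where w: "w = (x, b)" by fastforce
  have "bracket_sum ws y a (c + b) (\<lambda>vs. R (w # vs)) = bracket_sum ws y a (c + b) (\<lambda>vs. R' (w # vs))"
    using Cons.prems by (intro Cons.IH) (auto simp: w)
  moreover have "R ((br y x, a + b) # ws) = R' ((br y x, a + b) # ws)"
    using Cons.prems by (intro Cons.prems(1)) (auto simp: w br_grade)
  ultimately show ?case
    by (simp add: w)
qed simp

lemma bracket_sum_plus:
  "bracket_sum ws y a c (\<lambda>vs. R vs + R' vs) = bracket_sum ws y a c R + bracket_sum ws y a c R'"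
  by (induction ws arbitrary: c R R') (simp_all add: W.scale_right_distrib)

lemma bracket_sum_vscale:
  "bracket_sum ws y a c (\<lambda>vs. vscale W k (R vs)) = vscale W k (bracket_sum ws y a c R)"
  by (induction ws arbitrary: c R) (simp_all add: W.scale_right_distrib mult.commute)

text \<open>Each summand has a coefficient that is multiplicative in the second entry of
  \<open>\<epsilon>\<close>, so a common part of the offset factors out. The coboundary meets such
  an offset when the sum starts behind a letter already passed.\<close>

lemma bracket_sum_shift:
  "bracket_sum ws y a (b + c) R = vscale W (\<epsilon> a b) (bracket_sum ws y a c R)"
  by (induction ws arbitrary: c R) (simp_all add: W.scale_right_distrib eps_simps add.assoc)

lemma bracket_sum_add:
  assumes "alternating (length ws) \<beta> R" "homog_word L ws" "y \<in> grade L a" "y' \<in> grade L a"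
  shows "bracket_sum ws (y + y') a c R = bracket_sum ws y a c R + bracket_sum ws y' a c R"
  using assms
proof (induction ws arbitrary: c \<beta> R)
  case (Cons w ws)
  obtain x b where w: "w = (x, b)" by fastforce
  have x: "x \<in> grade L b" "homog_word L ws" and alt: "alternating (Suc (length ws)) \<beta> R"
    using Cons.prems w by auto
  have "bracket_sum ws (y + y') a (c + b) (\<lambda>vs. R (w # vs)) =
      bracket_sum ws y a (c + b) (\<lambda>vs. R (w # vs)) + bracket_sum ws y' a (c + b) (\<lambda>vs. R (w # vs))"
    unfolding w by (rule Cons.IH[OF alternating_Cons[OF alt x(1)] x(2) Cons.prems(3,4)])
  moreover have "R ((br (y + y') x, a + b) # ws) = R ((br y x, a + b) # ws) + R ((br y' x, a + b) # ws)"
    using Cons.prems(3,4) x by (simp add: br_add alternating_add[OF alt] br_grade)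
  ultimately show ?case
    by (simp add: w W.scale_right_distrib)
qed simp

lemma bracket_sum_scale:
  assumes "alternating (length ws) \<beta> R" "homog_word L ws" "y \<in> grade L a"
  shows "bracket_sum ws (vscale L k y) a c R = vscale W k (bracket_sum ws y a c R)"
  using assms
proof (induction ws arbitrary: c \<beta> R)
  case (Cons w ws)
  obtain x b where w: "w = (x, b)" by fastforce
  have x: "x \<in> grade L b" "homog_word L ws" and alt: "alternating (Suc (length ws)) \<beta> R"
    using Cons.prems w by auto
  have "bracket_sum ws (vscale L k y) a (c + b) (\<lambda>vs. R (w # vs)) =
      vscale W k (bracket_sum ws y a (c + b) (\<lambda>vs. R (w # vs)))"
    unfolding w by (rule Cons.IH[OF alternating_Cons[OF alt x(1)] x(2) Cons.prems(3)])
  moreover have "R ((br (vscale L k y) x, a + b) # ws) = vscale W k (R ((br y x, a + b) # ws))"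
    using Cons.prems(3) x by (simp add: br_scale alternating_scale[OF alt] br_grade)
  ultimately show ?case
    by (simp add: w W.scale_right_distrib mult.commute)
qed simp

lemma alternating_bracket_sum:
  assumes "alternating n \<beta> R" "y \<in> grade L d"
  shows "alternating n (\<beta> + d) (\<lambda>ws. bracket_sum ws y d c R)"
  using assms(1)
proof (induction n arbitrary: \<beta> R c)
  case 0
  then show ?case by (simp add: W.subspace_0 W.subspace_grade)
next
  case (Suc n)
  note alt = Suc.prems and y = assms(2)
  show ?case
  proof (rule alternating_SucI)
    fix a x assume x: "x \<in> grade L a"
    have "alternating n (\<beta> + (d + a)) (\<lambda>ws. vscale W (\<epsilon> d c) (R ((br y x, d + a) # ws)))"
      by (intro alternating_vscale alternating_Cons[OF alt] br_grade y x)
    moreover have "alternating n (\<beta> + a + d) (\<lambda>ws. bracket_sum ws y d (c + a) (\<lambda>vs. R ((x, a) # vs)))"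
      by (rule Suc.IH[OF alternating_Cons[OF alt x]])
    ultimately show "alternating n (\<beta> + d + a) (\<lambda>ws. bracket_sum ((x, a) # ws) y d c R)"
      by (simp add: alternating_plus ac_simps)
  next
    fix a x x' ws assume *: "x \<in> grade L a" "x' \<in> grade L a" "homog_word L ws" "length ws = n"
    have "bracket_sum ws y d (c + a) (\<lambda>vs. R ((x + x', a) # vs)) =
        bracket_sum ws y d (c + a) (\<lambda>vs. R ((x, a) # vs) + R ((x', a) # vs))"
      by (rule bracket_sum_cong[OF _ *(3) y]) (simp add: alternating_add[OF alt *(1,2)] *(4))
    with * y show "bracket_sum ((x + x', a) # ws) y d c R = bracket_sum ((x, a) # ws) y d c R + bracket_sum ((x', a) # ws) y d c R"
      by (simp add: br_add_right alternating_add[OF alt] br_grade bracket_sum_plus W.scale_right_distrib)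
  next
    fix k a x ws assume *: "x \<in> grade L a" "homog_word L ws" "length ws = n"
    have "bracket_sum ws y d (c + a) (\<lambda>vs. R ((vscale L k x, a) # vs)) =
        bracket_sum ws y d (c + a) (\<lambda>vs. vscale W k (R ((x, a) # vs)))"
      by (rule bracket_sum_cong[OF _ *(2) y]) (simp add: alternating_scale[OF alt *(1)] *(3))
    with * y show "bracket_sum ((vscale L k x, a) # ws) y d c R = vscale W k (bracket_sum ((x, a) # ws) y d c R)"
      by (simp add: br_scale_right alternating_scale[OF alt] br_grade bracket_sum_vscale W.scale_right_distrib mult.commute)
  next
    fix a b x z ws assume *: "x \<in> grade L a" "z \<in> grade L b" "homog_word L ws" "Suc (length ws) = n"
    \<comment> \<open>Under the swap the term with [y, x] in the leading place meets the one with
      [y, x] in the next place. The factor \<open>\<epsilon> d b\<close> contained in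
      \<open>\<epsilon> (d + a) b\<close> is the change of offset from c to c + b.\<close>
    have 1: "R ((br y x, d + a) # (z, b) # ws) = vscale W (- \<epsilon> (d + a) b) (R ((z, b) # (br y x, d + a) # ws))"
      by (rule alternating_swap[OF alt br_grade[OF y *(1)] *(2-4)])
    \<comment> \<open>Here the product of \<open>\<epsilon> d (c + a)\<close> and
      \<open>\<epsilon> a (d + b)\<close> leaves \<open>\<epsilon> d c * \<epsilon> a b\<close>,
      because \<open>\<epsilon> d a * \<epsilon> a d = 1\<close>.\<close>
    have 2: "R ((x, a) # (br y z, d + b) # ws) = vscale W (- \<epsilon> a (d + b)) (R ((br y z, d + b) # (x, a) # ws))"
      by (rule alternating_swap[OF alt *(1) br_grade[OF y *(2)] *(3,4)])
    have "bracket_sum ws y d (c + a + b) (\<lambda>vs. R ((x, a) # (z, b) # vs)) =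
        bracket_sum ws y d (c + a + b) (\<lambda>vs. vscale W (- \<epsilon> a b) (R ((z, b) # (x, a) # vs)))"
      by (rule bracket_sum_cong[OF _ *(3) y]) (rule alternating_swap[OF alt *(1,2)], simp_all add: *(4))
    then have 3: "bracket_sum ws y d (c + a + b) (\<lambda>vs. R ((x, a) # (z, b) # vs)) =
        vscale W (- \<epsilon> a b) (bracket_sum ws y d (c + b + a) (\<lambda>vs. R ((z, b) # (x, a) # vs)))"
      by (simp only: bracket_sum_vscale ac_simps)
    show "bracket_sum ((x, a) # (z, b) # ws) y d c R = vscale W (- \<epsilon> a b) (bracket_sum ((z, b) # (x, a) # ws) y d c R)"
      unfolding bracket_sum.simps fst_conv snd_conv 1 2 3
      by (simp add: W.scale_right_distrib eps_simps eps_inv mult.assoc ac_simps)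
  qed
qed

section \<open>Multilinearity and alternation of the coboundary on words\<close>

lemma ce_diff_cong:
  assumes "\<And>vs. homog_word L vs \<Longrightarrow> Suc (length vs) = length ws \<Longrightarrow> R vs = R' vs" "homog_word L ws"
  shows "ce_diff ws \<beta> R = ce_diff ws \<beta> R'"
  using assms
proof (induction ws arbitrary: \<beta> R R')
  case (Cons w ws)
  obtain x b where w: "w = (x, b)" by fastforce
  have "bracket_sum ws x b 0 R = bracket_sum ws x b 0 R'"
    using Cons.prems w by (intro bracket_sum_cong) auto
  moreover have "ce_diff ws (\<beta> + b) (\<lambda>vs. R (w # vs)) = ce_diff ws (\<beta> + b) (\<lambda>vs. R' (w # vs))"
    using Cons.prems by (intro Cons.IH) (auto simp: w)
  moreover have "R ws = R' ws"
    using Cons.prems by (auto simp: w)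
  ultimately show ?case
    by (simp add: w)
qed simp

lemma ce_diff_plus:
  assumes "length ws = Suc n \<longrightarrow> alternating n \<beta>' R \<and> alternating n \<beta>' R'" "homog_word L ws" "length ws \<in> {0, Suc n}"
  shows "ce_diff ws \<beta> (\<lambda>vs. R vs + R' vs) = ce_diff ws \<beta> R + ce_diff ws \<beta> R'"
  using assms
proof (induction ws arbitrary: n \<beta> \<beta>' R R')
  case (Cons w ws)
  obtain x b where w: "w = (x, b)" by fastforce
  have x: "x \<in> grade L b" "homog_word L ws" and n: "length ws = n"
    and alt: "alternating n \<beta>' R" "alternating n \<beta>' R'"
    using Cons.prems w by auto
  have "ce_diff ws (\<beta> + b) (\<lambda>vs. R (w # vs) + R' (w # vs)) =
      ce_diff ws (\<beta> + b) (\<lambda>vs. R (w # vs)) + ce_diff ws (\<beta> + b) (\<lambda>vs. R' (w # vs))"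
    using alt x n
    by (intro Cons.IH[of "n - 1" "\<beta>' + b"]) (cases n; auto simp: w intro: alternating_Cons)+
  then show ?case
    using ac_add_right[OF x(1) alternating_grade[OF alt(1) x(2) n] alternating_grade[OF alt(2) x(2) n]]
    by (simp add: w bracket_sum_plus W.scale_right_distrib)
qed simp

lemma ce_diff_vscale:
  assumes "length ws = Suc n \<longrightarrow> alternating n \<beta>' R" "homog_word L ws" "length ws \<in> {0, Suc n}"
  shows "ce_diff ws \<beta> (\<lambda>vs. vscale W k (R vs)) = vscale W k (ce_diff ws \<beta> R)"
  using assms
proof (induction ws arbitrary: n \<beta> \<beta>' R)
  case (Cons w ws)
  obtain x b where w: "w = (x, b)" by fastforce
  have x: "x \<in> grade L b" "homog_word L ws" and n: "length ws = n"
    and alt: "alternating n \<beta>' R"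
    using Cons.prems w by auto
  have "ce_diff ws (\<beta> + b) (\<lambda>vs. vscale W k (R (w # vs))) = vscale W k (ce_diff ws (\<beta> + b) (\<lambda>vs. R (w # vs)))"
    using alt x n
    by (intro Cons.IH[of "n - 1" "\<beta>' + b"]) (cases n; auto simp: w intro: alternating_Cons)+
  then show ?case
    using ac_scale_right[OF x(1) alternating_grade[OF alt x(2) n]]
    by (simp add: w bracket_sum_vscale W.scale_right_diff_distrib mult.commute)
qed simp

text \<open>The action is linear on elements of one degree, so the values of R are placed in a grade
  before it is moved past sums and multiples.\<close>

lemma alternating_ac:
  assumes "alternating n \<beta> R" "y \<in> grade L d"
  shows "alternating n (\<beta> + d) (\<lambda>ws. ac y (R ws))"
  using assms(1)
proof (induction n arbitrary: \<beta> R)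
  case 0
  with assms(2) show ?case by (simp add: ac_grade)
next
  case (Suc n)
  note alt = Suc.prems and y = assms(2)
  have deg: "R ((x, a) # ws) \<in> grade W (\<beta> + sum_list (map snd ((x, a) # ws)))"
    if "x \<in> grade L a" "homog_word L ws" "length ws = n" for x a ws
    using that by (intro alternating_grade[OF alt]) auto
  show ?case
  proof (rule alternating_SucI)
    fix a x assume x: "x \<in> grade L a"
    show "alternating n (\<beta> + d + a) (\<lambda>ws. ac y (R ((x, a) # ws)))"
      using Suc.IH[OF alternating_Cons[OF alt x]] by (simp add: ac_simps)
  next
    fix a x x' ws assume *: "x \<in> grade L a" "x' \<in> grade L a" "homog_word L ws" "length ws = n"
    show "ac y (R ((x + x', a) # ws)) = ac y (R ((x, a) # ws)) + ac y (R ((x', a) # ws))"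
      unfolding alternating_add[OF alt *]
      using ac_add_right[OF y deg[OF *(1,3,4)], of "R ((x', a) # ws)"] deg[OF *(2,3,4)] by simp
  next
    fix c a x ws assume *: "x \<in> grade L a" "homog_word L ws" "length ws = n"
    show "ac y (R ((vscale L c x, a) # ws)) = vscale W c (ac y (R ((x, a) # ws)))"
      unfolding alternating_scale[OF alt *] by (rule ac_scale_right[OF y deg[OF *]])
  next
    fix a b x z ws assume *: "x \<in> grade L a" "z \<in> grade L b" "homog_word L ws" "Suc (length ws) = n"
    show "ac y (R ((x, a) # (z, b) # ws)) = vscale W (- \<epsilon> a b) (ac y (R ((z, b) # (x, a) # ws)))"
      unfolding alternating_swap[OF alt *] using * by (intro ac_scale_right[OF y deg]) auto
  qed
qed

lemma alternating_ce_diff: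
  assumes "alternating n \<beta> R"
  shows "alternating (Suc n) \<beta> (\<lambda>ws. ce_diff ws \<beta> R)"
  using assms
proof (induction n arbitrary: \<beta> R)
  case 0
  then have R: "R [] \<in> grade W \<beta>" by simp
  show ?case
    by (rule alternating_SucI)
      (use R in \<open>auto simp: ac_grade W.subspace_scale[OF W.subspace_grade] ac_add_left[OF _ _ R]
        ac_scale_left[OF _ R] W.scale_right_distrib mult.commute\<close>)
next
  case (Suc n)
  note alt = Suc.prems
  show ?case
  proof (rule alternating_SucI)
    fix a x assume x: "x \<in> grade L a"
    show "alternating (Suc n) (\<beta> + a) (\<lambda>ws. ce_diff ((x, a) # ws) \<beta> R)"
      unfolding ce_diff.simps fst_conv snd_conv
      by (intro alternating_diff alternating_vscale alternating_ac[OF alt x]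
          alternating_bracket_sum[OF alt x] Suc.IH alternating_Cons[OF alt x])
  next
    fix a x x' ws assume *: "x \<in> grade L a" "x' \<in> grade L a" "homog_word L ws" "length ws = Suc n"
    have "ce_diff ws (\<beta> + a) (\<lambda>vs. R ((x + x', a) # vs)) =
        ce_diff ws (\<beta> + a) (\<lambda>vs. R ((x, a) # vs) + R ((x', a) # vs))"
      by (rule ce_diff_cong[OF _ *(3)]) (simp add: alternating_add[OF alt *(1,2)] *(4))
    also have "\<dots> = ce_diff ws (\<beta> + a) (\<lambda>vs. R ((x, a) # vs)) + ce_diff ws (\<beta> + a) (\<lambda>vs. R ((x', a) # vs))"
      using alternating_Cons[OF alt *(1)] alternating_Cons[OF alt *(2)] *
      by (intro ce_diff_plus[of _ n "\<beta> + a"]) auto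
    finally show "ce_diff ((x + x', a) # ws) \<beta> R = ce_diff ((x, a) # ws) \<beta> R + ce_diff ((x', a) # ws) \<beta> R"
      using ac_add_left[OF *(1,2) alternating_grade[OF alt *(3,4)]]
        bracket_sum_add[of ws \<beta> R x a x' 0] alt *
      by (simp add: W.scale_right_distrib)
  next
    fix k a x ws assume *: "x \<in> grade L a" "homog_word L ws" "length ws = Suc n"
    have "ce_diff ws (\<beta> + a) (\<lambda>vs. R ((vscale L k x, a) # vs)) =
        ce_diff ws (\<beta> + a) (\<lambda>vs. vscale W k (R ((x, a) # vs)))"
      by (rule ce_diff_cong[OF _ *(2)]) (simp add: alternating_scale[OF alt *(1)] *(3))
    also have "\<dots> = vscale W k (ce_diff ws (\<beta> + a) (\<lambda>vs. R ((x, a) # vs)))"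
      using alternating_Cons[OF alt *(1)] * by (intro ce_diff_vscale[of _ n "\<beta> + a"]) auto
    finally show "ce_diff ((vscale L k x, a) # ws) \<beta> R = vscale W k (ce_diff ((x, a) # ws) \<beta> R)"
      using ac_scale_left[OF *(1) alternating_grade[OF alt *(2,3)]]
        bracket_sum_scale[of ws \<beta> R x a k 0] alt *
      by (simp add: W.scale_right_diff_distrib mult.commute)
  next
    fix a b x y ws assume *: "x \<in> grade L a" "y \<in> grade L b" "homog_word L ws" "Suc (length ws) = Suc n"
    have len: "length ws = n" using *(4) by simp
    \<comment> \<open>Skewness settles the term in which the two leading letters are bracketed with
      each other.\<close>
    have 1: "R ((br x y, a + b) # ws) = vscale W (- \<epsilon> a b) (R ((br y x, b + a) # ws))"
      unfolding br_skew[OF *(1,2)] add.commute[of a b]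
      by (rule alternating_scale[OF alt br_grade[OF *(2,1)] *(3) len])
    have "ce_diff ws (\<beta> + a + b) (\<lambda>vs. R ((x, a) # (y, b) # vs)) =
        ce_diff ws (\<beta> + a + b) (\<lambda>vs. vscale W (- \<epsilon> a b) (R ((y, b) # (x, a) # vs)))"
      by (rule ce_diff_cong[OF _ *(3)]) (rule alternating_swap[OF alt *(1,2)], simp_all add: len)
    also have "\<dots> = vscale W (- \<epsilon> a b) (ce_diff ws (\<beta> + a + b) (\<lambda>vs. R ((y, b) # (x, a) # vs)))"
    \<comment> \<open>For n = 0 the rest of the word is empty and both sides are 0. Otherwise R with
      two frozen letters is alternating in the remaining n - 1 arguments.\<close>
    proof (cases n)
      case 0
      then show ?thesis using len by simp
    next
      case (Suc m)
      have "alternating m (\<beta> + b + a) (\<lambda>vs. R ((y, b) # (x, a) # vs))"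
        using alt * unfolding Suc by (intro alternating_Cons)
      then show ?thesis
        using * Suc by (intro ce_diff_vscale[of _ m "\<beta> + b + a"]) auto
    qed
    finally have 2: "ce_diff ws (\<beta> + a + b) (\<lambda>vs. R ((x, a) # (y, b) # vs)) =
        vscale W (- \<epsilon> a b) (ce_diff ws (\<beta> + b + a) (\<lambda>vs. R ((y, b) # (x, a) # vs)))"
      by (simp only: ac_simps)
    \<comment> \<open>The sum for the leading letter continues behind the next one, hence with
      offset b; the shift isolates the factor \<open>\<epsilon> a b\<close>.\<close>
    have 3: "bracket_sum ws x a b R' = vscale W (\<epsilon> a b) (bracket_sum ws x a 0 R')" for x a b R'
      using bracket_sum_shift[of ws x a b 0 R'] by simp
    \<comment> \<open>The action and bracket terms of x come from the outer contraction on the left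
      and from the inner one on the right, with opposite signs, which the factor
      \<open>- \<epsilon> a b\<close> reconciles. The same holds for y with the roles exchanged, and
      the term with both letters frozen obeys the swap rule of R.\<close>
    show "ce_diff ((x, a) # (y, b) # ws) \<beta> R = vscale W (- \<epsilon> a b) (ce_diff ((y, b) # (x, a) # ws) \<beta> R)"
      unfolding ce_diff.simps bracket_sum.simps fst_conv snd_conv 1 2 add_0 3[of x a b] 3[of y b a]
      by (simp add: W.scale_right_distrib W.scale_right_diff_distrib eps_simps eps_inv mult.assoc ac_simps)
  qed
qed

end


section \<open>Comparison with the index formulas\<close>

lemma sum_atLeast1_head: "(\<Sum>j\<in>{1..Suc n}. f j) = f 1 + (\<Sum>j\<in>{1..n}. f (Suc j))"
  for f :: "nat \<Rightarrow> 'a::comm_monoid_add"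
  unfolding One_nat_def sum.shift_bounds_cl_Suc_ivl[symmetric] by (rule sum.atLeast_Suc_atMost) simp

lemma sum_lessThan1_head: "1 \<le> j \<Longrightarrow> (\<Sum>s\<in>{1..<Suc j}. f s) = f 1 + (\<Sum>s\<in>{1..<j}. f (Suc s))"
  for f :: "nat \<Rightarrow> 'a::comm_monoid_add"
  unfolding One_nat_def sum.shift_bounds_Suc_ivl[symmetric] by (rule sum.atLeast_Suc_lessThan) simp

lemma map_upt_Suc: "map w [Suc a..<Suc b] = map (\<lambda>s. w (Suc s)) [a..<b]"
  unfolding map_Suc_upt[symmetric] map_map comp_def ..

lemma map_upt1_head: "1 \<le> j \<Longrightarrow> map w [1..<Suc j] = w 1 # map (\<lambda>s. w (Suc s)) [1..<j]"
  by (simp add: upt_conv_Cons map_upt_Suc del: upt_Suc)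

text \<open>The recursion peels off the leading letter, so the induction replaces w by its shift and
  moves the degree of that letter into the offset c.\<close>

lemma (in lie_action) bracket_sum_index:
  "bracket_sum (map w [1..<Suc n]) y a c R =
    (\<Sum>j\<in>{1..n}. vscale W (\<epsilon> a (c + (\<Sum>s\<in>{1..<j}. snd (w s))))
      (R (map w [1..<j] @ [(br y (fst (w j)), a + snd (w j))] @ map w [Suc j..<Suc n])))"
proof (induction n arbitrary: w c R)
  case (Suc n)
  let ?w = "\<lambda>s. w (Suc s)"
  have "vscale W (\<epsilon> a (c + snd (w 1) + (\<Sum>s\<in>{1..<j}. snd (?w s))))
      (R (w 1 # map ?w [1..<j] @ [(br y (fst (?w j)), a + snd (?w j))] @ map ?w [Suc j..<Suc n])) =
      vscale W (\<epsilon> a (c + (\<Sum>s\<in>{1..<Suc j}. snd (w s))))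
      (R (map w [1..<Suc j] @ [(br y (fst (w (Suc j))), a + snd (w (Suc j)))] @ map w [Suc (Suc j)..<Suc (Suc n)]))"
    if "j \<in> {1..n}" for j
    using that sum_lessThan1_head[of j "\<lambda>s. snd (w s)"] map_upt1_head[of j w] map_upt_Suc[of w "Suc j" "Suc n"]
    by (simp add: add.assoc)
  then have "bracket_sum (map ?w [1..<Suc n]) y a (c + snd (w 1)) (\<lambda>vs. R (w 1 # vs)) =
      (\<Sum>j\<in>{1..n}. vscale W (\<epsilon> a (c + (\<Sum>s\<in>{1..<Suc j}. snd (w s))))
        (R (map w [1..<Suc j] @ [(br y (fst (w (Suc j))), a + snd (w (Suc j)))] @ map w [Suc (Suc j)..<Suc (Suc n)])))"
    unfolding Suc.IH by (intro sum.cong refl) blast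
  moreover have "map w [1..<Suc (Suc n)] = w 1 # map ?w [1..<Suc n]"
    by (rule map_upt1_head) simp
  moreover have "map w [Suc 1..<Suc (Suc n)] = map ?w [1..<Suc n]"
    by (rule map_upt_Suc)
  ultimately show ?case
    unfolding sum_atLeast1_head[of _ n] by simp
qed simp

lemma (in lie_action) ce_diff_index:
  "ce_diff (map w [1..<Suc n]) \<beta> R =
    - (\<Sum>t\<in>{1..n}. vscale W ((-1) ^ t * \<epsilon> (\<beta> + (\<Sum>s\<in>{1..<t}. snd (w s))) (snd (w t)))
        (ac (fst (w t)) (R (map w ([1..<t] @ [Suc t..<Suc n])))))
    + (\<Sum>j\<in>{1..n}. \<Sum>t\<in>{1..<j}. vscale W ((-1) ^ t * \<epsilon> (snd (w t)) (\<Sum>s\<in>{Suc t..<j}. snd (w s)))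
        (R (map w ([1..<t] @ [Suc t..<j]) @ [(br (fst (w t)) (fst (w j)), snd (w t) + snd (w j))]
          @ map w [Suc j..<Suc n])))"
proof (induction n arbitrary: w \<beta> R)
  case (Suc n)
  let ?w = "\<lambda>s. w (Suc s)" and ?R = "\<lambda>vs. R (w 1 # vs)"
  define f where "f t = vscale W ((-1) ^ t * \<epsilon> (\<beta> + (\<Sum>s\<in>{1..<t}. snd (w s))) (snd (w t)))
      (ac (fst (w t)) (R (map w ([1..<t] @ [Suc t..<Suc (Suc n)]))))" for t
  define g where "g j t = vscale W ((-1) ^ t * \<epsilon> (snd (w t)) (\<Sum>s\<in>{Suc t..<j}. snd (w s)))
      (R (map w ([1..<t] @ [Suc t..<j]) @ [(br (fst (w t)) (fst (w j)), snd (w t) + snd (w j))]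
        @ map w [Suc j..<Suc (Suc n)]))" for j t
  have w_head: "map w [1..<Suc (Suc n)] = w 1 # map ?w [1..<Suc n]"
    by (rule map_upt1_head) simp
  \<comment> \<open>Index t = 1 gives the leading action term. For t + 1 the sign flips and the
    degree of the leading letter joins \<beta>, as in the tail of the recursion.\<close>
  have f1: "f 1 = - vscale W (\<epsilon> \<beta> (snd (w 1))) (ac (fst (w 1)) (R (map ?w [1..<Suc n])))"
    using map_upt_Suc[of w 1 "Suc n"] by (simp add: f_def del: upt_Suc sum.op_ivl_Suc)
  have f2: "f (Suc t) = - vscale W ((-1) ^ t * \<epsilon> (\<beta> + snd (w 1) + (\<Sum>s\<in>{1..<t}. snd (?w s))) (snd (?w t)))
      (ac (fst (?w t)) (?R (map ?w ([1..<t] @ [Suc t..<Suc n]))))" if "t \<in> {1..n}" for t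
    using that sum_lessThan1_head[of t "\<lambda>s. snd (w s)"] map_upt1_head[of t w] map_upt_Suc[of w "Suc t" "Suc n"]
    by (simp add: f_def add.assoc del: upt_Suc sum.op_ivl_Suc)
  have g1: "g (Suc j) 1 = - vscale W (\<epsilon> (snd (w 1)) (0 + (\<Sum>s\<in>{1..<j}. snd (?w s))))
      (R (map ?w [1..<j] @ [(br (fst (w 1)) (fst (?w j)), snd (w 1) + snd (?w j))] @ map ?w [Suc j..<Suc n]))"
    for j
    using map_upt_Suc[of w 1 j] map_upt_Suc[of w "Suc j" "Suc n"]
      sum.shift_bounds_Suc_ivl[of "\<lambda>s. snd (w s)" 1 j] by (simp add: g_def del: upt_Suc sum.op_ivl_Suc)
  have g2: "g (Suc j) (Suc t) = - vscale W ((-1) ^ t * \<epsilon> (snd (?w t)) (\<Sum>s\<in>{Suc t..<j}. snd (?w s)))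
      (?R (map ?w ([1..<t] @ [Suc t..<j]) @ [(br (fst (?w t)) (fst (?w j)), snd (?w t) + snd (?w j))]
        @ map ?w [Suc j..<Suc n]))" if "t \<in> {1..<j}" for j t
    using that map_upt1_head[of t w] map_upt_Suc[of w "Suc t" j] map_upt_Suc[of w "Suc j" "Suc n"]
      sum.shift_bounds_Suc_ivl[of "\<lambda>s. snd (w s)" "Suc t" j] by (simp add: g_def del: upt_Suc sum.op_ivl_Suc)
  have "(\<Sum>t\<in>{1..Suc n}. f t) = f 1 + (\<Sum>t\<in>{1..n}. f (Suc t))"
    by (rule sum_atLeast1_head)
  moreover have "(\<Sum>j\<in>{1..Suc n}. \<Sum>t\<in>{1..<j}. g j t) =
      (\<Sum>j\<in>{1..n}. g (Suc j) 1) + (\<Sum>j\<in>{1..n}. \<Sum>t\<in>{1..<j}. g (Suc j) (Suc t))"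
    unfolding sum_atLeast1_head[of _ n] sum.distrib[symmetric]
    by (simp add: sum_lessThan1_head del: One_nat_def sum.op_ivl_Suc)
  moreover have "(\<Sum>t\<in>{1..n}. f (Suc t)) = - (\<Sum>t\<in>{1..n}. vscale W ((-1) ^ t *
      \<epsilon> (\<beta> + snd (w 1) + (\<Sum>s\<in>{1..<t}. snd (?w s))) (snd (?w t)))
      (ac (fst (?w t)) (?R (map ?w ([1..<t] @ [Suc t..<Suc n])))))"
    unfolding sum_negf[symmetric] by (rule sum.cong[OF refl f2])
  moreover have "(\<Sum>j\<in>{1..n}. \<Sum>t\<in>{1..<j}. g (Suc j) (Suc t)) = - (\<Sum>j\<in>{1..n}. \<Sum>t\<in>{1..<j}.
      vscale W ((-1) ^ t * \<epsilon> (snd (?w t)) (\<Sum>s\<in>{Suc t..<j}. snd (?w s)))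
      (?R (map ?w ([1..<t] @ [Suc t..<j]) @ [(br (fst (?w t)) (fst (?w j)), snd (?w t) + snd (?w j))]
        @ map ?w [Suc j..<Suc n])))"
    unfolding sum_negf[symmetric] by (intro sum.cong[OF refl] g2)
  \<comment> \<open>The pairs with t = 1 form the bracket part of the Lie derivative along the
    leading letter. Its offset is 0 because their exponents count only the degrees strictly between
    that letter and slot j.\<close>
  moreover have "(\<Sum>j\<in>{1..n}. g (Suc j) 1) = - bracket_sum (map ?w [1..<Suc n]) (fst (w 1)) (snd (w 1)) 0 R"
    unfolding bracket_sum_index sum_negf[symmetric] by (rule sum.cong[OF refl g1])
  ultimately have "- (\<Sum>t\<in>{1..Suc n}. f t) + (\<Sum>j\<in>{1..Suc n}. \<Sum>t\<in>{1..<j}. g j t) =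
      ce_diff (w 1 # map ?w [1..<Suc n]) \<beta> R"
    unfolding ce_diff.simps Suc.IH f1 by simp
  then show ?case
    unfolding w_head f_def g_def by simp
qed simp

text \<open>The operators are specified through index functions, whose values outside 1..n are
  arbitrary; only the restriction, a word, enters P.\<close>

lemma all_words_iff:
  "(\<forall>ws. homog_word L ws \<longrightarrow> length ws = n \<longrightarrow> P ws) \<longleftrightarrow>
   (\<forall>x \<alpha>. (\<forall>s\<in>{1..n}. x s \<in> grade L (\<alpha> s)) \<longrightarrow> P (map (\<lambda>s. (x s, \<alpha> s)) [1..<Suc n]))"
proof (intro iffI allI impI)
  fix x \<alpha> assume "\<forall>ws. homog_word L ws \<longrightarrow> length ws = n \<longrightarrow> P ws" "\<forall>s\<in>{1..n}. x s \<in> grade L (\<alpha> s)"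
  then show "P (map (\<lambda>s. (x s, \<alpha> s)) [1..<Suc n])"
    by (auto simp: homog_word_def list_all_iff)
next
  fix ws assume *: "\<forall>x \<alpha>. (\<forall>s\<in>{1..n}. x s \<in> grade L (\<alpha> s)) \<longrightarrow> P (map (\<lambda>s. (x s, \<alpha> s)) [1..<Suc n])"
    "homog_word L ws" "length ws = n"
  \<comment> \<open>Arguments are numbered from 1, list positions from 0.\<close>
  have "ws = map (\<lambda>s. (fst (ws ! (s - 1)), snd (ws ! (s - 1)))) [1..<Suc n]"
    by (rule nth_equalityI) (use *(3) in \<open>auto simp del: upt_Suc\<close>)
  moreover have "fst (ws ! (s - 1)) \<in> grade L (snd (ws ! (s - 1)))" if "s \<in> {1..n}" for s
  proof -
    have "ws ! (s - 1) \<in> set ws"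
      using that *(3) by (intro nth_mem) auto
    then show ?thesis
      using *(2) by (auto simp: homog_word_def list_all_iff)
  qed
  ultimately show "P ws"
    using *(1)[rule_format, of "\<lambda>s. fst (ws ! (s - 1))" "\<lambda>s. snd (ws ! (s - 1))"] by simp
qed

locale lie_module = lie_action L \<epsilon> N "mult L" "act N"
  for L :: "('k::field, 'g::ab_group_add, 's::ab_group_add) galgebra"
    and \<epsilon> :: "'g \<Rightarrow> 'g \<Rightarrow> 'k"
    and N :: "('k, 'g, 'w::ab_group_add, 's) gmodule"
begin

abbreviation word_value :: "(('s list \<Rightarrow>\<^sub>0 'k) set \<Rightarrow> 'w) \<Rightarrow> ('s \<times> 'g) list \<Rightarrow> 'w" where
  "word_value f ws \<equiv> f (wedge \<epsilon> L (map fst ws))"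

lemma hom_deg_cochain: "f \<in> hom_deg (ext_power \<epsilon> L i) N \<beta> \<Longrightarrow> f \<in> carrier (lie_cochains \<epsilon> L N i)"
  unfolding lie_cochains_def E.carrier_graded_hom by (rule E.F.span_base) blast

lemma cochain_eqI:
  assumes "f \<in> carrier (lie_cochains \<epsilon> L N i)" "g \<in> carrier (lie_cochains \<epsilon> L N i)"
    and "\<And>ws. homog_word L ws \<Longrightarrow> length ws = i \<Longrightarrow> word_value f ws = word_value g ws"
  shows "f = g"
  using assms unfolding lie_cochains_def by (rule hom_eqI)

text \<open>Existence comes from \<open>hom_exists\<close>, uniqueness from agreement on homogeneous
  words. The description only asks for an element of Hom; homogeneity of degree \<beta> is inherited
  from the witness.\<close>

lemma the_cochain:
  assumes "alternating i \<beta> R"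
  defines "h \<equiv> (THE h. h \<in> carrier (lie_cochains \<epsilon> L N i) \<and>
    (\<forall>ws. homog_word L ws \<longrightarrow> length ws = i \<longrightarrow> word_value h ws = R ws))"
  shows "h \<in> hom_deg (ext_power \<epsilon> L i) N \<beta>"
    and "homog_word L ws \<Longrightarrow> length ws = i \<Longrightarrow> word_value h ws = R ws"
proof -
  obtain h' where h': "h' \<in> hom_deg (ext_power \<epsilon> L i) N \<beta>"
    "\<And>ws. homog_word L ws \<Longrightarrow> length ws = i \<Longrightarrow> word_value h' ws = R ws"
    using hom_exists[OF assms(1)] by blast
  have "h = h'"
    unfolding h_def
    by (rule the_equality) (use h' hom_deg_cochain in \<open>auto intro: cochain_eqI\<close>)
  with h' show "h \<in> hom_deg (ext_power \<epsilon> L i) N \<beta>"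
    "homog_word L ws \<Longrightarrow> length ws = i \<Longrightarrow> word_value h ws = R ws" by auto
qed

lemma \<xi>_hom_eq:
  "\<xi>_hom \<epsilon> L N i a y \<beta> f = (THE h. h \<in> carrier (lie_cochains \<epsilon> L N i) \<and>
    (\<forall>ws. homog_word L ws \<longrightarrow> length ws = i \<longrightarrow>
      word_value h ws = act N y (word_value f ws) - bracket_sum ws y a \<beta> (word_value f)))"
  unfolding \<xi>_hom_def all_words_iff bracket_sum_index by (simp add: comp_def del: upt_Suc)

lemma lie_d_hom_eq:
  "lie_d_hom \<epsilon> L N i \<beta> f = (THE h. h \<in> carrier (lie_cochains \<epsilon> L N (Suc i)) \<and>
    (\<forall>ws. homog_word L ws \<longrightarrow> length ws = Suc i \<longrightarrow> word_value h ws = ce_diff ws \<beta> (word_value f)))"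
  unfolding lie_d_hom_def all_words_iff ce_diff_index by (simp add: comp_def del: upt_Suc)

lemma \<xi>_hom:
  assumes y: "y \<in> grade L a" and f: "f \<in> hom_deg (ext_power \<epsilon> L i) N \<beta>"
  shows "\<xi>_hom \<epsilon> L N i a y \<beta> f \<in> hom_deg (ext_power \<epsilon> L i) N (\<beta> + a)"
    and "homog_word L ws \<Longrightarrow> length ws = i \<Longrightarrow> word_value (\<xi>_hom \<epsilon> L N i a y \<beta> f) ws =
      act N y (word_value f ws) - bracket_sum ws y a \<beta> (word_value f)"
proof -
  have alt: "alternating i (\<beta> + a) (\<lambda>ws. act N y (word_value f ws) - bracket_sum ws y a \<beta> (word_value f))"
    by (intro alternating_diff alternating_ac alternating_bracket_sum hom_alternating f y)
  show "\<xi>_hom \<epsilon> L N i a y \<beta> f \<in> hom_deg (ext_power \<epsilon> L i) N (\<beta> + a)"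
    "homog_word L ws \<Longrightarrow> length ws = i \<Longrightarrow> word_value (\<xi>_hom \<epsilon> L N i a y \<beta> f) ws =
      act N y (word_value f ws) - bracket_sum ws y a \<beta> (word_value f)"
    unfolding \<xi>_hom_eq by (rule the_cochain[OF alt]; assumption)+
qed

lemma lie_d_hom:
  assumes f: "f \<in> hom_deg (ext_power \<epsilon> L i) N \<beta>"
  shows "lie_d_hom \<epsilon> L N i \<beta> f \<in> hom_deg (ext_power \<epsilon> L (Suc i)) N \<beta>"
    and "homog_word L ws \<Longrightarrow> length ws = Suc i \<Longrightarrow>
      word_value (lie_d_hom \<epsilon> L N i \<beta> f) ws = ce_diff ws \<beta> (word_value f)"
proof -
  have alt: "alternating (Suc i) \<beta> (\<lambda>ws. ce_diff ws \<beta> (word_value f))"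
    by (intro alternating_ce_diff hom_alternating f)
  show "lie_d_hom \<epsilon> L N i \<beta> f \<in> hom_deg (ext_power \<epsilon> L (Suc i)) N \<beta>"
    "homog_word L ws \<Longrightarrow> length ws = Suc i \<Longrightarrow>
      word_value (lie_d_hom \<epsilon> L N i \<beta> f) ws = ce_diff ws \<beta> (word_value f)"
    unfolding lie_d_hom_eq by (rule the_cochain[OF alt]; assumption)+
qed

lemma lie_d_hom_index:
  assumes "f \<in> hom_deg (ext_power \<epsilon> L i) N \<beta>" "\<forall>s\<in>{1..i+1}. x s \<in> grade L (\<alpha> s)"
  shows "lie_d_hom \<epsilon> L N i \<beta> f (wedge \<epsilon> L (map x [1..<i+2])) =
    - (\<Sum>t\<in>{1..i+1}. vscale N ((-1) ^ t * \<epsilon> (\<beta> + (\<Sum>s\<in>{1..<t}. \<alpha> s)) (\<alpha> t))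
        (act N (x t) (f (wedge \<epsilon> L (map x ([1..<t] @ [Suc t..<i+2]))))))
    + (\<Sum>j\<in>{1..i+1}. \<Sum>t\<in>{1..<j}. vscale N ((-1) ^ t * \<epsilon> (\<alpha> t) (\<Sum>s\<in>{Suc t..<j}. \<alpha> s))
        (f (wedge \<epsilon> L (map x ([1..<t] @ [Suc t..<j]) @ [mult L (x t) (x j)] @ map x [Suc j..<i+2]))))"
  using lie_d_hom(2)[OF assms(1), of "map (\<lambda>s. (x s, \<alpha> s)) [1..<Suc (Suc i)]"] assms(2)
  unfolding ce_diff_index by (simp add: comp_def homog_word_def list_all_iff del: upt_Suc)

lemma \<xi>_hom_index:
  assumes "y \<in> grade L a" "f \<in> hom_deg (ext_power \<epsilon> L i) N \<beta>" "\<forall>s\<in>{1..i}. x s \<in> grade L (\<alpha> s)"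
  shows "\<xi>_hom \<epsilon> L N i a y \<beta> f (wedge \<epsilon> L (map x [1..<Suc i])) =
    act N y (f (wedge \<epsilon> L (map x [1..<Suc i])))
    - (\<Sum>j\<in>{1..i}. vscale N (\<epsilon> a (\<beta> + (\<Sum>s\<in>{1..<j}. \<alpha> s)))
        (f (wedge \<epsilon> L (map x [1..<j] @ [mult L y (x j)] @ map x [Suc j..<Suc i]))))"
  using \<xi>_hom(2)[OF assms(1,2), of "map (\<lambda>s. (x s, \<alpha> s)) [1..<Suc i]"] assms(3)
  unfolding bracket_sum_index by (simp add: comp_def homog_word_def list_all_iff del: upt_Suc)

end

section \<open>Linearity of the coboundary and its extension to all cochains\<close>

context lie_module
begin

lemma graded_space_cochains: "graded_space (lie_cochains \<epsilon> L N i)"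
  unfolding lie_cochains_def by (rule E.graded_space_graded_hom)

sublocale C: gr_space "lie_cochains \<epsilon> L N i" for i
  by standard (rule graded_space_cochains)

lemma cochains_simps [simp]:
  "vscale (lie_cochains \<epsilon> L N i) = (\<lambda>c f x. vscale N c (f x))"
  "grade (lie_cochains \<epsilon> L N i) = hom_deg (ext_power \<epsilon> L i) N"
  by (simp_all add: lie_cochains_def graded_hom_def)

lemma lie_d_hom_add:
  assumes f: "f \<in> hom_deg (ext_power \<epsilon> L i) N \<beta>" and g: "g \<in> hom_deg (ext_power \<epsilon> L i) N \<beta>"
  shows "lie_d_hom \<epsilon> L N i \<beta> (f + g) = lie_d_hom \<epsilon> L N i \<beta> f + lie_d_hom \<epsilon> L N i \<beta> g"
proof (rule cochain_eqI)
  have fg: "f + g \<in> hom_deg (ext_power \<epsilon> L i) N \<beta>"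
    by (rule E.F.subspace_add[OF E.subspace_hom_deg f g])
  show "lie_d_hom \<epsilon> L N i \<beta> (f + g) \<in> carrier (lie_cochains \<epsilon> L N (Suc i))"
    by (rule hom_deg_cochain[OF lie_d_hom(1)[OF fg]])
  show "lie_d_hom \<epsilon> L N i \<beta> f + lie_d_hom \<epsilon> L N i \<beta> g \<in> carrier (lie_cochains \<epsilon> L N (Suc i))"
    by (rule hom_deg_cochain[OF E.F.subspace_add[OF E.subspace_hom_deg lie_d_hom(1)[OF f] lie_d_hom(1)[OF g]]])
  fix ws assume ws: "homog_word L ws" "length ws = Suc i"
  have "ce_diff ws \<beta> (\<lambda>vs. word_value f vs + word_value g vs) =
      ce_diff ws \<beta> (word_value f) + ce_diff ws \<beta> (word_value g)"
    using hom_alternating[OF f] hom_alternating[OF g] ws by (intro ce_diff_plus[of _ i \<beta>]) auto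
  then show "word_value (lie_d_hom \<epsilon> L N i \<beta> (f + g)) ws =
      word_value (lie_d_hom \<epsilon> L N i \<beta> f + lie_d_hom \<epsilon> L N i \<beta> g) ws"
    by (simp add: lie_d_hom(2)[OF fg ws] lie_d_hom(2)[OF f ws] lie_d_hom(2)[OF g ws])
qed

lemma lie_d_hom_scale:
  assumes f: "f \<in> hom_deg (ext_power \<epsilon> L i) N \<beta>"
  shows "lie_d_hom \<epsilon> L N i \<beta> (\<lambda>x. vscale N c (f x)) = (\<lambda>x. vscale N c (lie_d_hom \<epsilon> L N i \<beta> f x))"
proof (rule cochain_eqI)
  have cf: "(\<lambda>x. vscale N c (f x)) \<in> hom_deg (ext_power \<epsilon> L i) N \<beta>"
    by (rule E.F.subspace_scale[OF E.subspace_hom_deg f])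
  show "lie_d_hom \<epsilon> L N i \<beta> (\<lambda>x. vscale N c (f x)) \<in> carrier (lie_cochains \<epsilon> L N (Suc i))"
    by (rule hom_deg_cochain[OF lie_d_hom(1)[OF cf]])
  show "(\<lambda>x. vscale N c (lie_d_hom \<epsilon> L N i \<beta> f x)) \<in> carrier (lie_cochains \<epsilon> L N (Suc i))"
    by (rule hom_deg_cochain[OF E.F.subspace_scale[OF E.subspace_hom_deg lie_d_hom(1)[OF f]]])
  fix ws assume ws: "homog_word L ws" "length ws = Suc i"
  have "ce_diff ws \<beta> (\<lambda>vs. vscale N c (word_value f vs)) = vscale N c (ce_diff ws \<beta> (word_value f))"
    using hom_alternating[OF f] ws by (intro ce_diff_vscale[of _ i \<beta>]) auto
  then show "word_value (lie_d_hom \<epsilon> L N i \<beta> (\<lambda>x. vscale N c (f x))) ws =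
      vscale N c (word_value (lie_d_hom \<epsilon> L N i \<beta> f) ws)"
    by (simp add: lie_d_hom(2)[OF cf ws] lie_d_hom(2)[OF f ws])
qed

lemma lie_d_hom_zero: "lie_d_hom \<epsilon> L N i \<beta> 0 = 0"
  using lie_d_hom_scale[of 0 i \<beta> 0] E.F.subspace_0[OF E.subspace_hom_deg]
  by (simp add: zero_fun_def)

lemma \<xi>_hom_zero:
  assumes y: "y \<in> grade L a"
  shows "\<xi>_hom \<epsilon> L N i a y \<beta> 0 = 0"
proof (rule cochain_eqI)
  have 0: "0 \<in> hom_deg (ext_power \<epsilon> L i) N \<gamma>" for i \<gamma>
    by (rule E.F.subspace_0[OF E.subspace_hom_deg])
  show "\<xi>_hom \<epsilon> L N i a y \<beta> 0 \<in> carrier (lie_cochains \<epsilon> L N i)"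
    by (rule hom_deg_cochain[OF \<xi>_hom(1)[OF y 0]])
  show "0 \<in> carrier (lie_cochains \<epsilon> L N i)"
    by (rule hom_deg_cochain[OF 0])
  fix ws assume ws: "homog_word L ws" "length ws = i"
  show "word_value (\<xi>_hom \<epsilon> L N i a y \<beta> 0) ws = word_value 0 ws"
    using ac_scale_right[OF y, of 0 0 0] bracket_sum_vscale[of ws y a \<beta> 0 "\<lambda>_. 0"]
    by (simp add: \<xi>_hom(2)[OF y 0 ws] W.subspace_0[OF W.subspace_grade])
qed

lemma lie_d_carrier:
  assumes "f \<in> carrier (lie_cochains \<epsilon> L N i)"
  shows "lie_d \<epsilon> L N i f \<in> carrier (lie_cochains \<epsilon> L N (Suc i))"
  unfolding lie_d_def hsum_def
  using C.homog_part(2)[OF assms]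
  by (intro C.subspace_sum[OF C.subspace_carrier] hom_deg_cochain[OF lie_d_hom(1)]) simp

lemma lie_d_add:
  assumes "f \<in> carrier (lie_cochains \<epsilon> L N i)" "g \<in> carrier (lie_cochains \<epsilon> L N i)"
  shows "lie_d \<epsilon> L N i (f + g) = lie_d \<epsilon> L N i f + lie_d \<epsilon> L N i g"
  unfolding lie_d_def by (rule C.hsum_add[OF assms]) (simp add: lie_d_hom_add)

lemma lie_d_scale:
  assumes "f \<in> carrier (lie_cochains \<epsilon> L N i)"
  shows "lie_d \<epsilon> L N i (\<lambda>x. vscale N c (f x)) = (\<lambda>x. vscale N c (lie_d \<epsilon> L N i f x))"
  unfolding lie_d_def
  using C.hsum_scale[OF assms, of "\<lambda>h x. vscale N c (h x)" "lie_d_hom \<epsilon> L N i" c]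
  by (simp add: lie_d_hom_scale lie_d_hom_zero W.scale_right_distrib fun_eq_iff)

lemma subspace_lie_d_image:
  "E.F.subspace (lie_d \<epsilon> L N i ` carrier (lie_cochains \<epsilon> L N i))"
proof (rule E.F.subspaceI)
  have zero: "0 \<in> carrier (lie_cochains \<epsilon> L N i)"
    by (rule C.subspace_0[OF C.subspace_carrier])
  have "lie_d \<epsilon> L N i 0 = 0"
    using lie_d_add[OF zero zero] by simp
  with zero show "0 \<in> lie_d \<epsilon> L N i ` carrier (lie_cochains \<epsilon> L N i)"
    by (intro image_eqI[of 0 _ 0]) simp_all
next
  fix f g assume "f \<in> lie_d \<epsilon> L N i ` carrier (lie_cochains \<epsilon> L N i)"
    "g \<in> lie_d \<epsilon> L N i ` carrier (lie_cochains \<epsilon> L N i)"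
  then obtain f' g' where *: "f' \<in> carrier (lie_cochains \<epsilon> L N i)" "f = lie_d \<epsilon> L N i f'"
    "g' \<in> carrier (lie_cochains \<epsilon> L N i)" "g = lie_d \<epsilon> L N i g'"
    by blast
  show "f + g \<in> lie_d \<epsilon> L N i ` carrier (lie_cochains \<epsilon> L N i)"
    unfolding *(2,4) lie_d_add[OF *(1,3), symmetric]
    by (rule imageI) (rule C.subspace_add[OF C.subspace_carrier *(1,3)])
next
  fix c f assume "f \<in> lie_d \<epsilon> L N i ` carrier (lie_cochains \<epsilon> L N i)"
  then obtain g where g: "g \<in> carrier (lie_cochains \<epsilon> L N i)" "f = lie_d \<epsilon> L N i g"
    by blast
  show "(\<lambda>x. vscale N c (f x)) \<in> lie_d \<epsilon> L N i ` carrier (lie_cochains \<epsilon> L N i)"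
    unfolding g(2) lie_d_scale[OF g(1), symmetric]
    by (rule imageI) (rule C.subspace_scale[OF C.subspace_carrier g(1), unfolded cochains_simps])
qed

end


section \<open>Currying\<close>

text \<open>A will be an exterior power, whose elements are cosets, and is therefore only presented,
  while B and M are honest graded spaces.\<close>

locale currying = A: presentation s A p H + B: gr_space B + M: gr_space M
  for s :: "'k::field \<Rightarrow> 'p::ab_group_add \<Rightarrow> 'p"
    and A :: "('k, 'g::ab_group_add, 'v, 'x) gspace_scheme" and p :: "'p \<Rightarrow> 'v" and H :: "'g \<Rightarrow> 'p set"
    and B :: "('k, 'g, 'b::ab_group_add, 'y) gspace_scheme"
    and M :: "('k, 'g, 'm::ab_group_add, 'z) gspace_scheme"
begin

sublocale BM: graded_homs "vscale B" B "\<lambda>x. x" "grade B" M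
  by (intro graded_homs.intro presentation_graded_space B.graded M.gr_space_axioms)

sublocale ABM: graded_homs s A p H "graded_hom B M"
  by (intro graded_homs.intro A.presentation_axioms gr_space.intro BM.graded_space_graded_hom)

sublocale AB: graded_homs s A p H B
  by (intro graded_homs.intro A.presentation_axioms B.gr_space_axioms)

sublocale AM: graded_homs s A p H M
  by (intro graded_homs.intro A.presentation_axioms M.gr_space_axioms)

sublocale T: graded_homs free_scale "tensor_space A B" "coset (tensor_rel A B)" "tensor_gens A B" M
  by (intro graded_homs.intro AB.presentation_tensor M.gr_space_axioms)

lemma tensor_carrier:
  assumes "X \<in> carrier A" "y \<in> carrier B"
  shows "tensor A B X y \<in> carrier (tensor_space A B)"
proof -
  have "free_gen (X, y) \<in> free.span {free_gen (x, y) | x y. x \<in> carrier A \<and> y \<in> carrier B}"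
    using assms by (intro free.span_base) blast
  then show ?thesis
    unfolding tensor_def tensor_space_def quotient_space_def gspace.select_convs by (rule imageI)
qed

lemma tensor_grade:
  assumes "X \<in> grade A \<alpha>" "y \<in> grade B \<beta>"
  shows "tensor A B X y \<in> grade (tensor_space A B) (\<alpha> + \<beta>)"
  unfolding tensor_def using assms by (intro T.generator_grade) (auto simp: tensor_gens_def)

lemma A_closed:
  "X \<in> carrier A \<Longrightarrow> Y \<in> carrier A \<Longrightarrow> vadd A X Y \<in> carrier A"
  "X \<in> carrier A \<Longrightarrow> vscale A c X \<in> carrier A"
  by (auto simp: A.carrier_image A.vadd_p A.vscale_p A.span_add A.span_scale)

lemma coset_tensor_eqI: "q - r \<in> tensor_rel A B \<Longrightarrow> coset (tensor_rel A B) q = coset (tensor_rel A B) r"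
  by (simp add: free.coset_eq_iff[OF subspace_tensor_rel])

lemma linear_tensor:
  assumes h: "h \<in> linear_maps (tensor_space A B) M"
  shows "X \<in> carrier A \<Longrightarrow> X' \<in> carrier A \<Longrightarrow> y \<in> carrier B \<Longrightarrow>
      h (tensor A B (vadd A X X') y) = h (tensor A B X y) + h (tensor A B X' y)"
    and "X \<in> carrier A \<Longrightarrow> y \<in> carrier B \<Longrightarrow>
      h (tensor A B (vscale A c X) y) = vscale M c (h (tensor A B X y))"
    and "X \<in> carrier A \<Longrightarrow> y \<in> carrier B \<Longrightarrow> y' \<in> carrier B \<Longrightarrow>
      h (tensor A B X (y + y')) = h (tensor A B X y) + h (tensor A B X y')"
    and "X \<in> carrier A \<Longrightarrow> y \<in> carrier B \<Longrightarrow>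
      h (tensor A B X (vscale B c y)) = vscale M c (h (tensor A B X y))"
proof -
  \<comment> \<open>Stated for two unrelated pairs, so that it serves additivity in the left factor,
    with y = y', and in the right one, with X = X'.\<close>
  have add: "h (coset (tensor_rel A B) q) = h (tensor A B X y) + h (tensor A B X' y')"
    if "q - free_gen (X, y) - free_gen (X', y') \<in> tensor_rel A B" "X \<in> carrier A" "X' \<in> carrier A" "y \<in> carrier B" "y' \<in> carrier B"
    for q X X' y y'
  proof -
    have "coset (tensor_rel A B) q = vadd (tensor_space A B) (tensor A B X y) (tensor A B X' y')"
      unfolding tensor_def T.V.vadd_p by (rule coset_tensor_eqI) (use that(1) in \<open>simp add: diff_diff_eq\<close>)
    then show ?thesis
      using h tensor_carrier that(2-) by (simp add: linear_maps_def)
  qed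
  have scale: "h (coset (tensor_rel A B) q) = vscale M c (h (tensor A B X y))"
    if "q - free_scale c (free_gen (X, y)) \<in> tensor_rel A B" "X \<in> carrier A" "y \<in> carrier B" for q X y c
  proof -
    have "coset (tensor_rel A B) q = vscale (tensor_space A B) c (tensor A B X y)"
      unfolding tensor_def T.V.vscale_p by (rule coset_tensor_eqI) (rule that(1))
    then show ?thesis
      using h tensor_carrier that(2-) by (simp add: linear_maps_def)
  qed
  show "X \<in> carrier A \<Longrightarrow> X' \<in> carrier A \<Longrightarrow> y \<in> carrier B \<Longrightarrow>
      h (tensor A B (vadd A X X') y) = h (tensor A B X y) + h (tensor A B X' y)"
    unfolding tensor_def[of _ _ "vadd A X X'"] by (rule add[OF tensor_relI(1)])
  show "X \<in> carrier A \<Longrightarrow> y \<in> carrier B \<Longrightarrow>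
      h (tensor A B (vscale A c X) y) = vscale M c (h (tensor A B X y))"
    unfolding tensor_def[of _ _ "vscale A c X"] by (rule scale[OF tensor_relI(3)])
  show "X \<in> carrier A \<Longrightarrow> y \<in> carrier B \<Longrightarrow> y' \<in> carrier B \<Longrightarrow>
      h (tensor A B X (y + y')) = h (tensor A B X y) + h (tensor A B X y')"
    unfolding B.vadd_eq[symmetric] tensor_def[of _ _ _ "vadd B y y'"] by (rule add[OF tensor_relI(2)])
  show "X \<in> carrier A \<Longrightarrow> y \<in> carrier B \<Longrightarrow>
      h (tensor A B X (vscale B c y)) = vscale M c (h (tensor A B X y))"
    unfolding tensor_def[of _ _ _ "vscale B c y"] by (rule scale[OF tensor_relI(4)])
qed

lemma uncurry_exists:
  assumes f: "f \<in> hom_deg A (graded_hom B M) \<beta>"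
  shows "\<exists>h\<in>hom_deg (tensor_space A B) M \<beta>. \<forall>X\<in>carrier A. \<forall>y\<in>carrier B. h (tensor A B X y) = f X y"
proof -
  have fX: "f X \<in> linear_maps B M" if "X \<in> carrier A" for X
    using f that by (intro BM.graded_hom_linear) (auto simp: hom_deg_def)
  define T where "T = free_extend (vscale M) (\<lambda>(X, y). f X y)"
  have T_gen: "T (free_gen (X, y)) = f X y" for X y
    by (simp add: T_def)
  have T_add: "T (q + r) = T q + T r" and T_diff: "T (q - r) = T q - T r"
    and T_scale: "T (free_scale c q) = vscale M c (T q)" for q r c
    by (simp_all add: T_def M.free_extend_add M.free_extend_diff M.free_extend_scale)
  have T_rel: "T q = 0" if "q \<in> tensor_rel A B" for q
    using that unfolding tensor_rel_def
  proof (induction rule: free.span_induct_alt)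
    case base
    then show ?case by (simp add: T_def)
  next
    case (step c q r)
    \<comment> \<open>Linearity of f itself handles the relations in the left factor, linearity of
      each map \<open>f X\<close> those in the right one.\<close>
    have "f (vadd A X X') y = f X y + f X' y" "f (vscale A c X) y = vscale M c (f X y)"
      if "X \<in> carrier A" "X' \<in> carrier A" for X X' c y
      using f that by (auto simp: hom_deg_def graded_hom_def)
    moreover have "f X (vadd B y y') = f X y + f X y'" "f X (vscale B c y) = vscale M c (f X y)"
      if "X \<in> carrier A" "y \<in> carrier B" "y' \<in> carrier B" for X y y' c
      using fX that by (auto simp: linear_maps_def)
    ultimately have "T q = 0"
      using step(1) by (auto simp: T_diff T_gen T_scale)
    with step(2) show ?case
      by (simp add: T_add T_scale)
  qed
  have "\<exists>h\<in>hom_deg (tensor_space A B) M \<beta>. \<forall>q. coset (tensor_rel A B) q \<in> carrier (tensor_space A B) \<longrightarrow>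
      h (coset (tensor_rel A B) q) = T q"
  proof (rule T.hom_deg_exists[OF T_add T_scale])
    show "T q = T r" if "coset (tensor_rel A B) q = coset (tensor_rel A B) r" for q r
      using that T_rel[of "q - r"] by (simp add: free.coset_eq_iff[OF subspace_tensor_rel] T_diff)
    show "T q \<in> grade M (\<gamma> + \<beta>)" if q: "q \<in> tensor_gens A B \<gamma>" for q \<gamma>
    proof -
      obtain X y \<alpha> \<delta> where *: "q = free_gen (X, y)" "X \<in> grade A \<alpha>" "y \<in> grade B \<delta>" "\<alpha> + \<delta> = \<gamma>"
        using q unfolding tensor_gens_def by blast
      have "f X \<in> hom_deg B M (\<alpha> + \<beta>)"
        using f *(2) by (auto simp: hom_deg_def[of A] graded_hom_def)
      then have "f X y \<in> grade M (\<delta> + (\<alpha> + \<beta>))"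
        using *(3) by (auto simp: hom_deg_eq)
      then show ?thesis
        by (simp add: T_gen *(1) *(4)[symmetric] ac_simps)
    qed
  qed
  then show ?thesis
    using tensor_carrier T_gen unfolding tensor_def by metis
qed

lemma curry_exists:
  assumes h: "h \<in> hom_deg (tensor_space A B) M \<beta>"
  shows "\<exists>f\<in>hom_deg A (graded_hom B M) \<beta>. \<forall>X\<in>carrier A. \<forall>y\<in>carrier B. f X y = h (tensor A B X y)"
proof -
  have lin: "h \<in> linear_maps (tensor_space A B) M"
    using h by (simp add: hom_deg_eq)
  \<comment> \<open>Both f and every \<open>f X\<close> have to vanish off their carriers to belong
    to Hom.\<close>
  define f where "f X y = (if X \<in> carrier A \<and> y \<in> carrier B then h (tensor A B X y) else 0)" for X y
  have f_add: "f (vadd A X Y) = f X + f Y" and f_scale: "f (vscale A c X) = (\<lambda>y. vscale M c (f X y))"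
    if "X \<in> carrier A" "Y \<in> carrier A" for X Y c
    using that by (auto simp: f_def fun_eq_iff A_closed linear_tensor[OF lin])
  have f_grade: "f X \<in> hom_deg B M (\<alpha> + \<beta>)" if X: "X \<in> grade A \<alpha>" for X \<alpha>
  proof -
    have XA: "X \<in> carrier A"
      by (rule AB.V_grade_carrier[OF X])
    have "f X y \<in> grade M (\<gamma> + (\<alpha> + \<beta>))" if "y \<in> grade B \<gamma>" for y \<gamma>
    proof -
      have "h (tensor A B X y) \<in> grade M (\<alpha> + \<gamma> + \<beta>)"
        using h tensor_grade[OF X that] by (auto simp: hom_deg_eq)
      then show ?thesis
        using XA B.grade_carrier[OF that] by (simp add: f_def ac_simps)
    qed
    moreover have "h (tensor A B X y) \<in> carrier M" if "y \<in> carrier B" for y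
      using lin tensor_carrier[OF XA that] by (auto simp: linear_maps_def)
    ultimately show ?thesis
      using XA by (auto simp: hom_deg_def f_def B.vadd_eq linear_tensor[OF lin]
        B.subspace_add[OF B.subspace_carrier] B.subspace_scale[OF B.subspace_carrier])
  qed
  \<comment> \<open>Membership is immediate for homogeneous X. For general X it is carried along a
    combination of generators upstairs, since the type of A has no addition.\<close>
  have "f X \<in> carrier (graded_hom B M)" if X: "X \<in> carrier A" for X
  proof -
    obtain a where a: "a \<in> A.span (\<Union>\<gamma>. H \<gamma>)" "X = p a"
      using X by (auto simp: A.carrier_image)
    have "a \<in> A.span (\<Union>\<gamma>. H \<gamma>) \<and> f (p a) \<in> carrier (graded_hom B M)"
      using a(1)
    proof (induction rule: A.span_induct_alt)
      case base
      have p0: "p 0 \<in> carrier A"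
        by (auto simp: A.carrier_image A.span_zero)
      have "f (p 0) = 0"
        using f_scale[OF p0 p0, of 0] by (simp add: A.vscale_p fun_eq_iff)
      moreover have "0 \<in> carrier (graded_hom B M)"
        by (rule BM.Hom.subspace_0[OF BM.Hom.subspace_carrier])
      ultimately show ?case
        using A.span_zero by metis
    next
      case (step c b q)
      then obtain \<gamma> where b: "b \<in> H \<gamma>"
        by blast
      have pb: "p b \<in> carrier A" and pq: "p q \<in> carrier A"
        using AB.generator_carrier[OF b] step(2) by (auto simp: A.carrier_image)
      have "f (p (s c b + q)) = (\<lambda>y. vscale M c (f (p b) y)) + f (p q)"
        using pb pq by (simp add: A.vadd_p[symmetric] A.vscale_p[symmetric] f_add f_scale[OF pb pb] A_closed)
      moreover have "f (p b) \<in> carrier (graded_hom B M)"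
        using f_grade[OF AB.generator_grade[OF b]] unfolding BM.carrier_graded_hom
        by (intro BM.F.span_base) blast
      ultimately have "f (p (s c b + q)) \<in> carrier (graded_hom B M)"
        using step(2) unfolding BM.carrier_graded_hom by (simp add: BM.F.span_add BM.F.span_scale)
      moreover have "s c b + q \<in> A.span (\<Union>\<gamma>. H \<gamma>)"
        using A.span_add[OF A.span_scale[OF A.span_base[OF step(1)]] conjunct1[OF step(2)]] .
      ultimately show ?case by blast
    qed
    with a show ?thesis by simp
  qed
  then have "f \<in> hom_deg A (graded_hom B M) \<beta>"
    using f_grade f_add f_scale unfolding hom_deg_def[of A]
    by (auto simp: graded_hom_def) (simp add: f_def fun_eq_iff)
  moreover have "\<forall>X\<in>carrier A. \<forall>y\<in>carrier B. f X y = h (tensor A B X y)"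
    by (simp add: f_def)
  ultimately show ?thesis by blast
qed

text \<open>In a generating tensor of \<open>tensor_space\<close> the left factor X ranges over a
  grade, that is over a span of generators. Fixing y turns both maps into linear maps on A, which
  are determined by the generators themselves.\<close>

lemma tensor_eqI:
  assumes h: "h \<in> carrier (graded_hom (tensor_space A B) M)" and h': "h' \<in> carrier (graded_hom (tensor_space A B) M)"
    and eq: "\<And>\<alpha> \<beta> a y. a \<in> H \<alpha> \<Longrightarrow> y \<in> grade B \<beta> \<Longrightarrow> h (tensor A B (p a) y) = h' (tensor A B (p a) y)"
  shows "h = h'"
proof (rule T.graded_hom_eqI[OF h h'])
  fix \<gamma> q assume "q \<in> tensor_gens A B \<gamma>"
  then obtain X y \<alpha> \<beta> where q: "q = free_gen (X, y)" "X \<in> grade A \<alpha>" "y \<in> grade B \<beta>"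
    unfolding tensor_gens_def by blast
  define k where "k h X = (if X \<in> carrier A then h (tensor A B X y) else 0)" for h :: "_ \<Rightarrow> 'm" and X
  have y: "y \<in> carrier B"
    by (rule B.grade_carrier[OF q(3)])
  have k: "k h \<in> linear_maps A M" if "h \<in> carrier (graded_hom (tensor_space A B) M)" for h
  proof -
    have lin: "h \<in> linear_maps (tensor_space A B) M"
      by (rule T.graded_hom_linear[OF that])
    then show ?thesis
      using linear_tensor(1)[OF lin _ _ y] linear_tensor(2)[OF lin _ y] tensor_carrier[OF _ y]
      by (auto simp: linear_maps_def k_def A_closed)
  qed
  have "k h = k h'"
    by (rule AM.linear_maps_eqI[OF k[OF h] k[OF h']])
      (use eq q(3) AB.generator_carrier in \<open>auto simp: k_def\<close>)
  then show "h (coset (tensor_rel A B) q) = h' (coset (tensor_rel A B) q)"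
    using AB.V_grade_carrier[OF q(2)] by (auto simp: q(1) tensor_def[symmetric] k_def dest!: fun_cong[of _ _ X])
qed

text \<open>A relation rather than a function: existence in either direction extends from
  homogeneous maps by additivity, and \<open>\<psi>\<close> is later identified through
  uniqueness.\<close>

abbreviation curried :: "('v \<Rightarrow> 'b \<Rightarrow> 'm) \<Rightarrow> (('v \<times> 'b \<Rightarrow>\<^sub>0 'k) set \<Rightarrow> 'm) \<Rightarrow> bool" where
  "curried f h \<equiv> \<forall>X\<in>carrier A. \<forall>y\<in>carrier B. h (tensor A B X y) = f X y"

lemma curried_uncurry_exists:
  assumes "f \<in> carrier (graded_hom A (graded_hom B M))"
  shows "\<exists>h\<in>carrier (graded_hom (tensor_space A B) M). curried f h"
  using assms
proof (induction rule: ABM.Hom.carrier_induct)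
  case zero
  have "0 \<in> carrier (graded_hom (tensor_space A B) M)"
    by (rule T.Hom.subspace_0[OF T.Hom.subspace_carrier])
  then show ?case by (intro bexI[of _ 0]) simp_all
next
  case (homog \<beta> f)
  then obtain h where "h \<in> hom_deg (tensor_space A B) M \<beta>" "curried f h"
    using uncurry_exists[of f \<beta>] by (auto simp: graded_hom_def[of A])
  then show ?case
    using T.Hom.grade_carrier[of h \<beta>] by (auto simp: graded_hom_def)
next
  case (add f g)
  then obtain h k where "h \<in> carrier (graded_hom (tensor_space A B) M)" "curried f h"
    "k \<in> carrier (graded_hom (tensor_space A B) M)" "curried g k"
    by blast
  then show ?case
    using T.Hom.subspace_add[OF T.Hom.subspace_carrier] by (intro bexI[of _ "h + k"]) simp_all
qed

lemma curried_curry_exists: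
  assumes "h \<in> carrier (graded_hom (tensor_space A B) M)"
  shows "\<exists>f\<in>carrier (graded_hom A (graded_hom B M)). curried f h"
  using assms
proof (induction rule: T.Hom.carrier_induct)
  case zero
  have "0 \<in> carrier (graded_hom A (graded_hom B M))"
    by (rule ABM.Hom.subspace_0[OF ABM.Hom.subspace_carrier])
  then show ?case by (intro bexI[of _ 0]) simp_all
next
  case (homog \<beta> h)
  then obtain f where "f \<in> hom_deg A (graded_hom B M) \<beta>" "curried f h"
    using curry_exists[of h \<beta>] by (auto simp: graded_hom_def[of "tensor_space A B"])
  then show ?case
    using ABM.Hom.grade_carrier[of f \<beta>] by (auto simp: graded_hom_def[of A])
next
  case (add h k)
  then obtain f g where "f \<in> carrier (graded_hom A (graded_hom B M))" "curried f h"
    "g \<in> carrier (graded_hom A (graded_hom B M))" "curried g k"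
    by blast
  then show ?case
    using ABM.Hom.subspace_add[OF ABM.Hom.subspace_carrier] by (intro bexI[of _ "f + g"]) simp_all
qed

lemma curried_unique:
  assumes "h \<in> carrier (graded_hom (tensor_space A B) M)" "h' \<in> carrier (graded_hom (tensor_space A B) M)"
    "curried f h" "curried f h'"
  shows "h = h'"
  using assms(1,2) by (rule tensor_eqI) (use assms(3,4) AB.generator_carrier B.grade_carrier in auto)

text \<open>Values off the carriers are zero for both maps, so agreement on A and B already gives
  equality of functions.\<close>

lemma curried_inj:
  assumes f: "f \<in> carrier (graded_hom A (graded_hom B M))" and g: "g \<in> carrier (graded_hom A (graded_hom B M))"
    and "curried f h" "curried g h"
  shows "f = g"
proof (intro ext)
  fix X y
  note lin = ABM.graded_hom_linear[OF f] ABM.graded_hom_linear[OF g]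
  show "f X y = g X y"
  proof (cases "X \<in> carrier A")
    case True
    then have "f X \<in> linear_maps B M" "g X \<in> linear_maps B M"
      using lin by (auto simp: linear_maps_def[of A] intro!: BM.graded_hom_linear)
    with True assms(3,4) show ?thesis
      by (cases "y \<in> carrier B") (auto simp: linear_maps_def)
  next
    case False
    with lin show ?thesis by (auto simp: linear_maps_def)
  qed
qed

end


section \<open>Cochains of a generalized left-symmetric algebra\<close>

lemma sum_apply: "sum F J z = (\<Sum>j\<in>J. F j z)" for F :: "'j \<Rightarrow> 'a \<Rightarrow> 'b::ab_group_add"
  by (rule additive_sum[of "\<lambda>f. f z"]) simp

lemma sum_list_upt: "sum_list (map \<alpha> [a..<b]) = (\<Sum>s\<in>{a..<b}. \<alpha> s)" for \<alpha> :: "nat \<Rightarrow> 'a::comm_monoid_add"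
  by (simp add: interv_sum_list_conv_sum_set_nat)

locale lsa_with_bimodule =
  fixes \<epsilon> :: "'g::ab_group_add \<Rightarrow> 'g \<Rightarrow> 'k::field"
    and S :: "('k, 'g, 's::ab_group_add) galgebra"
    and M :: "('k, 'g, 'm::ab_group_add, 's) gbimodule"
  assumes eps: "commutation_factor \<epsilon>"
    and lsa: "gen_lsa \<epsilon> S"
    and bimodule: "lsa_bimodule \<epsilon> S M"
begin

abbreviation \<gg> where "\<gg> \<equiv> lie_algebra_of \<epsilon> S"
abbreviation N where "N \<equiv> C1_module \<epsilon> S M"
abbreviation lie_C where "lie_C \<equiv> lie_cochains \<epsilon> \<gg> N"
abbreviation lsa_C where "lsa_C \<equiv> lsa_cochains \<epsilon> S M"

sublocale S: full_space S \<epsilon>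
  using lsa by unfold_locales (simp_all add: gen_lsa_def)

sublocale M: gr_space M
  using bimodule by unfold_locales (simp add: lsa_bimodule_def)

sublocale SM: graded_homs "vscale S" S "\<lambda>x. x" "grade S" M
  by (intro graded_homs.intro presentation_graded_space S.graded M.gr_space_axioms)

lemma carrier_M: "carrier M = UNIV"
  using bimodule by (simp add: lsa_bimodule_def)

lemma mult_linear:
  "mult S (x + x') y = mult S x y + mult S x' y" "mult S x (y + y') = mult S x y + mult S x y'"
  "mult S (vscale S c x) y = vscale S c (mult S x y)" "mult S x (vscale S c y) = vscale S c (mult S x y)"
  using lsa by (simp_all add: gen_lsa_def Vector_Spaces.linear_iff)

lemma mult_zero: "mult S 0 y = 0" "mult S x 0 = 0"
  using mult_linear(1)[of 0 0 y] mult_linear(2)[of x 0 0] by simp_all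

lemma mult_grade: "x \<in> grade S a \<Longrightarrow> y \<in> grade S b \<Longrightarrow> mult S x y \<in> grade S (a + b)"
  using lsa by (simp add: gen_lsa_def)

lemma lact_linear:
  "lact M (x + x') m = lact M x m + lact M x' m" "lact M x (m + m') = lact M x m + lact M x m'"
  "lact M (vscale S c x) m = vscale M c (lact M x m)" "lact M x (vscale M c m) = vscale M c (lact M x m)"
  using bimodule by (simp_all add: lsa_bimodule_def Vector_Spaces.linear_iff)

lemma ract_linear:
  "ract M m (x + x') = ract M m x + ract M m x'" "ract M (m + m') x = ract M m x + ract M m' x"
  "ract M m (vscale S c x) = vscale M c (ract M m x)" "ract M (vscale M c m) x = vscale M c (ract M m x)"
  using bimodule by (simp_all add: lsa_bimodule_def Vector_Spaces.linear_iff)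

lemma action_zero: "lact M 0 m = 0" "lact M x 0 = 0" "ract M 0 x = 0" "ract M m 0 = 0"
  using lact_linear(1)[of 0 0 m] lact_linear(2)[of x 0 0] ract_linear(2)[of 0 0 x] ract_linear(1)[of m 0 0]
  by simp_all

lemma action_grade:
  "x \<in> grade S a \<Longrightarrow> m \<in> grade M b \<Longrightarrow> lact M x m \<in> grade M (a + b)"
  "x \<in> grade S a \<Longrightarrow> m \<in> grade M b \<Longrightarrow> ract M m x \<in> grade M (b + a)"
  using bimodule by (simp_all add: lsa_bimodule_def)

lemma \<gg>_simps [simp]:
  "carrier \<gg> = carrier S" "vadd \<gg> = vadd S" "vscale \<gg> = vscale S" "grade \<gg> = grade S"
  by (simp_all add: lie_algebra_of_def)

lemma N_simps [simp]:
  "carrier N = carrier (graded_hom S M)" "vadd N = (+)" "vscale N = (\<lambda>c f x. vscale M c (f x))"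
  "grade N = hom_deg S M"
  by (simp_all add: C1_module_def with_action_def graded_hom_def)

lemma bracket_homog:
  assumes "x \<in> grade S a" "y \<in> grade S b"
  shows "mult \<gg> x y = mult S x y - vscale S (\<epsilon> a b) (mult S y x)"
proof -
  have "hsum S x (\<lambda>\<alpha> a. hsum S y (\<lambda>\<beta> b. vscale S (\<epsilon> \<alpha> \<beta>) (mult S b a))) =
      hsum S y (\<lambda>\<beta> b. vscale S (\<epsilon> a \<beta>) (mult S b x))"
    by (rule S.hsum_homog[OF assms(1)]) (simp add: mult_zero hsum_def)
  also have "\<dots> = vscale S (\<epsilon> a b) (mult S y x)"
    by (rule S.hsum_homog[OF assms(2)]) (simp add: mult_zero)
  finally show ?thesis
    by (simp add: lie_algebra_of_def)
qed

lemma linear_SM: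
  assumes "h \<in> hom_deg S M b"
  shows "h (x + y) = h x + h y" "h (vscale S c x) = vscale M c (h x)" "h 0 = 0"
    "x \<in> grade S a \<Longrightarrow> h x \<in> grade M (a + b)"
proof -
  show "h (x + y) = h x + h y" "h (vscale S c x) = vscale M c (h x)" for x y c
    using assms by (simp_all add: hom_deg_def S.carrier_UNIV S.vadd_eq)
  from this(1)[of 0 0] show "h 0 = 0" by simp
  show "x \<in> grade S a \<Longrightarrow> h x \<in> grade M (a + b)"
    using assms by (simp add: hom_deg_def)
qed

abbreviation act_homog :: "'g \<Rightarrow> 'g \<Rightarrow> 's \<Rightarrow> ('s \<Rightarrow> 'm) \<Rightarrow> 's \<Rightarrow> 'm" where
  "act_homog a b u h \<equiv> (\<lambda>z. lact M u (h z) - vscale M (\<epsilon> a b) (h (mult S u z))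
     + vscale M (\<epsilon> a b) (ract M (h u) z))"

lemma act_N:
  assumes u: "u \<in> grade S a" and h: "h \<in> hom_deg S M b"
  shows "act N u h = act_homog a b u h"
proof -
  have hg: "h \<in> grade (graded_hom S M) b"
    using h by (simp add: graded_hom_def)
  \<comment> \<open>Collapsing the outer extension requires the summand to vanish at u = 0. This
    rests on h 0 = 0, hence on linearity of the components of h.\<close>
  have "hsum (graded_hom S M) h (\<lambda>\<beta> h. act_homog \<alpha> \<beta> 0 h) = hsum (graded_hom S M) h (\<lambda>_ _. 0)" for \<alpha>
    by (rule SM.Hom.hsum_cong[OF SM.Hom.grade_carrier[OF hg]])
      (auto simp: graded_hom_def fun_eq_iff action_zero mult_zero linear_SM(3))
  then have "hsum S u (\<lambda>\<alpha> u. hsum (graded_hom S M) h (\<lambda>\<beta> h. act_homog \<alpha> \<beta> u h)) =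
      hsum (graded_hom S M) h (\<lambda>\<beta> h. act_homog a \<beta> u h)"
    by (intro S.hsum_homog[OF u]) (simp add: hsum_def)
  also have "\<dots> = act_homog a b u h"
    by (rule SM.Hom.hsum_homog[OF hg]) (simp add: fun_eq_iff action_zero)
  finally show ?thesis
    by (simp add: C1_module_def with_action_def)
qed

lemma act_homog_grade:
  assumes u: "u \<in> grade S a" and h: "h \<in> hom_deg S M b"
  shows "act_homog a b u h \<in> hom_deg S M (b + a)"
proof -
  have "act_homog a b u h z \<in> grade M (\<gamma> + (b + a))" if z: "z \<in> grade S \<gamma>" for z \<gamma>
  proof -
    have "lact M u (h z) \<in> grade M (a + (\<gamma> + b))" "h (mult S u z) \<in> grade M (a + \<gamma> + b)"
      "ract M (h u) z \<in> grade M (a + b + \<gamma>)"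
      by (intro action_grade linear_SM(4)[OF h] mult_grade u z)+
    then have "lact M u (h z) \<in> grade M (\<gamma> + (b + a))" "h (mult S u z) \<in> grade M (\<gamma> + (b + a))"
      "ract M (h u) z \<in> grade M (\<gamma> + (b + a))"
      by (simp_all add: ac_simps)
    then show ?thesis
      by (intro M.subspace_add M.subspace_diff M.subspace_scale M.subspace_grade)
  qed
  then show ?thesis
    by (simp add: hom_deg_def S.carrier_UNIV carrier_M S.vadd_eq linear_SM[OF h] mult_linear lact_linear
        ract_linear M.scale_right_distrib M.scale_right_diff_distrib mult.commute)
qed

sublocale Lie: lie_module \<gg> \<epsilon> N
proof -
  have "graded_space \<gg>"
    using S.graded unfolding graded_space_def \<gg>_simps .
  then interpret g: full_space \<gg> \<epsilon>
    using S.carrier_UNIV by unfold_locales simp_all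
  have "graded_space N"
    using SM.graded_space_graded_hom unfolding graded_space_def N_simps graded_hom_sel .
  then interpret n: gr_space N
    by unfold_locales
  show "lie_module \<gg> \<epsilon> N"
  proof unfold_locales
    show "commutation_factor \<epsilon>" by (rule eps)
  next
    fix a b x y assume *: "x \<in> grade \<gg> a" "y \<in> grade \<gg> b"
    then show "mult \<gg> x y \<in> grade \<gg> (a + b)"
      using mult_grade[of x a y b] mult_grade[of y b x a]
      by (auto simp: bracket_homog add.commute[of b a] intro!: S.subspace_diff S.subspace_scale S.subspace_grade)
    show "mult \<gg> x y = vscale \<gg> (- \<epsilon> a b) (mult \<gg> y x)"
      using * commutation_factorD(1)[OF eps, of a b]
      by (simp add: bracket_homog[of x a y b] bracket_homog[of y b x a] S.scale_right_diff_distrib)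
    fix c show "mult \<gg> (vscale \<gg> c x) y = vscale \<gg> c (mult \<gg> x y)"
      using * by (simp add: bracket_homog[of _ a y b] S.subspace_scale[OF S.subspace_grade] mult_linear
          S.scale_right_diff_distrib mult.commute)
  next
    fix a b x x' y assume "x \<in> grade \<gg> a" "x' \<in> grade \<gg> a" "y \<in> grade \<gg> b"
    then show "mult \<gg> (x + x') y = mult \<gg> x y + mult \<gg> x' y"
      by (simp add: bracket_homog[of _ a y b] S.subspace_add[OF S.subspace_grade] mult_linear
          S.scale_right_distrib)
  next
    fix a b x h assume *: "x \<in> grade \<gg> a" "h \<in> grade N b"
    then show "act N x h \<in> grade N (b + a)"
      by (simp add: act_N act_homog_grade)
    fix c show "act N (vscale \<gg> c x) h = vscale N c (act N x h)"
      using * by (simp add: act_N[of _ a h b] S.subspace_scale[OF S.subspace_grade] fun_eq_iff mult_linear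
          lact_linear ract_linear linear_SM[of h b] M.scale_right_distrib M.scale_right_diff_distrib mult.commute)
    have "(\<lambda>x. vscale M c (h x)) \<in> hom_deg S M b"
      using * SM.F.subspace_scale[OF SM.subspace_hom_deg] by simp
    with * show "act N x (vscale N c h) = vscale N c (act N x h)"
      by (simp add: act_N[of x a _ b] fun_eq_iff
          lact_linear ract_linear M.scale_right_distrib M.scale_right_diff_distrib mult.commute)
  next
    fix a b x x' h assume *: "x \<in> grade \<gg> a" "x' \<in> grade \<gg> a" "h \<in> grade N b"
    then show "act N (x + x') h = act N x h + act N x' h"
      by (simp add: act_N[of _ a h b] S.subspace_add[OF S.subspace_grade] fun_eq_iff mult_linear
          lact_linear ract_linear linear_SM[of h b] M.scale_right_distrib)
  next
    fix a b x h h' assume *: "x \<in> grade \<gg> a" "h \<in> grade N b" "h' \<in> grade N b"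
    then have "h + h' \<in> hom_deg S M b"
      using SM.F.subspace_add[OF SM.subspace_hom_deg] by simp
    with * show "act N x (h + h') = act N x h + act N x h'"
      by (simp add: act_N[of x a _ b] fun_eq_iff lact_linear ract_linear M.scale_right_distrib)
  qed
qed

section \<open>Cochain spaces as curried Hom spaces\<close>

sublocale Cur: currying free_scale "ext_power \<epsilon> S i" "coset (ext_ideal \<epsilon> S)" "word_gens S i" S M for i
  by (intro currying.intro S.presentation_ext_power S.gr_space_axioms M.gr_space_axioms)

lemma ext_\<gg>: "ext_power \<epsilon> \<gg> = ext_power \<epsilon> S" "wedge \<epsilon> \<gg> = wedge \<epsilon> S"
  by (simp_all add: fun_eq_iff ext_power_def ext_ideal_def wedge_def)

text \<open>N is a record with an action field, unlike the plain Hom space. Only the fields of a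
  graded space enter Hom, so the source of \<open>\<psi>\<close> becomes a Hom space to which
  currying applies.\<close>

lemma hom_deg_N: "hom_deg A N = hom_deg A (graded_hom S M)"
  by (simp add: fun_eq_iff hom_deg_def graded_hom_def)

lemma lie_cochains_eq: "lie_C i = graded_hom (ext_power \<epsilon> S i) (graded_hom S M)"
  unfolding lie_cochains_def graded_hom_def[of "ext_power \<epsilon> S i"] ext_\<gg> graded_hom_def[of _ N] hom_deg_N
  by (simp add: graded_hom_def)

lemma lsa_cochains_eq: "lsa_C (Suc i) = graded_hom (tensor_space (ext_power \<epsilon> S i) S) M"
  by (simp add: lsa_cochains_def)

lemma lsa_cochains_simps [simp]:
  "vscale (lsa_C n) = (\<lambda>c f x. vscale M c (f x))" "vadd (lsa_C n) = (+)"
  "grade (lsa_C n) = hom_deg (tensor_space (ext_power \<epsilon> S (n - 1)) S) M"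
  by (simp_all add: lsa_cochains_def graded_hom_def)

sublocale SC: gr_space "lsa_C (Suc i)" for i
  unfolding lsa_cochains_eq by unfold_locales (rule Cur.T.graded_space_graded_hom)

lemma wedge_carrier: "length xs = i \<Longrightarrow> wedge \<epsilon> S xs \<in> carrier (ext_power \<epsilon> S i)"
proof -
  assume "length xs = i"
  then have "free_gen xs \<in> free.span {free_gen xs | xs. length xs = i \<and> set xs \<subseteq> carrier S}"
    by (intro free.span_base) (auto simp: S.carrier_UNIV)
  then show ?thesis
    unfolding wedge_def ext_power_def quotient_space_def gspace.select_convs by (rule imageI)
qed

lemma wedge_grade:
  assumes "homog_word S ws" "length ws = i"
  shows "wedge \<epsilon> S (map fst ws) \<in> grade (ext_power \<epsilon> S i) (sum_list (map snd ws))"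
  unfolding wedge_def by (rule Cur.AB.generator_grade) (use assms in \<open>auto simp: word_gens_def\<close>)

lemma wedge_tensor_eq: "length xs = i \<Longrightarrow> wedge_tensor \<epsilon> S xs y = tensor (ext_power \<epsilon> S i) S (wedge \<epsilon> S xs) y"
  by (simp add: wedge_tensor_def)

lemma lsa_cochain_eqI:
  assumes h: "h \<in> carrier (lsa_C (Suc i))" and h': "h' \<in> carrier (lsa_C (Suc i))"
    and eq: "\<And>x \<alpha>. \<forall>s\<in>{1..i+1}. x s \<in> grade S (\<alpha> s) \<Longrightarrow>
      h (wedge_tensor \<epsilon> S (map x [1..<i+1]) (x (i+1))) = h' (wedge_tensor \<epsilon> S (map x [1..<i+1]) (x (i+1)))"
  shows "h = h'"
  using assms(1,2) unfolding lsa_cochains_eq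
proof (rule Cur.tensor_eqI)
  fix \<alpha> \<beta> a y assume "a \<in> word_gens S i \<alpha>" and y: "y \<in> grade S \<beta>"
  then obtain ws where ws: "a = free_gen (map fst ws)" "length ws = i" "homog_word S ws"
    by (auto simp: word_gens_def)
  \<comment> \<open>Indices 1 to i run through the word; index i + 1 holds the tensor factor
    y.\<close>
  define w where "w s = (if s \<le> i then ws ! (s - 1) else (y, \<beta>))" for s
  have "map (\<lambda>s. fst (w s)) [1..<i+1] = map fst ws"
    by (rule nth_equalityI) (use ws(2) in \<open>auto simp: w_def simp del: upt_Suc\<close>)
  moreover have "\<forall>s\<in>{1..i+1}. fst (w s) \<in> grade S (snd (w s))"
  proof
    fix s assume s: "s \<in> {1..i+1}"
    show "fst (w s) \<in> grade S (snd (w s))"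
    proof (cases "s \<le> i")
      case True
      with s ws(2) have "ws ! (s - 1) \<in> set ws"
        by (intro nth_mem) auto
      with True ws(3) show ?thesis
        by (auto simp: w_def homog_word_def list_all_iff)
    qed (simp add: w_def y)
  qed
  ultimately have "h (wedge_tensor \<epsilon> S (map fst ws) y) = h' (wedge_tensor \<epsilon> S (map fst ws) y)"
    using eq[of "\<lambda>s. fst (w s)" "\<lambda>s. snd (w s)"] by (simp add: w_def)
  then show "h (tensor (ext_power \<epsilon> S i) S (coset (ext_ideal \<epsilon> S) a) y) =
      h' (tensor (ext_power \<epsilon> S i) S (coset (ext_ideal \<epsilon> S) a) y)"
    using ws by (simp add: wedge_tensor_eq wedge_def)
qed

text \<open>The specification on homogeneous arguments determines a cochain, so any element that
  meets it is the described one. The element h will be an image under \<open>\<psi>\<close>.\<close>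

lemma the_lsa_cochain:
  assumes "h \<in> carrier (lsa_C (Suc i))"
    and "\<And>x \<alpha>. \<forall>s\<in>{1..i+1}. x s \<in> grade S (\<alpha> s) \<Longrightarrow>
      h (wedge_tensor \<epsilon> S (map x [1..<i+1]) (x (i+1))) = R x \<alpha>"
  shows "(THE h. h \<in> carrier (lsa_C (i + 1)) \<and> (\<forall>x \<alpha>. (\<forall>s\<in>{1..i+1}. x s \<in> grade S (\<alpha> s)) \<longrightarrow>
      h (wedge_tensor \<epsilon> S (map x [1..<i+1]) (x (i+1))) = R x \<alpha>)) = h"
proof (rule the_equality)
  show "h \<in> carrier (lsa_C (i + 1)) \<and> (\<forall>x \<alpha>. (\<forall>s\<in>{1..i+1}. x s \<in> grade S (\<alpha> s)) \<longrightarrow>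
      h (wedge_tensor \<epsilon> S (map x [1..<i+1]) (x (i+1))) = R x \<alpha>)"
    using assms by (simp del: upt_Suc)
next
  fix h' assume *: "h' \<in> carrier (lsa_C (i + 1)) \<and> (\<forall>x \<alpha>. (\<forall>s\<in>{1..i+1}. x s \<in> grade S (\<alpha> s)) \<longrightarrow>
      h' (wedge_tensor \<epsilon> S (map x [1..<i+1]) (x (i+1))) = R x \<alpha>)"
  show "h' = h"
  proof (rule lsa_cochain_eqI[OF _ assms(1)])
    show "h' \<in> carrier (lsa_C (Suc i))"
      using * by simp
    fix x \<alpha> assume x: "\<forall>s\<in>{1..i+1}. x s \<in> grade S (\<alpha> s)"
    show "h' (wedge_tensor \<epsilon> S (map x [1..<i+1]) (x (i+1))) = h (wedge_tensor \<epsilon> S (map x [1..<i+1]) (x (i+1)))"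
      unfolding assms(2)[OF x] using * x by blast
  qed
qed


section \<open>The isomorphism\<close>

text \<open>The second part evaluates at an arbitrary X of the exterior power, whereas the
  definition prescribes values at wedges only.\<close>

lemma \<psi>:
  assumes f: "f \<in> carrier (lie_C i)"
  shows "\<psi> \<epsilon> S M i f \<in> carrier (lsa_C (Suc i))"
    and "X \<in> carrier (ext_power \<epsilon> S i) \<Longrightarrow> \<psi> \<epsilon> S M i f (tensor (ext_power \<epsilon> S i) S X y) = f X y"
proof -
  obtain h where h: "h \<in> carrier (graded_hom (tensor_space (ext_power \<epsilon> S i) S) M)" "Cur.curried i f h"
    using Cur.curried_uncurry_exists f unfolding lie_cochains_eq by blast
  have h_wedge: "h (wedge_tensor \<epsilon> S xs y) = f (wedge \<epsilon> S xs) y" if "length xs = i" for xs y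
    using h(2) wedge_carrier[OF that] that by (simp add: wedge_tensor_eq S.carrier_UNIV)
  have "\<psi> \<epsilon> S M i f = h"
    unfolding \<psi>_def
  proof (rule the_equality)
    show "h \<in> carrier (lsa_C (i + 1)) \<and>
        (\<forall>xs y. length xs = i \<longrightarrow> h (wedge_tensor \<epsilon> S xs y) = f (wedge \<epsilon> S xs) y)"
      using h(1) h_wedge by (simp add: lsa_cochains_eq)
    fix h' assume *: "h' \<in> carrier (lsa_C (i + 1)) \<and>
        (\<forall>xs y. length xs = i \<longrightarrow> h' (wedge_tensor \<epsilon> S xs y) = f (wedge \<epsilon> S xs) y)"
    show "h' = h"
    proof (rule lsa_cochain_eqI)
      show "h' \<in> carrier (lsa_C (Suc i))" "h \<in> carrier (lsa_C (Suc i))"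
        using * h(1) by (simp_all add: lsa_cochains_eq)
      fix x :: "nat \<Rightarrow> 's"
      have len: "length (map x [1..<i+1]) = i" by simp
      then show "h' (wedge_tensor \<epsilon> S (map x [1..<i+1]) (x (i+1))) = h (wedge_tensor \<epsilon> S (map x [1..<i+1]) (x (i+1)))"
        unfolding h_wedge[OF len] using * by blast
    qed
  qed
  with h show "\<psi> \<epsilon> S M i f \<in> carrier (lsa_C (Suc i))"
    "X \<in> carrier (ext_power \<epsilon> S i) \<Longrightarrow> \<psi> \<epsilon> S M i f (tensor (ext_power \<epsilon> S i) S X y) = f X y"
    by (simp_all add: lsa_cochains_eq S.carrier_UNIV)
qed

lemma \<psi>_wedge:
  assumes "f \<in> carrier (lie_C i)" "length xs = i"
  shows "\<psi> \<epsilon> S M i f (wedge_tensor \<epsilon> S xs y) = f (wedge \<epsilon> S xs) y"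
  using \<psi>(2)[OF assms(1) wedge_carrier[OF assms(2)]] assms(2) by (simp add: wedge_tensor_eq)

text \<open>Reduces identities for \<open>\<psi>\<close> to pointwise identities of curried maps;
  linearity, degrees and surjectivity are obtained this way.\<close>

lemma \<psi>_eqI:
  assumes "f \<in> carrier (lie_C i)" "h \<in> carrier (lsa_C (Suc i))" "Cur.curried i f h"
  shows "\<psi> \<epsilon> S M i f = h"
  using \<psi>[OF assms(1)] assms(2,3) unfolding lsa_cochains_eq by (intro Cur.curried_unique) simp_all

lemma \<psi>_add:
  assumes "f \<in> carrier (lie_C i)" "g \<in> carrier (lie_C i)"
  shows "\<psi> \<epsilon> S M i (f + g) = \<psi> \<epsilon> S M i f + \<psi> \<epsilon> S M i g"
  using assms Lie.C.subspace_add[OF Lie.C.subspace_carrier] SC.subspace_add[OF SC.subspace_carrier]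
  by (intro \<psi>_eqI) (simp_all add: \<psi>)

lemma \<psi>_scale:
  assumes "f \<in> carrier (lie_C i)"
  shows "\<psi> \<epsilon> S M i (\<lambda>x y. vscale M c (f x y)) = (\<lambda>x. vscale M c (\<psi> \<epsilon> S M i f x))"
  using Lie.C.subspace_scale[OF Lie.C.subspace_carrier assms, of c]
    SC.subspace_scale[OF SC.subspace_carrier \<psi>(1)[OF assms], of c]
  by (intro \<psi>_eqI) (simp_all add: \<psi>[OF assms])

lemma \<psi>_zero: "\<psi> \<epsilon> S M i 0 = 0"
  using \<psi>_add[of 0 i 0] Lie.C.subspace_0[OF Lie.C.subspace_carrier] by simp

lemma \<psi>_sum:
  assumes "\<And>j. j \<in> J \<Longrightarrow> f j \<in> carrier (lie_C i)"
  shows "\<psi> \<epsilon> S M i (sum f J) = (\<Sum>j\<in>J. \<psi> \<epsilon> S M i (f j))"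
  using assms
proof (induction J rule: infinite_finite_induct)
  case (insert j J)
  have "\<psi> \<epsilon> S M i (f j + sum f J) = \<psi> \<epsilon> S M i (f j) + \<psi> \<epsilon> S M i (sum f J)"
    using insert.prems by (intro \<psi>_add Lie.C.subspace_sum[OF Lie.C.subspace_carrier]) simp_all
  moreover have "\<psi> \<epsilon> S M i (sum f J) = (\<Sum>j\<in>J. \<psi> \<epsilon> S M i (f j))"
    using insert.prems by (intro insert.IH) simp
  ultimately show ?case
    unfolding sum.insert[OF insert.hyps] by (rule trans[OF _ arg_cong])
qed (simp_all add: \<psi>_zero)

lemma \<psi>_hom_deg:
  assumes "f \<in> hom_deg (ext_power \<epsilon> S i) N \<beta>"
  shows "\<psi> \<epsilon> S M i f \<in> hom_deg (tensor_space (ext_power \<epsilon> S i) S) M \<beta>"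
proof -
  obtain h where h: "h \<in> hom_deg (tensor_space (ext_power \<epsilon> S i) S) M \<beta>" "Cur.curried i f h"
    using Cur.uncurry_exists[of f i \<beta>] assms unfolding hom_deg_N by blast
  have "f \<in> carrier (lie_C i)"
    using Lie.hom_deg_cochain assms unfolding ext_\<gg> by blast
  moreover have "h \<in> carrier (lsa_C (Suc i))"
    using h(1) by (intro SC.grade_carrier) simp
  ultimately have "\<psi> \<epsilon> S M i f = h"
    using h(2) by (rule \<psi>_eqI)
  with h show ?thesis by simp
qed

lemma \<psi>_grade: "\<psi> \<epsilon> S M i ` hom_deg (ext_power \<epsilon> S i) N \<beta> = hom_deg (tensor_space (ext_power \<epsilon> S i) S) M \<beta>"
proof (intro equalityI subsetI)
  fix h assume h: "h \<in> hom_deg (tensor_space (ext_power \<epsilon> S i) S) M \<beta>"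
  then obtain f where f: "f \<in> hom_deg (ext_power \<epsilon> S i) N \<beta>" "Cur.curried i f h"
    using Cur.curry_exists[of h i \<beta>] unfolding hom_deg_N by metis
  have "f \<in> carrier (lie_C i)"
    using Lie.hom_deg_cochain f(1) unfolding ext_\<gg> by blast
  moreover have "h \<in> carrier (lsa_C (Suc i))"
    using h by (intro SC.grade_carrier) simp
  ultimately have "\<psi> \<epsilon> S M i f = h"
    using f(2) by (rule \<psi>_eqI)
  with f(1) show "h \<in> \<psi> \<epsilon> S M i ` hom_deg (ext_power \<epsilon> S i) N \<beta>"
    by blast
qed (use \<psi>_hom_deg in blast)

lemma \<psi>_bij: "bij_betw (\<psi> \<epsilon> S M i) (carrier (lie_C i)) (carrier (lsa_C (Suc i)))"
  unfolding bij_betw_def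
proof
  show "inj_on (\<psi> \<epsilon> S M i) (carrier (lie_C i))"
  proof (rule inj_onI)
    fix f g assume f: "f \<in> carrier (lie_C i)" and g: "g \<in> carrier (lie_C i)"
      and eq: "\<psi> \<epsilon> S M i f = \<psi> \<epsilon> S M i g"
    have "Cur.curried i f (\<psi> \<epsilon> S M i f)" "Cur.curried i g (\<psi> \<epsilon> S M i f)"
      using \<psi>(2)[OF f] \<psi>(2)[OF g] eq by simp_all
    with f g show "f = g"
      unfolding lie_cochains_eq by (rule Cur.curried_inj)
  qed
  show "\<psi> \<epsilon> S M i ` carrier (lie_C i) = carrier (lsa_C (Suc i))"
  proof (intro equalityI subsetI)
    fix h assume h: "h \<in> carrier (lsa_C (Suc i))"
    then obtain f where f: "f \<in> carrier (lie_C i)" "Cur.curried i f h"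
      using Cur.curried_curry_exists unfolding lie_cochains_eq lsa_cochains_eq by metis
    with \<psi>_eqI[OF f(1) h f(2)] show "h \<in> \<psi> \<epsilon> S M i ` carrier (lie_C i)"
      by blast
  qed (use \<psi>(1) in blast)
qed

lemma linear_iso_\<psi>: "linear_iso (lie_C i) (lsa_C (Suc i)) (\<psi> \<epsilon> S M i)"
  using \<psi>_bij \<psi>_add \<psi>_scale Lie.C.vadd_eq by (auto simp: linear_iso_def)

text \<open>The coefficients in the action on Hom(S, M) depend on the degree of the map acted on;
  this supplies that degree for a value of f.\<close>

lemma value_hom_deg:
  assumes "f \<in> hom_deg (ext_power \<epsilon> S i) N \<beta>" "length js = i" "\<forall>s\<in>set js. x s \<in> grade S (\<alpha> s)"
  shows "f (wedge \<epsilon> S (map x js)) \<in> hom_deg S M (sum_list (map \<alpha> js) + \<beta>)"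
proof -
  have "wedge \<epsilon> S (map fst (map (\<lambda>s. (x s, \<alpha> s)) js)) \<in> grade (ext_power \<epsilon> S i)
      (sum_list (map snd (map (\<lambda>s. (x s, \<alpha> s)) js)))"
    using assms by (intro wedge_grade) (auto simp: homog_word_def list_all_iff)
  then have "wedge \<epsilon> S (map x js) \<in> grade (ext_power \<epsilon> S i) (sum_list (map \<alpha> js))"
    by (simp add: comp_def)
  with assms(1) show ?thesis
    by (simp add: hom_deg_def[of "ext_power \<epsilon> S i"])
qed

section \<open>Transport of the action and the coboundary\<close>

lemma \<rho>_hom_\<psi>:
  assumes u: "u \<in> grade S a" and f: "f \<in> hom_deg (ext_power \<epsilon> S i) N \<beta>"
  shows "\<rho>_hom \<epsilon> S M i a u \<beta> (\<psi> \<epsilon> S M i f) = \<psi> \<epsilon> S M i (\<xi>_hom \<epsilon> \<gg> N i a u \<beta> f)"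
proof -
  have fC: "f \<in> carrier (lie_C i)"
    using f Lie.hom_deg_cochain unfolding ext_\<gg> by blast
  have xi: "\<xi>_hom \<epsilon> \<gg> N i a u \<beta> f \<in> carrier (lie_C i)"
    by (rule Lie.hom_deg_cochain[OF Lie.\<xi>_hom(1)]) (use u f in \<open>simp_all add: ext_\<gg>\<close>)
  show ?thesis
    unfolding \<rho>_hom_def
  proof (rule the_lsa_cochain[OF \<psi>(1)[OF xi]])
    fix x \<alpha> assume x: "\<forall>s\<in>{1..i+1}. x s \<in> grade S (\<alpha> s)"
    let ?X = "wedge \<epsilon> S (map x [1..<i+1])" and ?z = "x (i+1)"
    have "f ?X \<in> hom_deg S M ((\<Sum>s\<in>{1..<i+1}. \<alpha> s) + \<beta>)"
      using value_hom_deg[OF f, of "[1..<i+1]" x \<alpha>] x unfolding sum_list_upt by (simp del: upt_Suc sum.op_ivl_Suc)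
    \<comment> \<open>The degree of the value is exactly the second entry of
      \<open>\<epsilon>\<close> in the two middle terms of the formula for
      \<open>\<rho>\<close>.\<close>
    then have act: "act N u (f ?X) = act_homog a (\<beta> + (\<Sum>s\<in>{1..i}. \<alpha> s)) u (f ?X)"
      using act_N[OF u] by (simp add: atLeastLessThanSuc_atLeastAtMost add.commute del: upt_Suc)
    have "\<psi> \<epsilon> S M i (\<xi>_hom \<epsilon> \<gg> N i a u \<beta> f) (wedge_tensor \<epsilon> S (map x [1..<i+1]) ?z) =
        \<xi>_hom \<epsilon> \<gg> N i a u \<beta> f ?X ?z"
      by (rule \<psi>_wedge[OF xi]) simp
    also have "\<xi>_hom \<epsilon> \<gg> N i a u \<beta> f ?X = act N u (f ?X)
        - (\<Sum>j\<in>{1..i}. vscale N (\<epsilon> a (\<beta> + (\<Sum>s\<in>{1..<j}. \<alpha> s)))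
            (f (wedge \<epsilon> S (map x [1..<j] @ [mult \<gg> u (x j)] @ map x [Suc j..<Suc i]))))"
      using Lie.\<xi>_hom_index[of u a f i \<beta> x \<alpha>] u f x by (simp add: ext_\<gg> del: upt_Suc)
    also have "\<dots> ?z = act_homog a (\<beta> + (\<Sum>s\<in>{1..i}. \<alpha> s)) u (f ?X) ?z
        - (\<Sum>j\<in>{1..i}. vscale M (\<epsilon> a (\<beta> + (\<Sum>s\<in>{1..<j}. \<alpha> s)))
            (f (wedge \<epsilon> S (map x [1..<j] @ [mult \<gg> u (x j)] @ map x [Suc j..<Suc i])) ?z))"
      unfolding act by (simp add: sum_apply del: upt_Suc)
    finally show "\<psi> \<epsilon> S M i (\<xi>_hom \<epsilon> \<gg> N i a u \<beta> f) (wedge_tensor \<epsilon> S (map x [1..<i+1]) ?z) =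
        lact M u (\<psi> \<epsilon> S M i f (wedge_tensor \<epsilon> S (map x [1..<i+1]) (x (i+1))))
          - vscale M (\<epsilon> a (\<beta> + (\<Sum>s\<in>{1..i}. \<alpha> s)))
              (\<psi> \<epsilon> S M i f (wedge_tensor \<epsilon> S (map x [1..<i+1]) (mult S u (x (i+1)))))
          + vscale M (\<epsilon> a (\<beta> + (\<Sum>s\<in>{1..i}. \<alpha> s)))
              (ract M (\<psi> \<epsilon> S M i f (wedge_tensor \<epsilon> S (map x [1..<i+1]) u)) (x (i+1)))
          - (\<Sum>s\<in>{1..i}. vscale M (\<epsilon> a (\<beta> + (\<Sum>r\<in>{1..<s}. \<alpha> r)))
              (\<psi> \<epsilon> S M i f (wedge_tensor \<epsilon> S
                 (map x [1..<s] @ [mult (lie_algebra_of \<epsilon> S) u (x s)] @ map x [Suc s..<i+1])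
                 (x (i+1)))))"
      by (simp add: \<psi>_wedge[OF fC] del: upt_Suc)
  qed
qed

lemma lsa_d_hom_\<psi>:
  assumes f: "f \<in> hom_deg (ext_power \<epsilon> S i) N \<beta>"
  shows "lsa_d_hom \<epsilon> S M (Suc i) \<beta> (\<psi> \<epsilon> S M i f) = \<psi> \<epsilon> S M (Suc i) (lie_d_hom \<epsilon> \<gg> N i \<beta> f)"
proof -
  have fC: "f \<in> carrier (lie_C i)"
    using f Lie.hom_deg_cochain unfolding ext_\<gg> by blast
  have df: "lie_d_hom \<epsilon> \<gg> N i \<beta> f \<in> carrier (lie_C (Suc i))"
    by (rule Lie.hom_deg_cochain[OF Lie.lie_d_hom(1)]) (use f in \<open>simp add: ext_\<gg>\<close>)
  show ?thesis
    unfolding lsa_d_hom_def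
  proof (rule the_lsa_cochain[OF \<psi>(1)[OF df]])
    fix x \<alpha> assume x: "\<forall>s\<in>{1..Suc i+1}. x s \<in> grade S (\<alpha> s)"
    \<comment> \<open>Only the arguments 1 to i + 1 enter the Lie side; the last one, with index i +
      2, is the tensor factor at which the value is evaluated.\<close>
    let ?z = "x (Suc i+1)"
    let ?X = "\<lambda>t. wedge \<epsilon> S (map x ([1..<t] @ [Suc t..<i+2]))"
    let ?Y = "\<lambda>t j. wedge \<epsilon> S (map x ([1..<t] @ [Suc t..<j]) @ [mult \<gg> (x t) (x j)] @ map x [Suc j..<i+2])"
    let ?P = "\<lambda>t. \<Sum>s\<in>{1..<t}. \<alpha> s" and ?Q = "\<lambda>t. \<Sum>s\<in>{Suc t..Suc i}. \<alpha> s"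
    \<comment> \<open>The map acted on has degree \<beta> plus all degrees except the t-th. The
      prefactor is kept in the left action term and simplifies in the other two, which carry a
      coefficient of their own.\<close>
    have act: "vscale M ((-1) ^ t * \<epsilon> (\<beta> + ?P t) (\<alpha> t)) (act N (x t) (f (?X t)) ?z) =
        vscale M ((-1) ^ t * \<epsilon> (\<beta> + ?P t) (\<alpha> t)) (lact M (x t) (f (?X t) ?z))
        - vscale M ((-1) ^ t * \<epsilon> (\<alpha> t) (?Q t)) (f (?X t) (mult S (x t) ?z))
        + vscale M ((-1) ^ t * \<epsilon> (\<alpha> t) (?Q t)) (ract M (f (?X t) (x t)) ?z)" if t: "t \<in> {1..i+1}" for t
    proof -
      have "f (?X t) \<in> hom_deg S M (sum_list (map \<alpha> ([1..<t] @ [Suc t..<i+2])) + \<beta>)"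
        using x t by (intro value_hom_deg[OF f]) (auto simp del: upt_Suc)
      moreover have "sum_list (map \<alpha> ([1..<t] @ [Suc t..<i+2])) + \<beta> = \<beta> + ?P t + ?Q t"
        by (simp add: sum_list_upt atLeastLessThanSuc_atLeastAtMost ac_simps del: upt_Suc sum.op_ivl_Suc)
      ultimately have deg: "f (?X t) \<in> hom_deg S M (\<beta> + ?P t + ?Q t)"
        by (simp only:)
      have "act N (x t) (f (?X t)) = act_homog (\<alpha> t) (\<beta> + ?P t + ?Q t) (x t) (f (?X t))"
        using x t by (intro act_N[OF _ deg]) auto
      moreover have "\<epsilon> P (\<alpha> t) * \<epsilon> (\<alpha> t) (P + Q) = \<epsilon> (\<alpha> t) Q" for P Q
        using commutation_factorD(1)[OF eps, of P "\<alpha> t"]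
        by (simp add: commutation_factorD(2)[OF eps, of _ P] mult.assoc[symmetric])
      ultimately show ?thesis
        by (simp add: M.scale_right_distrib M.scale_right_diff_distrib mult.assoc
            del: upt_Suc map_append sum.op_ivl_Suc sum.cl_ivl_Suc add_2_eq_Suc')
    qed
    have "\<psi> \<epsilon> S M (Suc i) (lie_d_hom \<epsilon> \<gg> N i \<beta> f) (wedge_tensor \<epsilon> S (map x [1..<Suc i+1]) ?z) =
        lie_d_hom \<epsilon> \<gg> N i \<beta> f (wedge \<epsilon> S (map x [1..<Suc i+1])) ?z"
      by (rule \<psi>_wedge[OF df]) simp
    also have "lie_d_hom \<epsilon> \<gg> N i \<beta> f (wedge \<epsilon> S (map x [1..<Suc i+1])) =
        - (\<Sum>t\<in>{1..i+1}. vscale N ((-1) ^ t * \<epsilon> (\<beta> + ?P t) (\<alpha> t)) (act N (x t) (f (?X t))))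
        + (\<Sum>j\<in>{1..i+1}. \<Sum>t\<in>{1..<j}. vscale N ((-1) ^ t * \<epsilon> (\<alpha> t) (\<Sum>s\<in>{Suc t..<j}. \<alpha> s)) (f (?Y t j)))"
      using Lie.lie_d_hom_index[of f i \<beta> x \<alpha>] f x by (simp add: ext_\<gg> del: upt_Suc sum.op_ivl_Suc sum.cl_ivl_Suc)
    also have "\<dots> ?z =
        - (\<Sum>t\<in>{1..i+1}. vscale M ((-1) ^ t * \<epsilon> (\<beta> + ?P t) (\<alpha> t)) (act N (x t) (f (?X t)) ?z))
        + (\<Sum>j\<in>{1..i+1}. \<Sum>t\<in>{1..<j}. vscale M ((-1) ^ t * \<epsilon> (\<alpha> t) (\<Sum>s\<in>{Suc t..<j}. \<alpha> s)) (f (?Y t j) ?z))"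
      by (simp add: sum_apply del: upt_Suc sum.op_ivl_Suc sum.cl_ivl_Suc)
    also have "(\<Sum>t\<in>{1..i+1}. vscale M ((-1) ^ t * \<epsilon> (\<beta> + ?P t) (\<alpha> t)) (act N (x t) (f (?X t)) ?z)) =
        (\<Sum>t\<in>{1..i+1}. vscale M ((-1) ^ t * \<epsilon> (\<beta> + ?P t) (\<alpha> t)) (lact M (x t) (f (?X t) ?z)))
        - (\<Sum>t\<in>{1..i+1}. vscale M ((-1) ^ t * \<epsilon> (\<alpha> t) (?Q t)) (f (?X t) (mult S (x t) ?z)))
        + (\<Sum>t\<in>{1..i+1}. vscale M ((-1) ^ t * \<epsilon> (\<alpha> t) (?Q t)) (ract M (f (?X t) (x t)) ?z))"
      unfolding sum.distrib[symmetric] sum_subtractf[symmetric] by (rule sum.cong[OF refl act])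
    finally have main: "\<psi> \<epsilon> S M (Suc i) (lie_d_hom \<epsilon> \<gg> N i \<beta> f) (wedge_tensor \<epsilon> S (map x [1..<Suc i+1]) ?z) =
        - ((\<Sum>t\<in>{1..i+1}. vscale M ((-1) ^ t * \<epsilon> (\<beta> + ?P t) (\<alpha> t)) (lact M (x t) (f (?X t) ?z)))
        - (\<Sum>t\<in>{1..i+1}. vscale M ((-1) ^ t * \<epsilon> (\<alpha> t) (?Q t)) (f (?X t) (mult S (x t) ?z)))
        + (\<Sum>t\<in>{1..i+1}. vscale M ((-1) ^ t * \<epsilon> (\<alpha> t) (?Q t)) (ract M (f (?X t) (x t)) ?z)))
        + (\<Sum>j\<in>{1..i+1}. \<Sum>t\<in>{1..<j}. vscale M ((-1) ^ t * \<epsilon> (\<alpha> t) (\<Sum>s\<in>{Suc t..<j}. \<alpha> s)) (f (?Y t j) ?z))" .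
    \<comment> \<open>Omitting one of i + 1 letters leaves i, and so does merging the t-th letter
      into slot j; this is the length at which \<open>\<psi>_wedge\<close> applies.\<close>
    have X: "\<psi> \<epsilon> S M i f (wedge_tensor \<epsilon> S (map x ([1..<t] @ [Suc t..<Suc i+1])) y) = f (?X t) y"
      if "t \<in> {1..Suc i}" for t y
      using that by (subst \<psi>_wedge[OF fC]) (auto simp del: upt_Suc)
    have Y: "\<psi> \<epsilon> S M i f (wedge_tensor \<epsilon> S (map x ([1..<t] @ [Suc t..<j]) @ [mult \<gg> (x t) (x j)] @
        map x [Suc j..<Suc i+1]) y) = f (?Y t j) y"
      if "j \<in> {1..Suc i}" "t \<in> {1..<j}" for t j y
      using that by (subst \<psi>_wedge[OF fC]) (auto simp del: upt_Suc)
    have s1: "(\<Sum>t\<in>{1..Suc i}. vscale M ((-1) ^ t * \<epsilon> (\<beta> + (\<Sum>s\<in>{1..<t}. \<alpha> s)) (\<alpha> t))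
           (lact M (x t)
              (\<psi> \<epsilon> S M i f (wedge_tensor \<epsilon> S (map x ([1..<t] @ [Suc t..<Suc i+1])) (x (Suc i+1)))))) =
        (\<Sum>t\<in>{1..i+1}. vscale M ((-1) ^ t * \<epsilon> (\<beta> + ?P t) (\<alpha> t)) (lact M (x t) (f (?X t) ?z)))"
      unfolding Suc_eq_plus1[of i, symmetric] by (intro sum.cong refl) (simp only: X)
    have s2: "(\<Sum>t\<in>{1..Suc i}. vscale M ((-1) ^ t * \<epsilon> (\<alpha> t) (\<Sum>s\<in>{Suc t..Suc i}. \<alpha> s))
           (\<psi> \<epsilon> S M i f (wedge_tensor \<epsilon> S (map x ([1..<t] @ [Suc t..<Suc i+1])) (mult S (x t) (x (Suc i+1)))))) =
        (\<Sum>t\<in>{1..i+1}. vscale M ((-1) ^ t * \<epsilon> (\<alpha> t) (?Q t)) (f (?X t) (mult S (x t) ?z)))"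
      unfolding Suc_eq_plus1[of i, symmetric] by (intro sum.cong refl) (simp only: X)
    have s3: "(\<Sum>t\<in>{1..Suc i}. vscale M ((-1) ^ t * \<epsilon> (\<alpha> t) (\<Sum>s\<in>{Suc t..Suc i}. \<alpha> s))
           (ract M (\<psi> \<epsilon> S M i f (wedge_tensor \<epsilon> S (map x ([1..<t] @ [Suc t..<Suc i+1])) (x t))) (x (Suc i+1)))) =
        (\<Sum>t\<in>{1..i+1}. vscale M ((-1) ^ t * \<epsilon> (\<alpha> t) (?Q t)) (ract M (f (?X t) (x t)) ?z))"
      unfolding Suc_eq_plus1[of i, symmetric] by (intro sum.cong refl) (simp only: X)
    have s4: "(\<Sum>j\<in>{1..Suc i}. \<Sum>t\<in>{1..<j}. vscale M ((-1) ^ t * \<epsilon> (\<alpha> t) (\<Sum>s\<in>{Suc t..<j}. \<alpha> s))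
           (\<psi> \<epsilon> S M i f (wedge_tensor \<epsilon> S
              (map x ([1..<t] @ [Suc t..<j]) @ [mult (lie_algebra_of \<epsilon> S) (x t) (x j)] @
                 map x [Suc j..<Suc i+1])
              (x (Suc i+1))))) =
        (\<Sum>j\<in>{1..i+1}. \<Sum>t\<in>{1..<j}. vscale M ((-1) ^ t * \<epsilon> (\<alpha> t) (\<Sum>s\<in>{Suc t..<j}. \<alpha> s)) (f (?Y t j) ?z))"
      unfolding Suc_eq_plus1[of i, symmetric] by (intro sum.cong refl) (simp only: Y)
    show "\<psi> \<epsilon> S M (Suc i) (lie_d_hom \<epsilon> \<gg> N i \<beta> f) (wedge_tensor \<epsilon> S (map x [1..<Suc i+1]) ?z) =
      - (\<Sum>t\<in>{1..Suc i}. vscale M ((-1) ^ t * \<epsilon> (\<beta> + (\<Sum>s\<in>{1..<t}. \<alpha> s)) (\<alpha> t))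
           (lact M (x t)
              (\<psi> \<epsilon> S M i f (wedge_tensor \<epsilon> S (map x ([1..<t] @ [Suc t..<Suc i+1])) (x (Suc i+1))))))
      + (\<Sum>t\<in>{1..Suc i}. vscale M ((-1) ^ t * \<epsilon> (\<alpha> t) (\<Sum>s\<in>{Suc t..Suc i}. \<alpha> s))
           (\<psi> \<epsilon> S M i f (wedge_tensor \<epsilon> S (map x ([1..<t] @ [Suc t..<Suc i+1])) (mult S (x t) (x (Suc i+1))))))
      - (\<Sum>t\<in>{1..Suc i}. vscale M ((-1) ^ t * \<epsilon> (\<alpha> t) (\<Sum>s\<in>{Suc t..Suc i}. \<alpha> s))
           (ract M (\<psi> \<epsilon> S M i f (wedge_tensor \<epsilon> S (map x ([1..<t] @ [Suc t..<Suc i+1])) (x t))) (x (Suc i+1))))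
      + (\<Sum>j\<in>{1..Suc i}. \<Sum>t\<in>{1..<j}. vscale M ((-1) ^ t * \<epsilon> (\<alpha> t) (\<Sum>s\<in>{Suc t..<j}. \<alpha> s))
           (\<psi> \<epsilon> S M i f (wedge_tensor \<epsilon> S
              (map x ([1..<t] @ [Suc t..<j]) @ [mult (lie_algebra_of \<epsilon> S) (x t) (x j)] @
                 map x [Suc j..<Suc i+1])
              (x (Suc i+1)))))"
      unfolding main s1 s2 s3 s4 by (simp only: minus_add_distrib minus_diff_eq) (simp only: diff_conv_add_uminus ac_simps)
  qed
qed

text \<open>Since \<open>\<psi>\<close> preserves degrees, it sends the homogeneous components of f
  to those of its image. An identity between operators on homogeneous cochains therefore passes to
  their additive extensions.\<close>

lemma hsum_\<psi>:
  fixes G :: "'g \<Rightarrow> ((('s list \<Rightarrow>\<^sub>0 'k) set \<times> 's \<Rightarrow>\<^sub>0 'k) set \<Rightarrow> 'm) \<Rightarrow> (('s list \<Rightarrow>\<^sub>0 'k) set \<times> 's \<Rightarrow>\<^sub>0 'k) set \<Rightarrow> 'm"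
  assumes f: "f \<in> carrier (lie_C i)"
    and F: "\<And>\<beta> h. h \<in> hom_deg (ext_power \<epsilon> S i) N \<beta> \<Longrightarrow> F \<beta> h \<in> carrier (lie_C j)"
    and F0: "\<And>\<beta>. F \<beta> 0 = 0"
    and G: "\<And>\<beta> h. h \<in> hom_deg (ext_power \<epsilon> S i) N \<beta> \<Longrightarrow> G \<beta> (\<psi> \<epsilon> S M i h) = \<psi> \<epsilon> S M j (F \<beta> h)"
  shows "hsum (lsa_C (Suc i)) (\<psi> \<epsilon> S M i f) G = \<psi> \<epsilon> S M j (hsum (lie_C i) f F)"
proof -
  obtain A c where *: "finite A" "\<And>\<gamma>. c \<gamma> \<in> grade (lie_C i) \<gamma>"
    "\<And>\<gamma>. \<gamma> \<notin> A \<Longrightarrow> c \<gamma> = 0" "f = sum c A"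
    using Lie.C.decomposition_exists[OF f] by blast
  have c: "c \<gamma> \<in> hom_deg (ext_power \<epsilon> S i) N \<gamma>" for \<gamma>
    using *(2)[of \<gamma>] by (simp add: ext_\<gg>)
  have cC: "c \<gamma> \<in> carrier (lie_C i)" for \<gamma>
    using *(2) Lie.C.grade_carrier by blast
  have "0 \<in> hom_deg (ext_power \<epsilon> S i) N \<gamma>" for \<gamma>
    using Lie.E.F.subspace_0[OF Lie.E.subspace_hom_deg, of i \<gamma>] by (simp add: ext_\<gg>)
  then have G0: "G \<gamma> 0 = 0" for \<gamma>
    using G[of 0 \<gamma>] by (simp add: F0 \<psi>_zero)
  have "\<psi> \<epsilon> S M i f = (\<Sum>\<gamma>\<in>A. \<psi> \<epsilon> S M i (c \<gamma>))"
    unfolding *(4) by (rule \<psi>_sum) (rule cC)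
  then have "hsum (lsa_C (Suc i)) (\<psi> \<epsilon> S M i f) G = (\<Sum>\<gamma>\<in>A. G \<gamma> (\<psi> \<epsilon> S M i (c \<gamma>)))"
    using SC.hsum_sum[of A "\<lambda>\<gamma>. \<psi> \<epsilon> S M i (c \<gamma>)" i G] *(1,3) \<psi>_hom_deg[OF c] G0 \<psi>_zero by simp
  also have "\<dots> = (\<Sum>\<gamma>\<in>A. \<psi> \<epsilon> S M j (F \<gamma> (c \<gamma>)))"
    by (simp add: G c)
  also have "\<dots> = \<psi> \<epsilon> S M j (\<Sum>\<gamma>\<in>A. F \<gamma> (c \<gamma>))"
    by (rule \<psi>_sum[symmetric]) (rule F[OF c])
  also have "(\<Sum>\<gamma>\<in>A. F \<gamma> (c \<gamma>)) = hsum (lie_C i) f F"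
    unfolding *(4) by (rule Lie.C.hsum_sum[of A c i F, OF *(1-3) F0, symmetric])
  finally show ?thesis .
qed

lemma lsa_d_\<psi>:
  assumes "f \<in> carrier (lie_C i)"
  shows "lsa_d \<epsilon> S M (Suc i) (\<psi> \<epsilon> S M i f) = \<psi> \<epsilon> S M (Suc i) (lie_d \<epsilon> \<gg> N i f)"
  unfolding lsa_d_def lie_d_def
proof (rule hsum_\<psi>[OF assms])
  fix \<beta> h assume h: "h \<in> hom_deg (ext_power \<epsilon> S i) N \<beta>"
  show "lie_d_hom \<epsilon> \<gg> N i \<beta> h \<in> carrier (lie_C (Suc i))"
    by (rule Lie.hom_deg_cochain[OF Lie.lie_d_hom(1)]) (use h in \<open>simp add: ext_\<gg>\<close>)
  show "lsa_d_hom \<epsilon> S M (Suc i) \<beta> (\<psi> \<epsilon> S M i h) = \<psi> \<epsilon> S M (Suc i) (lie_d_hom \<epsilon> \<gg> N i \<beta> h)"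
    by (rule lsa_d_hom_\<psi>[OF h])
qed (rule Lie.lie_d_hom_zero)

lemma homog_part_\<gg>: "homog_part \<gg> = homog_part S"
  by (simp add: fun_eq_iff homog_part_def)

lemma \<xi>_homog_carrier:
  assumes f: "f \<in> carrier (lie_C i)" and u: "u \<in> grade S a"
  shows "hsum (lie_C i) f (\<lambda>\<beta> h. \<xi>_hom \<epsilon> \<gg> N i a u \<beta> h) \<in> carrier (lie_C i)"
  unfolding hsum_def using Lie.C.homog_part(2)[OF f] u
  by (intro Lie.C.subspace_sum[OF Lie.C.subspace_carrier] Lie.hom_deg_cochain[OF Lie.\<xi>_hom(1)]) simp_all

lemma \<xi>_carrier:
  assumes "f \<in> carrier (lie_C i)"
  shows "\<xi> \<epsilon> \<gg> N i y f \<in> carrier (lie_C i)"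
  unfolding \<xi>_def hsum_def[of \<gg>] homog_part_\<gg>
  by (intro Lie.C.subspace_sum[OF Lie.C.subspace_carrier] \<xi>_homog_carrier[OF assms] S.homog_part(2))
    (simp add: S.carrier_UNIV)

text \<open>Two extensions are nested, over the components of y and inside over those of f.
  \<open>hsum_\<psi>\<close> handles the inner one, additivity of \<open>\<psi>\<close> the outer
  one.\<close>

lemma \<rho>_\<psi>:
  assumes f: "f \<in> carrier (lie_C i)"
  shows "\<rho> \<epsilon> S M i y (\<psi> \<epsilon> S M i f) = \<psi> \<epsilon> S M i (\<xi> \<epsilon> \<gg> N i y f)"
proof -
  have y: "homog_part S y a \<in> grade S a" for a
    by (rule S.homog_part(2)) (simp add: S.carrier_UNIV)
  have "hsum (lsa_C (Suc i)) (\<psi> \<epsilon> S M i f) (\<lambda>\<beta> h. \<rho>_hom \<epsilon> S M i a u \<beta> h) =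
      \<psi> \<epsilon> S M i (hsum (lie_C i) f (\<lambda>\<beta> h. \<xi>_hom \<epsilon> \<gg> N i a u \<beta> h))"
    if u: "u \<in> grade S a" for u a
  proof (rule hsum_\<psi>[OF f])
    fix \<beta> h assume h: "h \<in> hom_deg (ext_power \<epsilon> S i) N \<beta>"
    show "\<xi>_hom \<epsilon> \<gg> N i a u \<beta> h \<in> carrier (lie_C i)"
      by (rule Lie.hom_deg_cochain[OF Lie.\<xi>_hom(1)]) (use h u in \<open>simp_all add: ext_\<gg>\<close>)
    show "\<rho>_hom \<epsilon> S M i a u \<beta> (\<psi> \<epsilon> S M i h) = \<psi> \<epsilon> S M i (\<xi>_hom \<epsilon> \<gg> N i a u \<beta> h)"
      by (rule \<rho>_hom_\<psi>[OF u h])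
  qed (use u in \<open>simp add: Lie.\<xi>_hom_zero\<close>)
  then show ?thesis
    unfolding \<rho>_def \<xi>_def hsum_def[of \<gg>] hsum_def[of S] homog_part_\<gg>
    using y by (simp add: \<psi>_sum \<xi>_homog_carrier[OF f])
qed

lemma module_iso_\<psi>:
  "module_iso \<gg> (with_action (lie_C i) (\<xi> \<epsilon> \<gg> N i))
    (with_action (lsa_C (Suc i)) (\<rho> \<epsilon> S M i)) (\<psi> \<epsilon> S M i)"
proof -
  have "\<rho> \<epsilon> S M i y h \<in> carrier (lsa_C (Suc i))"
    if h: "h \<in> carrier (lsa_C (Suc i))" for y h
  proof -
    obtain f where f: "f \<in> carrier (lie_C i)" "h = \<psi> \<epsilon> S M i f"
      using h \<psi>_bij[of i] by (auto simp: bij_betw_def)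
    show ?thesis
      unfolding f(2) \<rho>_\<psi>[OF f(1)] by (rule \<psi>(1)[OF \<xi>_carrier[OF f(1)]])
  qed
  moreover have "\<psi> \<epsilon> S M i ` grade (lie_C i) \<gamma> = grade (lsa_C (Suc i)) \<gamma>" for \<gamma>
    by (simp add: ext_\<gg> \<psi>_grade)
  ultimately show ?thesis
    using linear_iso_\<psi>[of i] \<xi>_carrier \<rho>_\<psi>
    unfolding module_iso_def by (simp add: with_action_def linear_iso_def)
qed

end


section \<open>Cohomology\<close>

text \<open>In the application D is the space of all cochains, with the kernel as carrier of C and
  the coboundaries as B. Taking preimages under \<phi> sends cosets back to cosets, without a choice
  of representatives.\<close>

lemma isomorphic_quotient:
  fixes C :: "('k::field, 'g, 'v::ab_group_add, 'y) gspace_scheme"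
    and C' :: "('k, 'h, 'w::ab_group_add, 'z) gspace_scheme"
  assumes C: "vector_space (vscale C)" "module.subspace (vscale C) D"
    and C': "vector_space (vscale C')"
    and inj: "inj_on \<phi> D"
    and add: "\<And>x y. x \<in> D \<Longrightarrow> y \<in> D \<Longrightarrow> \<phi> (x + y) = \<phi> x + \<phi> y"
    and scale: "\<And>c x. x \<in> D \<Longrightarrow> \<phi> (vscale C c x) = vscale C' c (\<phi> x)"
    and B: "module.subspace (vscale C) B" "B \<subseteq> D"
    and Z: "carrier C \<subseteq> D" "carrier C' = \<phi> ` carrier C"
  shows "isomorphic (quotient_space C' (\<phi> ` B)) (quotient_space C B)"
proof -
  interpret C: vector_space "vscale C" by fact
  interpret C': vector_space "vscale C'" by fact
  have zero: "\<phi> 0 = 0"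
    using add[of 0 0] C.subspace_0[OF C(2)] by simp
  have diff: "\<phi> (x - y) = \<phi> x - \<phi> y" if "x \<in> D" "y \<in> D" for x y
    using add[of "x - y" y] C.subspace_diff[OF C(2) that] that by simp
  have B': "C'.subspace (\<phi> ` B)"
  proof (rule C'.subspaceI)
    show "0 \<in> \<phi> ` B"
      using zero C.subspace_0[OF B(1)] by (metis imageI)
    show "x + y \<in> \<phi> ` B" if "x \<in> \<phi> ` B" "y \<in> \<phi> ` B" for x y
    proof -
      obtain a b where "a \<in> B" "b \<in> B" "x = \<phi> a" "y = \<phi> b"
        using \<open>x \<in> \<phi> ` B\<close> \<open>y \<in> \<phi> ` B\<close> by blast
      then have "x + y = \<phi> (a + b)" "a + b \<in> B"
        using add[of a b] subsetD[OF B(2)] C.subspace_add[OF B(1)] by auto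
      then show ?thesis by blast
    qed
    show "vscale C' c x \<in> \<phi> ` B" if "x \<in> \<phi> ` B" for c x
    proof -
      obtain a where "a \<in> B" "x = \<phi> a"
        using \<open>x \<in> \<phi> ` B\<close> by blast
      then have "vscale C' c x = \<phi> (vscale C c a)" "vscale C c a \<in> B"
        using scale[of a c] subsetD[OF B(2)] C.subspace_scale[OF B(1)] by auto
      then show ?thesis by blast
    qed
  qed
  define \<Theta> where "\<Theta> X = {w \<in> D. \<phi> w \<in> X}" for X
  \<comment> \<open>Injectivity gives one inclusion. For the other, z + B stays inside D because B
    lies in the subspace D.\<close>
  have coset: "\<Theta> (coset (\<phi> ` B) (\<phi> z)) = coset B z" if z: "z \<in> D" for z
  proof (intro equalityI subsetI)
    fix w assume "w \<in> \<Theta> (coset (\<phi> ` B) (\<phi> z))"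
    then obtain b where w: "w \<in> D" and b: "b \<in> B" "\<phi> w - \<phi> z = \<phi> b"
      by (auto simp: \<Theta>_def coset_def)
    then have "\<phi> (w - z) = \<phi> b"
      using z by (simp add: diff)
    then have "w - z = b"
      using inj_onD[OF inj] subsetD[OF B(2) b(1)] C.subspace_diff[OF C(2) w z] by blast
    with b(1) show "w \<in> coset B z"
      by (simp add: coset_def)
  next
    fix w assume w: "w \<in> coset B z"
    then have "w - z \<in> B"
      by (simp add: coset_def)
    then have wD: "w \<in> D"
      using C.subspace_add[OF C(2) _ z, of "w - z"] subsetD[OF B(2)] by simp
    with \<open>w - z \<in> B\<close> z show "w \<in> \<Theta> (coset (\<phi> ` B) (\<phi> z))"
      by (auto simp: \<Theta>_def coset_def diff[symmetric])
  qed
  \<comment> \<open>Equal preimages are equal cosets of B, so their representatives differ by an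
    element of B; applying \<phi> gives back equal cosets in the target.\<close>
  have inj_\<Theta>: "coset (\<phi> ` B) (\<phi> x) = coset (\<phi> ` B) (\<phi> y)"
    if "coset B x = coset B y" "x \<in> D" "y \<in> D" for x y
  proof -
    have "x - y \<in> B"
      using that(1) by (simp add: C.coset_eq_iff[OF B(1)])
    then have "\<phi> x - \<phi> y \<in> \<phi> ` B"
      using that by (simp add: diff[symmetric])
    then show ?thesis
      by (simp add: C'.coset_eq_iff[OF B'])
  qed
  have "linear_iso (quotient_space C' (\<phi> ` B)) (quotient_space C B) \<Theta>"
    unfolding linear_iso_def
  proof (intro conjI ballI allI)
    show "bij_betw \<Theta> (carrier (quotient_space C' (\<phi> ` B))) (carrier (quotient_space C B))"
      unfolding bij_betw_def
    proof
      show "inj_on \<Theta> (carrier (quotient_space C' (\<phi> ` B)))"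
      proof (rule inj_onI)
        fix X Y assume "X \<in> carrier (quotient_space C' (\<phi> ` B))" "Y \<in> carrier (quotient_space C' (\<phi> ` B))"
          and eq: "\<Theta> X = \<Theta> Y"
        then obtain x y where xy: "X = coset (\<phi> ` B) (\<phi> x)" "x \<in> D" "Y = coset (\<phi> ` B) (\<phi> y)" "y \<in> D"
          using Z by (auto simp: quotient_space_def)
        show "X = Y"
          unfolding xy(1,3) by (rule inj_\<Theta>) (use eq xy in \<open>simp_all add: coset\<close>)
      qed
      show "\<Theta> ` carrier (quotient_space C' (\<phi> ` B)) = carrier (quotient_space C B)"
        using Z(1) unfolding quotient_space_def gspace.select_convs Z(2) image_image
        by (intro image_cong refl coset) blast
    qed
  next
    fix X Y assume "X \<in> carrier (quotient_space C' (\<phi> ` B))" "Y \<in> carrier (quotient_space C' (\<phi> ` B))"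
    then obtain x y where "X = coset (\<phi> ` B) (\<phi> x)" "x \<in> D" "Y = coset (\<phi> ` B) (\<phi> y)" "y \<in> D"
      using Z by (auto simp: quotient_space_def)
    then show "\<Theta> (vadd (quotient_space C' (\<phi> ` B)) X Y) = vadd (quotient_space C B) (\<Theta> X) (\<Theta> Y)"
      by (simp add: quotient_space_def C'.coset_Union_add[OF B'] C.coset_Union_add[OF B(1)] coset
          add[symmetric] C.subspace_add[OF C(2)])
  next
    fix c X assume "X \<in> carrier (quotient_space C' (\<phi> ` B))"
    then obtain x where "X = coset (\<phi> ` B) (\<phi> x)" "x \<in> D"
      using Z by (auto simp: quotient_space_def)
    then show "\<Theta> (vscale (quotient_space C' (\<phi> ` B)) c X) = vscale (quotient_space C B) c (\<Theta> X)"
      by (simp add: quotient_space_def C'.coset_Union_scale[OF B'] C.coset_Union_scale[OF B(1)] coset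
          scale[symmetric] C.subspace_scale[OF C(2)])
  qed
  then show ?thesis
    unfolding isomorphic_def by blast
qed

context lsa_with_bimodule
begin

lemma \<psi>_onto: "carrier (lsa_C (Suc i)) = \<psi> \<epsilon> S M i ` carrier (lie_C i)"
  using \<psi>_bij[of i] by (simp add: bij_betw_def)

lemma lsa_d_image:
  "lsa_d \<epsilon> S M (Suc i) ` carrier (lsa_C (Suc i)) =
    \<psi> \<epsilon> S M (Suc i) ` lie_d \<epsilon> \<gg> N i ` carrier (lie_C i)"
  unfolding \<psi>_onto image_image by (intro image_cong refl lsa_d_\<psi>)

lemma isomorphic_cohomology:
  "isomorphic (lsa_cohomology \<epsilon> S M (Suc (Suc i))) (lie_cohomology \<epsilon> \<gg> N (Suc i))"
proof -
  let ?C = "lie_C (Suc i)" and ?C' = "lsa_C (Suc (Suc i))"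
  have inj: "inj_on (\<psi> \<epsilon> S M j) (carrier (lie_C j))" for j
    using \<psi>_bij[of j] by (simp add: bij_betw_def)
  \<comment> \<open>The coboundary of an image is itself an image, under \<open>\<psi>\<close> one
    degree higher, and that map is injective as well.\<close>
  have ker_iff: "lsa_d \<epsilon> S M (Suc (Suc i)) (\<psi> \<epsilon> S M (Suc i) f) = 0 \<longleftrightarrow> lie_d \<epsilon> \<gg> N (Suc i) f = 0"
    if f: "f \<in> carrier ?C" for f
    unfolding lsa_d_\<psi>[OF f]
    using inj_onD[OF inj, of "Suc (Suc i)" "lie_d \<epsilon> \<gg> N (Suc i) f" 0] Lie.lie_d_carrier[OF f]
      Lie.C.subspace_0[OF Lie.C.subspace_carrier] \<psi>_zero by metis
  have kernel: "{h \<in> carrier ?C'. lsa_d \<epsilon> S M (Suc (Suc i)) h = 0} =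
      \<psi> \<epsilon> S M (Suc i) ` {f \<in> carrier ?C. lie_d \<epsilon> \<gg> N (Suc i) f = 0}"
    unfolding \<psi>_onto by (auto simp: ker_iff)
  have sel: "carrier (C\<lparr>carrier := X, grade := G\<rparr>) = X" "vscale (C\<lparr>carrier := X, grade := G\<rparr>) = vscale C"
    for C :: "('a, 'b, 'c) gspace" and X G
    by simp_all
  show ?thesis
    unfolding lsa_cohomology_def lie_cohomology_def cohomology_space_def nat.case(2) diff_Suc_1 lsa_d_image
  \<comment> \<open>The carriers of the compared records have been cut down to the kernels, so the
    full cochain space is supplied as D.\<close>
  proof (rule isomorphic_quotient[where D = "carrier ?C"], unfold sel)
    show "vector_space (vscale ?C)" "vector_space (vscale ?C')"
      by (rule Lie.C.vector_space_axioms SC.vector_space_axioms)+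
    show "module.subspace (vscale ?C) (carrier ?C)"
      by (rule Lie.C.subspace_carrier)
    show "inj_on (\<psi> \<epsilon> S M (Suc i)) (carrier ?C)"
      by (rule inj)
    show "\<psi> \<epsilon> S M (Suc i) (f + g) = \<psi> \<epsilon> S M (Suc i) f + \<psi> \<epsilon> S M (Suc i) g"
      if "f \<in> carrier ?C" "g \<in> carrier ?C" for f g
      by (rule \<psi>_add[OF that])
    show "\<psi> \<epsilon> S M (Suc i) (vscale ?C c f) = vscale ?C' c (\<psi> \<epsilon> S M (Suc i) f)" if "f \<in> carrier ?C" for c f
      using \<psi>_scale[OF that] by simp
    show "module.subspace (vscale ?C) (lie_d \<epsilon> \<gg> N i ` carrier (lie_C i))"
      using Lie.subspace_lie_d_image[of i] by simp
    show "lie_d \<epsilon> \<gg> N i ` carrier (lie_C i) \<subseteq> carrier ?C"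
      using Lie.lie_d_carrier by blast
    show "{f \<in> carrier ?C. lie_d \<epsilon> \<gg> N (Suc i) f = 0} \<subseteq> carrier ?C"
      by blast
    show "{h \<in> carrier ?C'. lsa_d \<epsilon> S M (Suc (Suc i)) h = 0} =
        \<psi> \<epsilon> S M (Suc i) ` {f \<in> carrier ?C. lie_d \<epsilon> \<gg> N (Suc i) f = 0}"
      by (rule kernel)
  qed
qed

lemma lsa_d_carrier:
  "lsa_d \<epsilon> S M (Suc i) ` carrier (lsa_C (Suc i)) \<subseteq> carrier (lsa_C (Suc (Suc i)))"
  unfolding lsa_d_image using \<psi>(1)[OF Lie.lie_d_carrier] by blast

end

theorem theorem4p1:
  fixes \<epsilon> :: "'g::ab_group_add \<Rightarrow> 'g \<Rightarrow> 'k::field_char_0"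
    and S :: "('k, 'g, 's::ab_group_add) galgebra"
    and M :: "('k, 'g, 'm::ab_group_add, 's) gbimodule"
  assumes "commutation_factor \<epsilon>"
    and "gen_lsa \<epsilon> S" and "finite_dim S"
    and "lsa_bimodule \<epsilon> S M" and "finite_dim M"
  shows
    "let \<gg> = lie_algebra_of \<epsilon> S; N = C1_module \<epsilon> S M in
      (\<forall>i>0. module_iso \<gg>
         (with_action (lie_cochains \<epsilon> \<gg> N i) (\<xi> \<epsilon> \<gg> N i))
         (with_action (lsa_cochains \<epsilon> S M (i + 1)) (\<rho> \<epsilon> S M i))
         (\<psi> \<epsilon> S M i)) \<and>
      (\<forall>i. linear_iso (lie_cochains \<epsilon> \<gg> N i) (lsa_cochains \<epsilon> S M (i + 1)) (\<psi> \<epsilon> S M i) \<and>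
         lie_d \<epsilon> \<gg> N i ` carrier (lie_cochains \<epsilon> \<gg> N i) \<subseteq> carrier (lie_cochains \<epsilon> \<gg> N (i + 1)) \<and>
         lsa_d \<epsilon> S M (i + 1) ` carrier (lsa_cochains \<epsilon> S M (i + 1))
           \<subseteq> carrier (lsa_cochains \<epsilon> S M (i + 2)) \<and>
         (\<forall>f\<in>carrier (lie_cochains \<epsilon> \<gg> N i).
            \<psi> \<epsilon> S M (i + 1) (lie_d \<epsilon> \<gg> N i f) = lsa_d \<epsilon> S M (i + 1) (\<psi> \<epsilon> S M i f))) \<and>
      (\<forall>i>0. isomorphic (lsa_cohomology \<epsilon> S M (i + 1)) (lie_cohomology \<epsilon> \<gg> N i))"
proof -
  interpret lsa_with_bimodule \<epsilon> S M
    by standard fact+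
  \<comment> \<open>For positive i both quotients divide by the image of the preceding coboundary,
    the form in which \<open>\<psi>\<close> compares them.\<close>
  have "isomorphic (lsa_cohomology \<epsilon> S M (Suc i)) (lie_cohomology \<epsilon> \<gg> N i)" if "i > 0" for i
    using that isomorphic_cohomology by (cases i) simp_all
  then show ?thesis
    unfolding Let_def Suc_eq_plus1[symmetric] add_2_eq_Suc'
    using module_iso_\<psi> linear_iso_\<psi> lsa_d_carrier Lie.lie_d_carrier lsa_d_\<psi> by (simp add: image_subset_iff)
qed

end
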